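(* Let $Y$ have law $\mathrm{BESQ}^\delta_y$ with $\delta>0$ and $y\in\mathbb{R}_+$ arbitrary. Let $\alpha\in\mathbb{R}_+$, $\gamma\in(-\alpha,\infty)$, and $A_t:=\int_1^t s^\gamma Y_s^\alpha\,ds$ for $t\ge1$. Then: (a) $\displaystyle\lim_{t\to\infty}\frac{\log A_t}{\log t}=1+\gamma+\alpha$ a.s.; (b) if $\widetilde{Y}$ has law $\mathrm{BESQ}^\delta_0$, then $A_t/t^{1+\gamma+\alpha}\xrightarrow{d}\int_0^1 s^\gamma\widetilde{Y}_s^\alpha\,ds$ as $t\to\infty$; (c) $\sup_{t\ge1}\mathbb{E}[A_t]/t^{1+\gamma+\alpha}<\infty$.
   Context: $\mathbb{R}_+=[0,\infty)$. For $\delta>0$ and $y\in\mathbb{R}_+$, $\mathrm{BESQ}^\delta_y$ is the law of the squared-Bessel process of dimension $\delta$ started at $y$, i.e. the unique strong solution of $dY_t=\delta\,dt+2|Y_t|^{1/2}\,dW_t$, $Y_0=y$, with $W$ a Brownian motion. *)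

theory Defs
  imports "HOL-Probability.Probability"
begin

text \<open>Real power with the convention x^0 = 1 (also for x = 0), as in the paper's Y_s^alpha.\<close>
definition rpow0 :: "real \<Rightarrow> real \<Rightarrow> real" where
  "rpow0 x a = (if a = 0 then 1 else x powr a)"

definition filtration_on :: "'a measure \<Rightarrow> (real \<Rightarrow> 'a set set) \<Rightarrow> bool" where
  "filtration_on M F \<longleftrightarrow>
     (\<forall>t\<ge>0. sigma_algebra (space M) (F t) \<and> F t \<subseteq> sets M) \<and>
     (\<forall>s t. 0 \<le> s \<longrightarrow> s \<le> t \<longrightarrow> F s \<subseteq> F t)"

definition adapted_to :: "'a measure \<Rightarrow> (real \<Rightarrow> 'a set set) \<Rightarrow> (real \<Rightarrow> 'a \<Rightarrow> real) \<Rightarrow> bool" where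
  "adapted_to M F X \<longleftrightarrow>
     (\<forall>t\<ge>0. \<forall>B\<in>sets borel. (X t -` B \<inter> space M) \<in> F t)"

definition brownian_motion :: "'a measure \<Rightarrow> (real \<Rightarrow> 'a set set) \<Rightarrow> (real \<Rightarrow> 'a \<Rightarrow> real) \<Rightarrow> bool" where
  "brownian_motion M F W \<longleftrightarrow>
     prob_space M \<and> filtration_on M F \<and> adapted_to M F W \<and>
     (\<forall>\<omega>\<in>space M. W 0 \<omega> = 0 \<and> continuous_on {0..} (\<lambda>t. W t \<omega>)) \<and>
     (\<forall>s t. 0 \<le> s \<longrightarrow> s < t \<longrightarrow>
        distributed M lborel (\<lambda>\<omega>. W t \<omega> - W s \<omega>) (\<lambda>x. ennreal (normal_density 0 (sqrt (t - s)) x)) \<and>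
        (\<forall>A\<in>F s. \<forall>B\<in>sets borel.
           measure M (A \<inter> {\<omega>\<in>space M. W t \<omega> - W s \<omega> \<in> B})
             = measure M A * measure M {\<omega>\<in>space M. W t \<omega> - W s \<omega> \<in> B}))"

definition conv_in_prob :: "'a measure \<Rightarrow> (nat \<Rightarrow> 'a \<Rightarrow> real) \<Rightarrow> ('a \<Rightarrow> real) \<Rightarrow> bool" where
  "conv_in_prob M X L \<longleftrightarrow>
     (\<forall>e>0. (\<lambda>n. measure M {\<omega>\<in>space M. \<bar>X n \<omega> - L \<omega>\<bar> > e}) \<longlonglongrightarrow> 0)"

definition ito_sum :: "(real \<Rightarrow> 'a \<Rightarrow> real) \<Rightarrow> (real \<Rightarrow> 'a \<Rightarrow> real) \<Rightarrow> real \<Rightarrow> nat \<Rightarrow> 'a \<Rightarrow> real" where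
  "ito_sum H W t n \<omega> =
     (\<Sum>k<2^n. H (real k * t / 2^n) \<omega> *
                 (W (real (Suc k) * t / 2^n) \<omega> - W (real k * t / 2^n) \<omega>))"

text \<open>Y solves dY_t = delta dt + 2 |Y_t|^(1/2) dW_t, Y_0 = y, driven by the (F_t)-Brownian motion W:
  Y is continuous and adapted, and for every t the Ito integral int_0^t |Y_s|^(1/2) dW_s
  (the limit in probability of the left-point Riemann sums, which is the Ito integral for a
  continuous adapted integrand) satisfies Y_t = y + delta t + 2 int_0^t |Y_s|^(1/2) dW_s a.s.
  By pathwise uniqueness (Yamada-Watanabe) every such Y has law BESQ^delta_y.\<close>
definition besq_solution ::
  "'a measure \<Rightarrow> (real \<Rightarrow> 'a set set) \<Rightarrow> (real \<Rightarrow> 'a \<Rightarrow> real) \<Rightarrow> real \<Rightarrow> real \<Rightarrow> (real \<Rightarrow> 'a \<Rightarrow> real) \<Rightarrow> bool" where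
  "besq_solution M F W \<delta> y Y \<longleftrightarrow>
     brownian_motion M F W \<and> adapted_to M F Y \<and>
     (\<forall>\<omega>\<in>space M. continuous_on {0..} (\<lambda>t. Y t \<omega>)) \<and>
     (\<forall>t\<ge>0. \<exists>I. I \<in> borel_measurable M \<and>
        conv_in_prob M (ito_sum (\<lambda>s \<omega>. sqrt \<bar>Y s \<omega>\<bar>) W t) I \<and>
        (AE \<omega> in M. Y t \<omega> = y + \<delta> * t + 2 * I \<omega>))"

definition conv_distr_at_top ::
  "'a measure \<Rightarrow> (real \<Rightarrow> 'a \<Rightarrow> real) \<Rightarrow> 'b measure \<Rightarrow> ('b \<Rightarrow> real) \<Rightarrow> bool" where
  "conv_distr_at_top M X N Z \<longleftrightarrow>
     (\<forall>f::real \<Rightarrow> real. continuous_on UNIV f \<and> (\<exists>B. \<forall>x. \<bar>f x\<bar> \<le> B) \<longrightarrow>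
        ((\<lambda>t. integral\<^sup>L M (\<lambda>\<omega>. f (X t \<omega>))) \<longlongrightarrow> integral\<^sup>L N (\<lambda>\<omega>. f (Z \<omega>))) at_top)"

end

theory Submission imports Defs begin

text \<open>
  For a bounded test function the Riemann sums defining the Ito integral, with truncated integrand,
  give Dynkin's formula for \<open>Y\<close> directly; no stochastic calculus beyond the isometry of
  discrete sums is used. A Yamada--Watanabe type test function yields \<open>Y \<ge> 0\<close> a.s., and the
  exponentials yield the conditional Laplace transform
  \<open>E[exp (- l Y\<^sub>T) | F\<^sub>s] = (1 + 2l(T-s))\<^sup>-\<^sup>\<delta>\<^sup>/\<^sup>2 exp (- l Y\<^sub>s / (1 + 2l(T-s)))\<close>,
  hence the finite-dimensional distributions, their scaling, and \<open>E[Y\<^sub>t\<^sup>\<alpha>] \<le> C t\<^sup>\<alpha>\<close>, which gives (c).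

  For (a), the integrals over \<open>[1,\<infinity>)\<close> of \<open>s\<^sup>\<gamma>\<^sup>-\<^sup>k Y\<^sub>s\<^sup>\<alpha>\<close> with \<open>k > 1 + \<gamma> + \<alpha>\<close> and of
  \<open>s\<^sup>-\<^sup>1 exp (- Y\<^sub>s s\<^sup>\<eta>\<^sup>-\<^sup>1)\<close> with \<open>\<eta> > 0\<close> have finite expectation. Finiteness of the first bounds \<open>A\<^sub>t\<close>
  from above; finiteness of the second says that \<open>Y\<^sub>s\<close> is rarely below \<open>s\<^sup>1\<^sup>-\<^sup>\<eta>\<close>, in logarithmic scale,
  and so bounds \<open>A\<^sub>t\<close> from below.

  For (b), \<open>A\<^sub>t / t\<^sup>1\<^sup>+\<^sup>\<gamma>\<^sup>+\<^sup>\<alpha>\<close> is the integral of \<open>s\<^sup>\<gamma> X\<^sub>s\<^sup>\<alpha>\<close> over \<open>[1/t,1]\<close> for the rescaled process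
  \<open>X\<^sub>s = Y\<^sub>t\<^sub>s / t\<close>. Away from \<open>s = 0\<close> and for \<open>X\<close> truncated, Weierstrass replaces \<open>X\<^sub>s\<^sup>\<alpha>\<close> by a polynomial in
  \<open>exp (- X\<^sub>s)\<close>; the moments of the resulting bounded integral are mixtures of Laplace transforms of
  finite-dimensional distributions, so they converge, and the errors are controlled in \<open>L\<^sup>1\<close>.
\<close>

section \<open>Discrete integrals against Brownian motion\<close>

text \<open>The solution property gives the stochastic integral one time at a time: for each t, a
  limit in probability of left-point sums over the dyadic partition of [0,t], without an integral
  process and without a common grid for different times. An argument by increments needs one grid,
  so the sum with mesh 2^-n up to j/2^n is compared with the sums that define the integral up to
  this time: both coarsen a grid of mesh 2^-(n+m), on which the isometry measures their distance.

  The Markov property and uniqueness in law are not taken as known. Their work is done by a weight X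
  inside the expectation, bounded by 1 and measurable at time s: with X a product of exponentials of
  earlier values, joint Laplace transforms are computed by removing the last time again and again.
  In (b) the two processes live on different spaces and are never coupled; they meet only in these
  transforms, which for the process rescaled by c have the form C exp (- \<nu> y / c), with the same
  C as for the process from 0.\<close>

locale filtered_bm =
  fixes M :: "'a measure" and F :: "real \<Rightarrow> 'a set set" and W :: "real \<Rightarrow> 'a \<Rightarrow> real"
  assumes bm: "brownian_motion M F W"
begin

sublocale prob_space M
  using bm by (simp add: brownian_motion_def)

text \<open>Wrapping the set system \<open>F t\<close> as a measure makes adaptedness an instance of
  ordinary measurability of functions.\<close>

definition Fm :: "real \<Rightarrow> 'a measure" where
  "Fm t = sigma (space M) (F t)"

lemma sigma_algebra_F: "0 \<le> t \<Longrightarrow> sigma_algebra (space M) (F t)"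
  and F_subset: "0 \<le> t \<Longrightarrow> F t \<subseteq> sets M"
  and F_mono: "0 \<le> s \<Longrightarrow> s \<le> t \<Longrightarrow> F s \<subseteq> F t"
  using bm by (simp_all add: brownian_motion_def filtration_on_def)

lemma space_Fm [simp]: "space (Fm t) = space M"
  by (simp add: Fm_def space_measure_of_conv)

lemma sets_Fm: "0 \<le> t \<Longrightarrow> sets (Fm t) = F t"
  by (simp add: Fm_def sigma_algebra.sets_measure_of_eq sigma_algebra_F)

lemma subalgebra_Fm: "0 \<le> t \<Longrightarrow> subalgebra M (Fm t)"
  by (simp add: subalgebra_def sets_Fm F_subset)

lemma measurable_FmD: "X \<in> measurable (Fm t) N \<Longrightarrow> 0 \<le> t \<Longrightarrow> X \<in> measurable M N"
  by (rule measurable_from_subalg[OF subalgebra_Fm])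

lemma measurable_Fm_mono:
  assumes "X \<in> measurable (Fm s) N" "0 \<le> s" "s \<le> t"
  shows "X \<in> measurable (Fm t) N"
proof (rule measurable_from_subalg[OF _ assms(1)])
  show "subalgebra (Fm t) (Fm s)"
    using F_mono[OF assms(2,3)] assms by (simp add: subalgebra_def sets_Fm)
qed

lemma adapted_measurable:
  assumes "adapted_to M F X" "0 \<le> t"
  shows "X t \<in> borel_measurable (Fm t)"
  using assms by (auto simp: measurable_def adapted_to_def sets_Fm)

lemma W_measurable: "0 \<le> t \<Longrightarrow> W t \<in> borel_measurable (Fm t)"
  using bm by (intro adapted_measurable) (simp_all add: brownian_motion_def)

lemma W_measurable_M [measurable]: "0 \<le> t \<Longrightarrow> W t \<in> borel_measurable M"
  using W_measurable measurable_FmD by blast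

lemma increment_distributed:
  assumes "0 \<le> s" "s < t"
  shows "distributed M lborel (\<lambda>\<omega>. W t \<omega> - W s \<omega>) (\<lambda>x. ennreal (normal_density 0 (sqrt (t - s)) x))"
  using bm assms by (simp add: brownian_motion_def)

text \<open>\<open>brownian_motion\<close> only provides the product rule for single events.
  Preimages under X lie in \<open>F s\<close>, and preimages under one function are stable under
  intersection, so the rule extends to the generated sigma-algebras.\<close>

lemma indep_increment:
  assumes X: "X \<in> borel_measurable (Fm s)" and st: "0 \<le> s" "s < t"
  shows "indep_var borel X borel (\<lambda>\<omega>. W t \<omega> - W s \<omega>)"
proof -
  have rX: "random_variable borel X"
    using measurable_FmD[OF X] st by simp
  have rD: "random_variable borel (\<lambda>\<omega>. W t \<omega> - W s \<omega>)"
    using st by (intro borel_measurable_diff W_measurable_M) auto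
  have "indep_set {X -` A \<inter> space M |A. A \<in> sets borel}
      {(\<lambda>\<omega>. W t \<omega> - W s \<omega>) -` A \<inter> space M |A. A \<in> sets borel}"
  proof (rule indep_setI)
    show "{X -` A \<inter> space M |A. A \<in> sets borel} \<subseteq> events"
      using rX by (auto intro: measurable_sets)
    show "{(\<lambda>\<omega>. W t \<omega> - W s \<omega>) -` A \<inter> space M |A. A \<in> sets borel} \<subseteq> events"
      using rD by (auto intro: measurable_sets)
    fix a b assume "a \<in> {X -` A \<inter> space M |A. A \<in> sets borel}"
      and "b \<in> {(\<lambda>\<omega>. W t \<omega> - W s \<omega>) -` A \<inter> space M |A. A \<in> sets borel}"
    then obtain A B where a: "a = X -` A \<inter> space M" "A \<in> sets borel"
      and b: "b = (\<lambda>\<omega>. W t \<omega> - W s \<omega>) -` B \<inter> space M" "B \<in> sets borel"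
      by auto
    have aF: "a \<in> F s"
      using measurable_sets[OF X a(2)] a(1) st by (simp add: sets_Fm)
    have "\<forall>A\<in>F s. \<forall>B\<in>sets borel.
           measure M (A \<inter> {\<omega>\<in>space M. W t \<omega> - W s \<omega> \<in> B})
             = measure M A * measure M {\<omega>\<in>space M. W t \<omega> - W s \<omega> \<in> B}"
      using bm st unfolding brownian_motion_def by blast
    moreover have "b = {\<omega>\<in>space M. W t \<omega> - W s \<omega> \<in> B}"
      using b by auto
    ultimately show "prob (a \<inter> b) = prob a * prob b"
      using aF b(2) by auto
  qed
  moreover have "Int_stable {X -` A \<inter> space M |A. A \<in> sets borel}" for X :: "'a \<Rightarrow> real"
  proof (safe intro!: Int_stableI)
    fix A B :: "real set" assume "A \<in> sets borel" "B \<in> sets borel"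
    then show "\<exists>C. (X -` A \<inter> space M) \<inter> (X -` B \<inter> space M) = (X -` C \<inter> space M) \<and> C \<in> sets borel"
      by (intro exI[of _ "A \<inter> B"]) auto
  qed
  ultimately show ?thesis
    unfolding indep_var_eq using rX rD by (intro conjI indep_set_sigma_sets) blast+
qed

text \<open>Stands in for conditional expectation given time s: with \<phi> the identity the term
  disappears, with \<phi> the square the squared increment is replaced by t - s.\<close>

lemma increment_product:
  fixes \<phi> :: "real \<Rightarrow> real"
  assumes X: "X \<in> borel_measurable (Fm s)" "integrable M X" and st: "0 \<le> s" "s < t"
    and \<phi>: "\<phi> \<in> borel_measurable borel" "integrable M (\<lambda>\<omega>. \<phi> (W t \<omega> - W s \<omega>))"
  shows "integrable M (\<lambda>\<omega>. X \<omega> * \<phi> (W t \<omega> - W s \<omega>))"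
    and "expectation (\<lambda>\<omega>. X \<omega> * \<phi> (W t \<omega> - W s \<omega>)) = expectation X * expectation (\<lambda>\<omega>. \<phi> (W t \<omega> - W s \<omega>))"
proof -
  have "indep_var borel (id \<circ> X) borel (\<phi> \<circ> (\<lambda>\<omega>. W t \<omega> - W s \<omega>))"
    by (rule indep_var_compose[OF indep_increment[OF X(1) st]]) (use \<phi> in auto)
  then have i: "indep_var borel X borel (\<lambda>\<omega>. \<phi> (W t \<omega> - W s \<omega>))"
    by (simp add: comp_def)
  show "integrable M (\<lambda>\<omega>. X \<omega> * \<phi> (W t \<omega> - W s \<omega>))"
    by (rule indep_var_integrable[OF i X(2) \<phi>(2)])
  show "expectation (\<lambda>\<omega>. X \<omega> * \<phi> (W t \<omega> - W s \<omega>)) = expectation X * expectation (\<lambda>\<omega>. \<phi> (W t \<omega> - W s \<omega>))"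
    by (rule indep_var_lebesgue_integral[OF i X(2) \<phi>(2)])
qed

text \<open>The third absolute moment is there for the Taylor remainder in \<open>one_step\<close>.
  Only its order (t - s)^(3/2) matters, so the factor sqrt (2 / pi) is bounded by 1.\<close>

lemma increment_moments:
  assumes st: "0 \<le> s" "s < t"
  shows "integrable M (\<lambda>\<omega>. \<bar>W t \<omega> - W s \<omega>\<bar> ^ k)"
    and "integrable M (\<lambda>\<omega>. (W t \<omega> - W s \<omega>) ^ k)"
    and "expectation (\<lambda>\<omega>. W t \<omega> - W s \<omega>) = 0"
    and "expectation (\<lambda>\<omega>. (W t \<omega> - W s \<omega>)\<^sup>2) = t - s"
    and "expectation (\<lambda>\<omega>. \<bar>W t \<omega> - W s \<omega>\<bar> ^ 3) \<le> 2 * (t - s) * sqrt (t - s)"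
proof -
  let ?\<sigma> = "sqrt (t - s)"
  have \<sigma>: "?\<sigma> > 0" using st by simp
  note D = increment_distributed[OF st]
  show "integrable M (\<lambda>\<omega>. \<bar>W t \<omega> - W s \<omega>\<bar> ^ k)"
    using distributed_integrable[OF D, of "\<lambda>x. \<bar>x\<bar> ^ k"] integrable_normal_moment_abs[OF \<sigma>, of 0 k] by simp
  show "integrable M (\<lambda>\<omega>. (W t \<omega> - W s \<omega>) ^ k)"
    using distributed_integrable[OF D, of "\<lambda>x. x ^ k"] integrable_normal_moment[OF \<sigma>, of 0 k] by simp
  show "expectation (\<lambda>\<omega>. W t \<omega> - W s \<omega>) = 0"
    using distributed_integral[OF D, of "\<lambda>x. x"] integral_normal_moment_odd[OF \<sigma>, of 0 0] by simp
  show "expectation (\<lambda>\<omega>. (W t \<omega> - W s \<omega>)\<^sup>2) = t - s"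
    using distributed_integral[OF D, of "\<lambda>x. x^2"] integral_normal_moment_even[OF \<sigma>, of 0 1] st by simp
  have "expectation (\<lambda>\<omega>. \<bar>W t \<omega> - W s \<omega>\<bar> ^ 3) = 2 * ?\<sigma> ^ 3 * sqrt (2 / pi)"
    using distributed_integral[OF D, of "\<lambda>x. \<bar>x\<bar> ^ 3"] integral_normal_moment_abs_odd[OF \<sigma>, of 0 1] by simp
  also have "?\<sigma> ^ 3 = (t - s) * ?\<sigma>"
    using st by (simp add: power3_eq_cube)
  also have "2 * ((t - s) * ?\<sigma>) * sqrt (2 / pi) \<le> 2 * ((t - s) * ?\<sigma>) * 1"
    using st pi_gt3 by (intro mult_left_mono) auto
  finally show "expectation (\<lambda>\<omega>. \<bar>W t \<omega> - W s \<omega>\<bar> ^ 3) \<le> 2 * (t - s) * sqrt (t - s)"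
    by (simp add: algebra_simps)
qed

lemma bounded_integrable:
  fixes X :: "'a \<Rightarrow> real"
  assumes "X \<in> borel_measurable M" "\<And>\<omega>. \<omega> \<in> space M \<Longrightarrow> \<bar>X \<omega>\<bar> \<le> B"
  shows "integrable M X"
  by (rule integrable_const_bound[where B = B]) (use assms in auto)

lemma discrete_integral_measurable:
  assumes \<eta>: "0 < \<eta>" and \<xi>: "\<And>i. i < N \<Longrightarrow> \<xi> i \<in> borel_measurable (Fm (real i * \<eta>))"
  shows "(\<lambda>\<omega>. \<Sum>i<N. \<xi> i \<omega> * (W (real (Suc i) * \<eta>) \<omega> - W (real i * \<eta>) \<omega>)) \<in> borel_measurable (Fm (real N * \<eta>))"
proof (intro borel_measurable_sum borel_measurable_times borel_measurable_diff)
  fix i assume i: "i \<in> {..<N}"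
  have "real i * \<eta> \<le> real N * \<eta>" "real (Suc i) * \<eta> \<le> real N * \<eta>"
    using i \<eta> by (auto intro!: mult_right_mono)
  then show "\<xi> i \<in> borel_measurable (Fm (real N * \<eta>))"
    "W (real i * \<eta>) \<in> borel_measurable (Fm (real N * \<eta>))"
    "W (real (Suc i) * \<eta>) \<in> borel_measurable (Fm (real N * \<eta>))"
    using i \<eta> by (auto intro: measurable_Fm_mono[OF \<xi>[of i]] measurable_Fm_mono[OF W_measurable])
qed

text \<open>Induction step of the isometry. S and X are known at time s, so the cross term 2 S X is
  multiplied by an independent increment of mean 0.\<close>

lemma increment_square_step:
  assumes S: "S \<in> borel_measurable (Fm s)" "integrable M (\<lambda>\<omega>. (S \<omega>)\<^sup>2)"
    and X: "X \<in> borel_measurable (Fm s)" "\<And>\<omega>. \<omega> \<in> space M \<Longrightarrow> \<bar>X \<omega>\<bar> \<le> B" and t: "0 \<le> s" "s < t"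
  shows "integrable M (\<lambda>\<omega>. (S \<omega> + X \<omega> * (W t \<omega> - W s \<omega>))\<^sup>2)"
    and "expectation (\<lambda>\<omega>. (S \<omega> + X \<omega> * (W t \<omega> - W s \<omega>))\<^sup>2)
      = expectation (\<lambda>\<omega>. (S \<omega>)\<^sup>2) + (t - s) * expectation (\<lambda>\<omega>. (X \<omega>)\<^sup>2)"
proof -
  let ?D = "\<lambda>\<omega>. W t \<omega> - W s \<omega>"
  note [measurable] = S(1) X(1)
  have SM [measurable]: "S \<in> borel_measurable M" by (rule measurable_FmD[OF S(1) t(1)])
  have XM [measurable]: "X \<in> borel_measurable M" by (rule measurable_FmD[OF X(1) t(1)])
  have Si: "integrable M S"
    by (rule square_integrable_imp_integrable[OF SM S(2)])
  \<comment> \<open>S is only square integrable, hence integrable; the bound on X carries this over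
    to the product.\<close>
  have Sx: "integrable M (\<lambda>\<omega>. 2 * S \<omega> * X \<omega>)"
  proof (rule Bochner_Integration.integrable_bound)
    show "integrable M (\<lambda>\<omega>. 2 * B * S \<omega>)" using Si by auto
    show "AE x in M. norm (2 * S x * X x) \<le> norm (2 * B * S x)"
    proof (rule AE_I2)
      fix x assume "x \<in> space M"
      then have "\<bar>X x\<bar> \<le> \<bar>B\<bar>" using X(2) by fastforce
      then have "\<bar>S x\<bar> * \<bar>X x\<bar> \<le> \<bar>S x\<bar> * \<bar>B\<bar>" by (rule mult_left_mono) simp
      then show "norm (2 * S x * X x) \<le> norm (2 * B * S x)" by (simp add: abs_mult mult_ac)
    qed
  qed measurable
  have x2: "integrable M (\<lambda>\<omega>. (X \<omega>)\<^sup>2)"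
  proof (rule bounded_integrable)
    fix \<omega> assume "\<omega> \<in> space M"
    then have "\<bar>X \<omega>\<bar>\<^sup>2 \<le> B\<^sup>2" by (intro power_mono X(2)) auto
    then show "\<bar>(X \<omega>)\<^sup>2\<bar> \<le> B\<^sup>2" by simp
  qed measurable
  have D2: "expectation (\<lambda>\<omega>. (?D \<omega>)\<^sup>2) = t - s" "expectation ?D = 0"
    "integrable M ?D" "integrable M (\<lambda>\<omega>. (?D \<omega>)\<^sup>2)"
    using increment_moments(3,4)[OF t] increment_moments(2)[OF t, of 1] increment_moments(2)[OF t, of 2] by simp_all
  have m1: "(\<lambda>\<omega>. 2 * S \<omega> * X \<omega>) \<in> borel_measurable (Fm s)"
    and m2: "(\<lambda>\<omega>. (X \<omega>)\<^sup>2) \<in> borel_measurable (Fm s)" by measurable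
  have i1: "integrable M (\<lambda>\<omega>. 2 * S \<omega> * X \<omega> * ?D \<omega>)"
    "expectation (\<lambda>\<omega>. 2 * S \<omega> * X \<omega> * ?D \<omega>) = expectation (\<lambda>\<omega>. 2 * S \<omega> * X \<omega>) * expectation ?D"
    by (rule increment_product[OF m1 Sx t, of "\<lambda>x. x"]; use D2 in simp)+
  have i2: "integrable M (\<lambda>\<omega>. (X \<omega>)\<^sup>2 * (?D \<omega>)\<^sup>2)"
    "expectation (\<lambda>\<omega>. (X \<omega>)\<^sup>2 * (?D \<omega>)\<^sup>2) = expectation (\<lambda>\<omega>. (X \<omega>)\<^sup>2) * expectation (\<lambda>\<omega>. (?D \<omega>)\<^sup>2)"
    by (rule increment_product[OF m2 x2 t, of "\<lambda>x. x\<^sup>2"]; use D2 in simp)+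
  have eq: "(S \<omega> + X \<omega> * ?D \<omega>)\<^sup>2 = (S \<omega>)\<^sup>2 + 2 * S \<omega> * X \<omega> * ?D \<omega> + (X \<omega>)\<^sup>2 * (?D \<omega>)\<^sup>2" for \<omega>
    by (simp add: power2_sum power_mult_distrib)
  show "integrable M (\<lambda>\<omega>. (S \<omega> + X \<omega> * ?D \<omega>)\<^sup>2)"
    unfolding eq by (intro Bochner_Integration.integrable_add S(2) i1 i2)
  show "expectation (\<lambda>\<omega>. (S \<omega> + X \<omega> * ?D \<omega>)\<^sup>2)
      = expectation (\<lambda>\<omega>. (S \<omega>)\<^sup>2) + (t - s) * expectation (\<lambda>\<omega>. (X \<omega>)\<^sup>2)"
    unfolding eq
    by (simp only: Bochner_Integration.integral_add[OF Bochner_Integration.integrable_add[OF S(2) i1(1)] i2(1)]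
        Bochner_Integration.integral_add[OF S(2) i1(1)] i1 i2 D2) simp
qed

lemma discrete_isometry:
  assumes \<eta>: "0 < \<eta>" and \<xi>: "\<And>i. i < N \<Longrightarrow> \<xi> i \<in> borel_measurable (Fm (real i * \<eta>))"
    and bd: "\<And>i \<omega>. i < N \<Longrightarrow> \<omega> \<in> space M \<Longrightarrow> \<bar>\<xi> i \<omega>\<bar> \<le> B"
  shows "integrable M (\<lambda>\<omega>. (\<Sum>i<N. \<xi> i \<omega> * (W (real (Suc i) * \<eta>) \<omega> - W (real i * \<eta>) \<omega>))\<^sup>2) \<and>
    expectation (\<lambda>\<omega>. (\<Sum>i<N. \<xi> i \<omega> * (W (real (Suc i) * \<eta>) \<omega> - W (real i * \<eta>) \<omega>))\<^sup>2)
      = (\<Sum>i<N. \<eta> * expectation (\<lambda>\<omega>. (\<xi> i \<omega>)\<^sup>2))"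
  using \<xi> bd
proof (induction N)
  case 0
  then show ?case by simp
next
  case (Suc N)
  let ?S = "\<lambda>\<omega>. \<Sum>i<N. \<xi> i \<omega> * (W (real (Suc i) * \<eta>) \<omega> - W (real i * \<eta>) \<omega>)"
  have IH: "integrable M (\<lambda>\<omega>. (?S \<omega>)\<^sup>2)"
    "expectation (\<lambda>\<omega>. (?S \<omega>)\<^sup>2) = (\<Sum>i<N. \<eta> * expectation (\<lambda>\<omega>. (\<xi> i \<omega>)\<^sup>2))"
    using Suc.IH Suc.prems by auto
  have Sm: "?S \<in> borel_measurable (Fm (real N * \<eta>))"
    by (rule discrete_integral_measurable[OF \<eta>]) (use Suc.prems in auto)
  have t: "0 \<le> real N * \<eta>" "real N * \<eta> < real (Suc N) * \<eta>" using \<eta> by auto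
  have "real (Suc N) * \<eta> - real N * \<eta> = \<eta>" by (simp add: algebra_simps)
  with increment_square_step[OF Sm IH(1) Suc.prems(1)[of N, OF lessI] Suc.prems(2)[of N, OF lessI] t] IH(2)
  show ?case unfolding sum.lessThan_Suc by (simp only:)
qed

end

section \<open>Discrete approximation of the solution with truncated integrand\<close>

locale besq_sol =
  fixes M :: "'a measure" and F :: "real \<Rightarrow> 'a set set" and W Y :: "real \<Rightarrow> 'a \<Rightarrow> real"
    and \<delta> y :: real
  assumes sol: "besq_solution M F W \<delta> y Y"
    and \<delta>_pos: "\<delta> > 0" and y_nonneg: "y \<ge> 0"
begin

sublocale filtered_bm M F W
  using sol by unfold_locales (simp add: besq_solution_def)

lemma Y_adapted: "0 \<le> t \<Longrightarrow> Y t \<in> borel_measurable (Fm t)"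
  using sol by (intro adapted_measurable) (simp_all add: besq_solution_def)

lemma Y_measurable [measurable]: "0 \<le> t \<Longrightarrow> Y t \<in> borel_measurable M"
  using Y_adapted measurable_FmD by blast

lemma Y_continuous: "\<omega> \<in> space M \<Longrightarrow> continuous_on {0..} (\<lambda>t. Y t \<omega>)"
  using sol by (simp add: besq_solution_def)

lemma Y_equation:
  assumes "0 \<le> t"
  obtains I where "I \<in> borel_measurable M"
    "conv_in_prob M (ito_sum (\<lambda>s \<omega>. sqrt \<bar>Y s \<omega>\<bar>) W t) I"
    "AE \<omega> in M. Y t \<omega> = y + \<delta> * t + 2 * I \<omega>"
  using sol assms unfolding besq_solution_def by blast

text \<open>At t = 0 all points of the partition coincide, so every Riemann sum is 0 and the limit
  in probability vanishes almost surely.\<close>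

lemma Y_start: "AE \<omega> in M. Y 0 \<omega> = y"
proof -
  obtain I where I [measurable]: "I \<in> borel_measurable M" and c: "conv_in_prob M (ito_sum (\<lambda>s \<omega>. sqrt \<bar>Y s \<omega>\<bar>) W 0) I"
    and eq: "AE \<omega> in M. Y 0 \<omega> = y + \<delta> * 0 + 2 * I \<omega>"
    using Y_equation[of 0] by auto
  have "AE \<omega> in M. \<bar>I \<omega>\<bar> \<le> 1 / real (Suc k)" for k
  proof -
    have "(\<lambda>n::nat. measure M {\<omega>\<in>space M. \<bar>0 - I \<omega>\<bar> > 1 / real (Suc k)}) \<longlonglongrightarrow> 0"
      using c unfolding conv_in_prob_def ito_sum_def by simp
    then have "measure M {\<omega>\<in>space M. \<bar>I \<omega>\<bar> > 1 / real (Suc k)} = 0"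
      by (simp add: tendsto_const_iff)
    then have "AE \<omega> in M. \<omega> \<notin> {\<omega>\<in>space M. \<bar>I \<omega>\<bar> > 1 / real (Suc k)}"
      by (subst (asm) prob_eq_0) auto
    then show ?thesis by (rule AE_mp) (auto simp: not_less)
  qed
  then have "AE \<omega> in M. \<forall>k. \<bar>I \<omega>\<bar> \<le> 1 / real (Suc k)" by (simp add: AE_all_countable)
  with eq show ?thesis
  proof eventually_elim
    case (elim \<omega>)
    have "\<bar>I \<omega>\<bar> \<le> 0"
    proof (rule LIMSEQ_le_const)
      show "(\<lambda>k. 1 / real (Suc k)) \<longlonglongrightarrow> 0" by (rule LIMSEQ_Suc[OF lim_1_over_n])
    qed (use elim in auto)
    then show ?case using elim by simp
  qed
qed

text \<open>\<open>G\<close> is the integrand truncated at level \<open>\<kappa>\<close>; on \<open>Om (\<kappa>\<^sup>2) r\<close> the truncation is inactive up to time \<open>r\<close>.\<close>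

definition G :: "real \<Rightarrow> real \<Rightarrow> 'a \<Rightarrow> real" where
  "G \<kappa> s \<omega> = min (sqrt \<bar>Y s \<omega>\<bar>) \<kappa>"

definition Om :: "real \<Rightarrow> real \<Rightarrow> 'a set" where
  "Om K r = {\<omega>\<in>space M. \<forall>q\<in>{0..r}. \<bar>Y q \<omega>\<bar> \<le> K}"

text \<open>Here the mesh \<eta> and the number of steps are independent parameters, whereas
  \<open>ito_sum\<close> ties its mesh to the end time.\<close>

definition dsum :: "(real \<Rightarrow> 'a \<Rightarrow> real) \<Rightarrow> real \<Rightarrow> nat \<Rightarrow> 'a \<Rightarrow> real" where
  "dsum H \<eta> N \<omega> = (\<Sum>k<N. H (real k * \<eta>) \<omega> * (W (real (Suc k) * \<eta>) \<omega> - W (real k * \<eta>) \<omega>))"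

lemma G_bounded: "0 \<le> \<kappa> \<Longrightarrow> \<bar>G \<kappa> s \<omega>\<bar> \<le> \<kappa>"
  by (simp add: G_def)

lemma G_adapted: "0 \<le> s \<Longrightarrow> G \<kappa> s \<in> borel_measurable (Fm s)"
  using Y_adapted[of s] unfolding G_def by measurable

lemma G_measurable [measurable]: "0 \<le> s \<Longrightarrow> G \<kappa> s \<in> borel_measurable M"
  using G_adapted measurable_FmD by blast

lemma G_continuous: "\<omega> \<in> space M \<Longrightarrow> continuous_on {0..} (\<lambda>t. G \<kappa> t \<omega>)"
  unfolding G_def by (intro continuous_intros Y_continuous)

lemma Om_mono: "r \<le> r' \<Longrightarrow> Om K r' \<subseteq> Om K r"
  by (auto simp: Om_def)

text \<open>Path continuity reduces the condition to countably many times, which makes the event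
  measurable at time r. The rational is taken to the left of q so that it stays in [0,r]; q = 0 is
  rational itself.\<close>

lemma Om_rational: "Om K r = {\<omega>\<in>space M. \<forall>q\<in>{0..r} \<inter> \<rat>. \<bar>Y q \<omega>\<bar> \<le> K}"
proof (intro equalityI subsetI)
  fix \<omega> assume \<omega>: "\<omega> \<in> {\<omega>\<in>space M. \<forall>q\<in>{0..r} \<inter> \<rat>. \<bar>Y q \<omega>\<bar> \<le> K}"
  have "\<bar>Y q \<omega>\<bar> \<le> K" if q: "q \<in> {0..r}" for q
  proof (rule ccontr)
    assume n: "\<not> \<bar>Y q \<omega>\<bar> \<le> K"
    then have "q \<noteq> 0" using \<omega> q by auto
    with q have q0: "0 < q" by auto
    have "continuous_on {0..} (\<lambda>t. \<bar>Y t \<omega>\<bar>)"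
      using \<omega> by (intro continuous_intros Y_continuous) auto
    then have "((\<lambda>t. \<bar>Y t \<omega>\<bar>) \<longlongrightarrow> \<bar>Y q \<omega>\<bar>) (at q within {0..})"
      using q0 by (auto simp: continuous_on_def)
    then have "eventually (\<lambda>t. \<bar>Y t \<omega>\<bar> > K) (at q within {0..})"
      using n by (auto simp: order_tendsto_iff)
    then obtain d where d: "d > 0" "\<And>t. t \<ge> 0 \<Longrightarrow> t \<noteq> q \<Longrightarrow> dist t q < d \<Longrightarrow> \<bar>Y t \<omega>\<bar> > K"
      unfolding eventually_at by auto
    obtain p where p: "p \<in> \<rat>" "max 0 (q - d) < p" "p < q"
      using Rats_dense_in_real[of "max 0 (q - d)" q] q0 d by auto
    have "\<bar>Y p \<omega>\<bar> > K" using p by (intro d(2)) (auto simp: dist_real_def)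
    moreover have "\<bar>Y p \<omega>\<bar> \<le> K" using \<omega> p q by auto
    ultimately show False by simp
  qed
  then show "\<omega> \<in> Om K r" using \<omega> by (auto simp: Om_def)
qed (auto simp: Om_def)

lemma Om_Fm [measurable]:
  assumes "0 \<le> r" shows "Om K r \<in> sets (Fm r)"
proof -
  have c: "countable ({0..r} \<inter> \<rat>)" by (intro countable_Int2 countable_rat)
  have "{\<omega>\<in>space (Fm r). \<forall>q\<in>{0..r} \<inter> \<rat>. \<bar>Y q \<omega>\<bar> \<le> K} \<in> sets (Fm r)"
  proof (rule sets.sets_Collect_countable_All'[OF _ c])
    fix q assume "q \<in> {0..r} \<inter> \<rat>"
    then have q: "0 \<le> q" "q \<le> r" by auto
    have [measurable]: "Y q \<in> borel_measurable (Fm r)"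
      by (rule measurable_Fm_mono[OF Y_adapted q]) (rule q)
    show "{\<omega>\<in>space (Fm r). \<bar>Y q \<omega>\<bar> \<le> K} \<in> sets (Fm r)" by measurable
  qed
  then show ?thesis unfolding Om_rational by simp
qed

lemma Om_M [measurable]: "0 \<le> r \<Longrightarrow> Om K r \<in> sets M"
  using Om_Fm[of r K] F_subset[of r] by (auto simp: sets_Fm)

text \<open>Each path is bounded on [0,r], so the events with \<kappa> a natural number increase to
  the whole space.\<close>

lemma Om_prob:
  assumes "0 \<le> r" "0 < \<epsilon>"
  obtains \<kappa> where "0 \<le> \<kappa>" "prob (space M - Om (\<kappa>\<^sup>2) r) \<le> \<epsilon>"
proof -
  have un: "(\<Union>n. Om ((real n)\<^sup>2) r) = space M"
  proof (intro equalityI subsetI)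
    fix \<omega> assume \<omega>: "\<omega> \<in> space M"
    have "compact ((\<lambda>t. Y t \<omega>) ` {0..r})"
      by (intro compact_continuous_image continuous_on_subset[OF Y_continuous[OF \<omega>]]) auto
    then obtain B where B: "\<And>t. t \<in> {0..r} \<Longrightarrow> \<bar>Y t \<omega>\<bar> \<le> B"
      using compact_imp_bounded bounded_iff by (metis image_eqI real_norm_def)
    obtain n where n: "B \<le> real n" using real_arch_simple by blast
    have "real n \<le> (real n)\<^sup>2" by (cases n) (auto simp: power2_eq_square)
    with n have n': "B \<le> (real n)\<^sup>2" by linarith
    have "\<omega> \<in> Om ((real n)\<^sup>2) r"
      unfolding Om_def using \<omega> order_trans[OF B n'] by simp
    then show "\<omega> \<in> (\<Union>n. Om ((real n)\<^sup>2) r)" by blast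
  qed (auto simp: Om_def)
  have "incseq (\<lambda>n. Om ((real n)\<^sup>2) r)"
    unfolding incseq_def Om_def by (auto intro: order_trans power_mono)
  then have "(\<lambda>n. prob (Om ((real n)\<^sup>2) r)) \<longlonglongrightarrow> prob (space M)"
    using assms finite_Lim_measure_incseq[of "\<lambda>n. Om ((real n)\<^sup>2) r"] un by (auto intro!: Om_M)
  then have "eventually (\<lambda>n. prob (Om ((real n)\<^sup>2) r) > 1 - \<epsilon>) sequentially"
    using assms by (auto simp: prob_space order_tendsto_iff)
  then obtain n where "prob (Om ((real n)\<^sup>2) r) > 1 - \<epsilon>"
    by (auto simp: eventually_sequentially)
  then show ?thesis
    using assms prob_compl[of "Om ((real n)\<^sup>2) r"] by (intro that[of "real n"]) auto
qed

text \<open>Every path of \<open>G\<close> is uniformly continuous on [0,T], but with a modulus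
  depending on the path. A sequence of counterexamples and dominated convergence, with the bound 2
  \<kappa> on differences, yield one modulus in mean square.\<close>

lemma G_modulus:
  assumes "0 \<le> \<kappa>" "0 < \<epsilon>"
  shows "\<exists>d>0. \<forall>s r. 0 \<le> s \<longrightarrow> s \<le> T \<longrightarrow> 0 \<le> r \<longrightarrow> r \<le> T \<longrightarrow> \<bar>s - r\<bar> \<le> d \<longrightarrow>
    expectation (\<lambda>\<omega>. (G \<kappa> s \<omega> - G \<kappa> r \<omega>)\<^sup>2) \<le> \<epsilon>"
proof (rule ccontr)
  assume no: "\<not> ?thesis"
  define E where "E s r = expectation (\<lambda>\<omega>. (G \<kappa> s \<omega> - G \<kappa> r \<omega>)\<^sup>2)" for s r
  have neg: "\<exists>s r. 0 \<le> s \<and> s \<le> T \<and> 0 \<le> r \<and> r \<le> T \<and> \<bar>s - r\<bar> \<le> d \<and> \<epsilon> < E s r" if "0 < d" for d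
    using no that unfolding E_def[symmetric] by (metis not_le)
  have "\<forall>n. \<exists>s r. 0 \<le> s \<and> s \<le> T \<and> 0 \<le> r \<and> r \<le> T \<and> \<bar>s - r\<bar> \<le> 1 / real (Suc n) \<and> \<epsilon> < E s r"
    using neg[of "1 / real (Suc n)" for n] by simp
  then obtain s r where "\<And>n. 0 \<le> s n \<and> s n \<le> T \<and> 0 \<le> r n \<and> r n \<le> T \<and> \<bar>s n - r n\<bar> \<le> 1 / real (Suc n) \<and> \<epsilon> < E (s n) (r n)"
    by metis
  then have sr: "\<And>n. 0 \<le> s n" "\<And>n. s n \<le> T" "\<And>n. 0 \<le> r n" "\<And>n. r n \<le> T"
    "\<And>n. \<bar>s n - r n\<bar> \<le> 1 / real (Suc n)"
    "\<And>n. \<epsilon> < expectation (\<lambda>\<omega>. (G \<kappa> (s n) \<omega> - G \<kappa> (r n) \<omega>)\<^sup>2)"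
    unfolding E_def by blast+
  have "(\<lambda>n. expectation (\<lambda>\<omega>. (G \<kappa> (s n) \<omega> - G \<kappa> (r n) \<omega>)\<^sup>2)) \<longlonglongrightarrow> expectation (\<lambda>\<omega>. 0)"
  proof (rule integral_dominated_convergence[where w = "\<lambda>_. (2 * \<kappa>)\<^sup>2"])
    show "AE \<omega> in M. (\<lambda>n. (G \<kappa> (s n) \<omega> - G \<kappa> (r n) \<omega>)\<^sup>2) \<longlonglongrightarrow> 0"
    proof (rule AE_I2)
      fix \<omega> assume \<omega>: "\<omega> \<in> space M"
      have "uniformly_continuous_on {0..T} (\<lambda>t. G \<kappa> t \<omega>)"
        by (intro compact_uniformly_continuous continuous_on_subset[OF G_continuous[OF \<omega>]]) auto
      moreover have "(\<lambda>n. dist (s n) (r n)) \<longlonglongrightarrow> 0"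
        unfolding dist_real_def
      proof (rule real_tendsto_sandwich[of "\<lambda>_. 0" _ _ "\<lambda>n. 1 / real (Suc n)"])
        show "(\<lambda>n. 1 / real (Suc n)) \<longlonglongrightarrow> 0" by (rule LIMSEQ_Suc[OF lim_1_over_n])
      qed (use sr in auto)
      ultimately have "(\<lambda>n. dist (G \<kappa> (s n) \<omega>) (G \<kappa> (r n) \<omega>)) \<longlonglongrightarrow> 0"
        using sr unfolding uniformly_continuous_on_sequentially by auto
      then have "(\<lambda>n. (dist (G \<kappa> (s n) \<omega>) (G \<kappa> (r n) \<omega>))\<^sup>2) \<longlonglongrightarrow> 0\<^sup>2"
        by (intro tendsto_intros)
      then show "(\<lambda>n. (G \<kappa> (s n) \<omega> - G \<kappa> (r n) \<omega>)\<^sup>2) \<longlonglongrightarrow> 0" by (simp add: dist_real_def)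
    qed
    fix n
    show "AE \<omega> in M. norm ((G \<kappa> (s n) \<omega> - G \<kappa> (r n) \<omega>)\<^sup>2) \<le> (2 * \<kappa>)\<^sup>2"
    proof (rule AE_I2)
      fix \<omega>
      have "\<bar>G \<kappa> (s n) \<omega> - G \<kappa> (r n) \<omega>\<bar> \<le> 2 * \<kappa>"
        using G_bounded[OF assms(1), of "s n" \<omega>] G_bounded[OF assms(1), of "r n" \<omega>] by linarith
      then have "\<bar>G \<kappa> (s n) \<omega> - G \<kappa> (r n) \<omega>\<bar>\<^sup>2 \<le> (2 * \<kappa>)\<^sup>2" by (intro power_mono) auto
      then show "norm ((G \<kappa> (s n) \<omega> - G \<kappa> (r n) \<omega>)\<^sup>2) \<le> (2 * \<kappa>)\<^sup>2" by simp
    qed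
  qed (use sr in measurable)
  then have "\<epsilon> \<le> 0"
    using sr(6) by (intro LIMSEQ_le_const) (auto intro: less_imp_le)
  with assms show False by simp
qed

text \<open>A coarse sum is a sum on the finer grid whose integrand is frozen at the last coarse
  point, the one of index \<open>i div a\<close>; within each block the fine increments
  telescope.\<close>

lemma dsum_refine:
  assumes "0 < a"
  shows "dsum H (real a * \<eta>) N \<omega> =
    (\<Sum>i<N*a. H (real (i div a) * (real a * \<eta>)) \<omega> * (W (real (Suc i) * \<eta>) \<omega> - W (real i * \<eta>) \<omega>))"
proof -
  let ?f = "\<lambda>i. H (real (i div a) * (real a * \<eta>)) \<omega> * (W (real (Suc i) * \<eta>) \<omega> - W (real i * \<eta>) \<omega>)"
  have "sum ?f {m*a..<m*a+a} = H (real m * (real a * \<eta>)) \<omega> * (W (real (Suc m) * (real a * \<eta>)) \<omega> - W (real m * (real a * \<eta>)) \<omega>)" for m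
  proof -
    have "sum ?f {m*a..<m*a+a} = (\<Sum>i=m*a..<m*a+a. H (real m * (real a * \<eta>)) \<omega> * (W (real (Suc i) * \<eta>) \<omega> - W (real i * \<eta>) \<omega>))"
    proof (rule sum.cong[OF refl])
      fix i assume i: "i \<in> {m*a..<m*a+a}"
      then have "i div a = m" using assms by (intro div_nat_eqI) (auto simp: mult.commute)
      then show "?f i = H (real m * (real a * \<eta>)) \<omega> * (W (real (Suc i) * \<eta>) \<omega> - W (real i * \<eta>) \<omega>)" by simp
    qed
    also have "\<dots> = H (real m * (real a * \<eta>)) \<omega> * (\<Sum>i=m*a..<m*a+a. W (real (Suc i) * \<eta>) \<omega> - W (real i * \<eta>) \<omega>)"
      by (simp add: sum_distrib_left)
    also have "(\<Sum>i=m*a..<m*a+a. W (real (Suc i) * \<eta>) \<omega> - W (real i * \<eta>) \<omega>) = W (real (m*a+a) * \<eta>) \<omega> - W (real (m*a) * \<eta>) \<omega>"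
      by (rule sum_Suc_diff'[of _ _ "\<lambda>i. W (real i * \<eta>) \<omega>"]) simp
    also have "real (m*a+a) * \<eta> = real (Suc m) * (real a * \<eta>)" by (simp add: algebra_simps)
    also have "real (m*a) * \<eta> = real m * (real a * \<eta>)" by simp
    finally show ?thesis .
  qed
  then show ?thesis
    unfolding dsum_def sum.nat_group[symmetric] by simp
qed

lemma dsum_measurable [measurable]:
  assumes "0 < \<eta>"
  shows "dsum (G \<kappa>) \<eta> N \<in> borel_measurable (Fm (real N * \<eta>))" "dsum (G \<kappa>) \<eta> N \<in> borel_measurable M"
proof -
  show *: "dsum (G \<kappa>) \<eta> N \<in> borel_measurable (Fm (real N * \<eta>))"
    unfolding dsum_def using assms
    by (intro discrete_integral_measurable[OF assms]) (auto intro!: G_adapted)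
  show "dsum (G \<kappa>) \<eta> N \<in> borel_measurable M"
    by (rule measurable_FmD[OF *]) (use assms in auto)
qed

text \<open>The difference of the two sums is a sum on the fine grid whose integrand is a difference
  of values of \<open>G\<close> at times at most d apart; the isometry turns the modulus of
  \<open>G\<close> into an error of size T \<epsilon>.\<close>

lemma dsum_refine_L2:
  assumes \<kappa>: "0 \<le> \<kappa>" and a: "0 < a" and \<eta>: "0 < \<eta>" and T: "real (N * a) * \<eta> \<le> T"
    and d: "real a * \<eta> \<le> d" and \<epsilon>: "0 \<le> \<epsilon>"
    and mod: "\<forall>s r. 0 \<le> s \<longrightarrow> s \<le> T \<longrightarrow> 0 \<le> r \<longrightarrow> r \<le> T \<longrightarrow> \<bar>s - r\<bar> \<le> d \<longrightarrow>
      expectation (\<lambda>\<omega>. (G \<kappa> s \<omega> - G \<kappa> r \<omega>)\<^sup>2) \<le> \<epsilon>"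
  shows "integrable M (\<lambda>\<omega>. (dsum (G \<kappa>) (real a * \<eta>) N \<omega> - dsum (G \<kappa>) \<eta> (N * a) \<omega>)\<^sup>2)"
    and "expectation (\<lambda>\<omega>. (dsum (G \<kappa>) (real a * \<eta>) N \<omega> - dsum (G \<kappa>) \<eta> (N * a) \<omega>)\<^sup>2) \<le> T * \<epsilon>"
proof -
  let ?\<xi> = "\<lambda>i \<omega>. G \<kappa> (real (i div a) * (real a * \<eta>)) \<omega> - G \<kappa> (real i * \<eta>) \<omega>"
  have eq: "dsum (G \<kappa>) (real a * \<eta>) N \<omega> - dsum (G \<kappa>) \<eta> (N * a) \<omega> =
    (\<Sum>i<N*a. ?\<xi> i \<omega> * (W (real (Suc i) * \<eta>) \<omega> - W (real i * \<eta>) \<omega>))" for \<omega>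
    unfolding dsum_refine[OF a] unfolding dsum_def by (simp add: sum_subtractf[symmetric] left_diff_distrib)
  have le: "real (i div a) * (real a * \<eta>) \<le> real i * \<eta>" for i
  proof -
    have "real (i div a * a) \<le> real i" using div_times_less_eq_dividend of_nat_le_iff by blast
    then have "real (i div a * a) * \<eta> \<le> real i * \<eta>" using \<eta> by (intro mult_right_mono) auto
    then show ?thesis by (simp add: mult.assoc)
  qed
  have close: "\<bar>real (i div a) * (real a * \<eta>) - real i * \<eta>\<bar> \<le> real a * \<eta>" for i
  proof -
    have "real i \<le> real (i div a * a + a)"
      using mod_less_divisor[OF a, of i] div_mult_mod_eq[of i a] unfolding of_nat_le_iff by linarith
    then have "real i * \<eta> \<le> real (i div a * a + a) * \<eta>" using \<eta> by (intro mult_right_mono) auto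
    then show ?thesis using le[of i] by (simp add: algebra_simps)
  qed
  have iso: "integrable M (\<lambda>\<omega>. (\<Sum>i<N*a. ?\<xi> i \<omega> * (W (real (Suc i) * \<eta>) \<omega> - W (real i * \<eta>) \<omega>))\<^sup>2) \<and>
    expectation (\<lambda>\<omega>. (\<Sum>i<N*a. ?\<xi> i \<omega> * (W (real (Suc i) * \<eta>) \<omega> - W (real i * \<eta>) \<omega>))\<^sup>2)
      = (\<Sum>i<N*a. \<eta> * expectation (\<lambda>\<omega>. (?\<xi> i \<omega>)\<^sup>2))"
  proof (rule discrete_isometry[OF \<eta>])
    fix i
    have "G \<kappa> (real (i div a) * (real a * \<eta>)) \<in> borel_measurable (Fm (real i * \<eta>))"
      by (rule measurable_Fm_mono[OF G_adapted _ le]) (use \<eta> in auto)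
    moreover have "G \<kappa> (real i * \<eta>) \<in> borel_measurable (Fm (real i * \<eta>))"
      using \<eta> by (intro G_adapted) auto
    ultimately show "?\<xi> i \<in> borel_measurable (Fm (real i * \<eta>))" by measurable
    show "\<bar>?\<xi> i \<omega>\<bar> \<le> 2 * \<kappa>" for \<omega>
      using G_bounded[OF \<kappa>, of "real (i div a) * (real a * \<eta>)" \<omega>] G_bounded[OF \<kappa>, of "real i * \<eta>" \<omega>]
      by linarith
  qed
  show "integrable M (\<lambda>\<omega>. (dsum (G \<kappa>) (real a * \<eta>) N \<omega> - dsum (G \<kappa>) \<eta> (N * a) \<omega>)\<^sup>2)"
    unfolding eq using iso by simp
  have "expectation (\<lambda>\<omega>. (dsum (G \<kappa>) (real a * \<eta>) N \<omega> - dsum (G \<kappa>) \<eta> (N * a) \<omega>)\<^sup>2)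
    = (\<Sum>i<N*a. \<eta> * expectation (\<lambda>\<omega>. (?\<xi> i \<omega>)\<^sup>2))"
    unfolding eq using iso by simp
  also have "\<dots> \<le> (\<Sum>i<N*a. \<eta> * \<epsilon>)"
  proof (intro sum_mono mult_left_mono mod[rule_format])
    fix i assume "i \<in> {..<N*a}"
    then have "real i \<le> real (N * a)" unfolding of_nat_le_iff by simp
    then have "real i * \<eta> \<le> real (N * a) * \<eta>" using \<eta> by (intro mult_right_mono) auto
    then show "real i * \<eta> \<le> T" "real (i div a) * (real a * \<eta>) \<le> T" using T le[of i] by auto
    show "\<bar>real (i div a) * (real a * \<eta>) - real i * \<eta>\<bar> \<le> d" using close[of i] d by linarith
  qed (use \<eta> in auto)
  also have "\<dots> = real (N * a) * \<eta> * \<epsilon>" by simp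
  also have "\<dots> \<le> T * \<epsilon>" using T \<epsilon> by (intro mult_right_mono)
  finally show "expectation (\<lambda>\<omega>. (dsum (G \<kappa>) (real a * \<eta>) N \<omega> - dsum (G \<kappa>) \<eta> (N * a) \<omega>)\<^sup>2) \<le> T * \<epsilon>" .
qed

text \<open>From \<bar>x\<bar> \<le> e + x^2 / e, in the role of the Cauchy-Schwarz inequality; the
  lost factor 2 is harmless.\<close>

lemma expectation_abs_le_square:
  fixes X :: "'a \<Rightarrow> real"
  assumes X: "X \<in> borel_measurable M" "integrable M (\<lambda>\<omega>. (X \<omega>)\<^sup>2)"
    and e: "0 < e" "expectation (\<lambda>\<omega>. (X \<omega>)\<^sup>2) \<le> e\<^sup>2"
  shows "integrable M (\<lambda>\<omega>. \<bar>X \<omega>\<bar>)" "expectation (\<lambda>\<omega>. \<bar>X \<omega>\<bar>) \<le> 2 * e"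
proof -
  show i: "integrable M (\<lambda>\<omega>. \<bar>X \<omega>\<bar>)"
    using square_integrable_imp_integrable[OF X] by simp
  have "expectation (\<lambda>\<omega>. \<bar>X \<omega>\<bar>) \<le> expectation (\<lambda>\<omega>. e + (X \<omega>)\<^sup>2 / e)"
  proof (rule integral_mono[OF i])
    show "integrable M (\<lambda>\<omega>. e + (X \<omega>)\<^sup>2 / e)" using X by simp
    fix \<omega>
    show "\<bar>X \<omega>\<bar> \<le> e + (X \<omega>)\<^sup>2 / e"
    proof (cases "\<bar>X \<omega>\<bar> \<le> e")
      case False
      then have "\<bar>X \<omega>\<bar> * e \<le> \<bar>X \<omega>\<bar> * \<bar>X \<omega>\<bar>" by (intro mult_left_mono) auto
      then have "\<bar>X \<omega>\<bar> \<le> (X \<omega>)\<^sup>2 / e" using e by (simp add: field_simps power2_eq_square)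
      then show ?thesis using e by simp
    qed (use e in \<open>simp add: add_increasing2\<close>)
  qed
  also have "\<dots> = e + expectation (\<lambda>\<omega>. (X \<omega>)\<^sup>2) / e" using X by (simp add: prob_space)
  also have "\<dots> \<le> e + e\<^sup>2 / e" using e by (intro add_left_mono divide_right_mono) auto
  finally show "expectation (\<lambda>\<omega>. \<bar>X \<omega>\<bar>) \<le> 2 * e" using e by (simp add: power2_eq_square)
qed

text \<open>The truncated mean metrises convergence in probability and, unlike probabilities of
  deviations, can simply be added to errors in mean.\<close>

lemma conv_in_prob_expectation:
  fixes X :: "nat \<Rightarrow> 'a \<Rightarrow> real"
  assumes [measurable]: "\<And>n. X n \<in> borel_measurable M" "L \<in> borel_measurable M"
    and c: "conv_in_prob M X L" and e: "0 < e"
  shows "eventually (\<lambda>n. expectation (\<lambda>\<omega>. min 1 \<bar>X n \<omega> - L \<omega>\<bar>) \<le> 2 * e) sequentially"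
proof -
  have "eventually (\<lambda>n. measure M {\<omega>\<in>space M. \<bar>X n \<omega> - L \<omega>\<bar> > e} < e) sequentially"
    using c e unfolding conv_in_prob_def by (auto simp: order_tendsto_iff)
  then show ?thesis
  proof eventually_elim
    case (elim n)
    let ?A = "{\<omega>\<in>space M. \<bar>X n \<omega> - L \<omega>\<bar> > e}"
    have "expectation (\<lambda>\<omega>. min 1 \<bar>X n \<omega> - L \<omega>\<bar>) \<le> expectation (\<lambda>\<omega>. e + indicator ?A \<omega>)"
    proof (rule integral_mono)
      show "integrable M (\<lambda>\<omega>. min 1 \<bar>X n \<omega> - L \<omega>\<bar>)"
        by (rule bounded_integrable[where B = 1]) auto
      show "integrable M (\<lambda>\<omega>. e + indicator ?A \<omega> :: real)"
        by (rule bounded_integrable[where B = "e + 1"]) (use e in \<open>auto simp: indicator_def\<close>)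
    qed (use e in \<open>auto simp: indicator_def\<close>)
    also have "\<dots> = e + measure M ?A"
      by (subst Bochner_Integration.integral_add) (auto simp: prob_space intro!: bounded_integrable[where B = 1])
    finally show ?case using elim by simp
  qed
qed

text \<open>The right-hand side of the equation at time j / 2^n with its integral truncated and
  discretised. It is not an Euler scheme: the integrand is still evaluated at Y itself.\<close>

definition Z :: "real \<Rightarrow> nat \<Rightarrow> nat \<Rightarrow> 'a \<Rightarrow> real" where
  "Z \<kappa> n j \<omega> = y + \<delta> * (real j / 2 ^ n) + 2 * dsum (G \<kappa>) (1 / 2 ^ n) j \<omega>"

lemma Z_measurable: "Z \<kappa> n j \<in> borel_measurable (Fm (real j / 2 ^ n))"
  using dsum_measurable(1)[of "1 / 2 ^ n" \<kappa> j] unfolding Z_def by simp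

lemma Z_measurable_M [measurable]: "Z \<kappa> n j \<in> borel_measurable M"
  using measurable_FmD[OF Z_measurable] by simp

text \<open>The modulus of \<open>G\<close> bounds the distance of both sums to their common
  refinement. The depth m of the partition defining the integral may depend on j, but it does not
  appear in the result, so the condition on n is the same for all j. Each of the three errors is at
  most 2 e and enters with factor 2, whence 12 e.\<close>

lemma Z_approx_single:
  assumes \<kappa>: "0 \<le> \<kappa>" and e: "0 < e" and T: "0 < T" "real j / 2 ^ n \<le> T" and d: "1 / 2 ^ n \<le> d"
    and mod: "\<forall>s r. 0 \<le> s \<longrightarrow> s \<le> T \<longrightarrow> 0 \<le> r \<longrightarrow> r \<le> T \<longrightarrow> \<bar>s - r\<bar> \<le> d \<longrightarrow>
      expectation (\<lambda>\<omega>. (G \<kappa> s \<omega> - G \<kappa> r \<omega>)\<^sup>2) \<le> e\<^sup>2 / T"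
  shows "expectation (\<lambda>\<omega>. indicator (Om (\<kappa>\<^sup>2) (real j / 2 ^ n)) \<omega> * min 1 \<bar>Y (real j / 2 ^ n) \<omega> - Z \<kappa> n j \<omega>\<bar>) \<le> 12 * e"
proof (cases "j = 0")
  case True
  have "expectation (\<lambda>\<omega>. indicator (Om (\<kappa>\<^sup>2) (real j / 2 ^ n)) \<omega> * min 1 \<bar>Y (real j / 2 ^ n) \<omega> - Z \<kappa> n j \<omega>\<bar>)
    = expectation (\<lambda>\<omega>. 0)"
  proof (rule integral_cong_AE)
    show "AE \<omega> in M. indicator (Om (\<kappa>\<^sup>2) (real j / 2 ^ n)) \<omega> * min 1 \<bar>Y (real j / 2 ^ n) \<omega> - Z \<kappa> n j \<omega>\<bar> = 0"
      using Y_start by eventually_elim (simp add: Z_def True dsum_def)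
  qed measurable
  then show ?thesis using e by simp
next
  case False
  define r where "r = real j / 2 ^ n"
  have r: "0 < r" "r \<le> T" using False T by (auto simp: r_def)
  have rp [measurable]: "0 \<le> r" using r by simp
  obtain I where I [measurable]: "I \<in> borel_measurable M"
    and c: "conv_in_prob M (ito_sum (\<lambda>s \<omega>. sqrt \<bar>Y s \<omega>\<bar>) W r) I"
    and eq: "AE \<omega> in M. Y r \<omega> = y + \<delta> * r + 2 * I \<omega>"
    using Y_equation[of r] r by auto
  let ?J = "\<lambda>m. ito_sum (\<lambda>s \<omega>. sqrt \<bar>Y s \<omega>\<bar>) W r m"
  have Jm [measurable]: "?J m \<in> borel_measurable M" for m
    unfolding ito_sum_def using r by (auto intro!: borel_measurable_sum borel_measurable_times borel_measurable_diff
      borel_measurable_sqrt borel_measurable_abs Y_measurable W_measurable_M measurable_compose[OF Y_measurable])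
  have "eventually (\<lambda>m. expectation (\<lambda>\<omega>. min 1 \<bar>?J m \<omega> - I \<omega>\<bar>) \<le> 2 * e) sequentially"
    by (rule conv_in_prob_expectation[OF Jm I c e])
  moreover have "eventually (\<lambda>m. r / 2 ^ m \<le> d) sequentially"
  proof -
    have "0 < d" using d less_le_trans[of 0 "1 / 2 ^ n" d] by simp
    moreover have "(\<lambda>m. r / 2 ^ m) \<longlonglongrightarrow> 0" by (rule LIMSEQ_divide_realpow_zero) simp
    ultimately show ?thesis by (metis (mono_tags, lifting) eventually_mono less_imp_le order_tendstoD(2))
  qed
  ultimately have "eventually (\<lambda>m. expectation (\<lambda>\<omega>. min 1 \<bar>?J m \<omega> - I \<omega>\<bar>) \<le> 2 * e \<and> r / 2 ^ m \<le> d) sequentially"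
    by (rule eventually_conj)
  then obtain m where m: "expectation (\<lambda>\<omega>. min 1 \<bar>?J m \<omega> - I \<omega>\<bar>) \<le> 2 * e" "r / 2 ^ m \<le> d"
    by (auto simp: eventually_sequentially)
  \<comment> \<open>The common refinement: 2^m of its steps make one step of \<open>Z\<close>, and j
    of them make one step of the sum that defines the integral up to r.\<close>
  define \<eta> :: real where "\<eta> = 1 / 2 ^ (n + m)"
  have \<eta>: "0 < \<eta>" by (simp add: \<eta>_def)
  have h1: "real (2 ^ m) * \<eta> = 1 / 2 ^ n" by (simp add: \<eta>_def power_add)
  have h2: "real j * \<eta> = r / 2 ^ m" by (simp add: \<eta>_def power_add r_def)
  have hT: "real (j * 2 ^ m) * \<eta> = r" by (simp add: \<eta>_def power_add r_def)
  let ?A = "\<lambda>\<omega>. dsum (G \<kappa>) (1 / 2 ^ n) j \<omega> - dsum (G \<kappa>) \<eta> (j * 2 ^ m) \<omega>"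
  let ?B = "\<lambda>\<omega>. dsum (G \<kappa>) (r / 2 ^ m) (2 ^ m) \<omega> - dsum (G \<kappa>) \<eta> (j * 2 ^ m) \<omega>"
  have Te: "T * (e\<^sup>2 / T) = e\<^sup>2" "0 \<le> e\<^sup>2 / T" using T by auto
  have A: "integrable M (\<lambda>\<omega>. (?A \<omega>)\<^sup>2)" "expectation (\<lambda>\<omega>. (?A \<omega>)\<^sup>2) \<le> e\<^sup>2"
    using dsum_refine_L2[OF \<kappa> _ \<eta> _ _ Te(2) mod, where a = "2 ^ m" and N = j]
    unfolding h1 hT Te using r d by auto
  have B: "integrable M (\<lambda>\<omega>. (?B \<omega>)\<^sup>2)" "expectation (\<lambda>\<omega>. (?B \<omega>)\<^sup>2) \<le> e\<^sup>2"
    using dsum_refine_L2[OF \<kappa> _ \<eta> _ _ Te(2) mod, where a = j and N = "2 ^ m"] False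
    unfolding h2 mult.commute[of "2 ^ m" j] hT Te using r m by auto
  have [measurable]: "?A \<in> borel_measurable M" "?B \<in> borel_measurable M"
    using r \<eta> by (auto intro!: borel_measurable_diff dsum_measurable)
  have A': "integrable M (\<lambda>\<omega>. \<bar>?A \<omega>\<bar>)" "expectation (\<lambda>\<omega>. \<bar>?A \<omega>\<bar>) \<le> 2 * e"
    by (rule expectation_abs_le_square[OF _ A(1) e A(2)]; measurable)+
  have B': "integrable M (\<lambda>\<omega>. \<bar>?B \<omega>\<bar>)" "expectation (\<lambda>\<omega>. \<bar>?B \<omega>\<bar>) \<le> 2 * e"
    by (rule expectation_abs_le_square[OF _ B(1) e B(2)]; measurable)+
  have JG: "?J m \<omega> = dsum (G \<kappa>) (r / 2 ^ m) (2 ^ m) \<omega>" if "\<omega> \<in> Om (\<kappa>\<^sup>2) r" for \<omega>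
    unfolding ito_sum_def dsum_def
  proof (intro sum.cong refl arg_cong2[where f = times])
    fix k :: nat assume k: "k \<in> {..<2 ^ m}"
    have "real k \<le> 2 ^ m" using k by (metis lessThan_iff less_imp_le of_nat_le_iff of_nat_numeral of_nat_power)
    then have "real k * r \<le> 2 ^ m * r" using r by (intro mult_right_mono) auto
    then have "real k * r / 2 ^ m \<in> {0..r}" using r by (auto simp: field_simps)
    then have "\<bar>Y (real k * r / 2 ^ m) \<omega>\<bar> \<le> \<kappa>\<^sup>2" using that by (auto simp: Om_def)
    then have "sqrt \<bar>Y (real k * r / 2 ^ m) \<omega>\<bar> \<le> \<kappa>" using \<kappa> by (intro real_le_lsqrt) auto
    then show "sqrt \<bar>Y (real k * r / 2 ^ m) \<omega>\<bar> = G \<kappa> (real k * (r / 2 ^ m)) \<omega>"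
      by (simp add: G_def)
  qed (simp_all only: times_divide_eq_right)
  have int1: "integrable M (\<lambda>\<omega>. min 1 \<bar>?J m \<omega> - I \<omega>\<bar>)"
    by (rule bounded_integrable[where B = 1]) auto
  have "expectation (\<lambda>\<omega>. indicator (Om (\<kappa>\<^sup>2) r) \<omega> * min 1 \<bar>Y r \<omega> - Z \<kappa> n j \<omega>\<bar>)
    \<le> expectation (\<lambda>\<omega>. 2 * min 1 \<bar>?J m \<omega> - I \<omega>\<bar> + 2 * \<bar>?A \<omega>\<bar> + 2 * \<bar>?B \<omega>\<bar>)"
  proof (rule integral_mono_AE)
    show "integrable M (\<lambda>\<omega>. indicator (Om (\<kappa>\<^sup>2) r) \<omega> * min 1 \<bar>Y r \<omega> - Z \<kappa> n j \<omega>\<bar>)"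
      by (rule bounded_integrable[where B = 1]) (auto simp: indicator_def)
    show "integrable M (\<lambda>\<omega>. 2 * min 1 \<bar>?J m \<omega> - I \<omega>\<bar> + 2 * \<bar>?A \<omega>\<bar> + 2 * \<bar>?B \<omega>\<bar>)"
      using int1 A' B' by auto
    show "AE \<omega> in M. indicator (Om (\<kappa>\<^sup>2) r) \<omega> * min 1 \<bar>Y r \<omega> - Z \<kappa> n j \<omega>\<bar>
      \<le> 2 * min 1 \<bar>?J m \<omega> - I \<omega>\<bar> + 2 * \<bar>?A \<omega>\<bar> + 2 * \<bar>?B \<omega>\<bar>"
      using eq
    proof eventually_elim
      case (elim \<omega>)
      show ?case
      proof (cases "\<omega> \<in> Om (\<kappa>\<^sup>2) r")
        case True
        have "Y r \<omega> - Z \<kappa> n j \<omega> = 2 * (I \<omega> - ?J m \<omega>) + 2 * ?B \<omega> - 2 * ?A \<omega>"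
          using elim JG[OF True] unfolding Z_def r_def[symmetric] by (simp add: algebra_simps)
        moreover have "min 1 \<bar>2 * (i - q) + 2 * b - 2 * a\<bar> \<le> 2 * min 1 \<bar>q - i\<bar> + 2 * \<bar>a\<bar> + 2 * \<bar>b\<bar>" for i q a b :: real
          by (simp add: min_def abs_if)
        ultimately show ?thesis using True by (simp only: indicator_simps mult_1_left)
      qed (simp add: min_def)
    qed
  qed
  also have "\<dots> = 2 * expectation (\<lambda>\<omega>. min 1 \<bar>?J m \<omega> - I \<omega>\<bar>) + 2 * expectation (\<lambda>\<omega>. \<bar>?A \<omega>\<bar>) + 2 * expectation (\<lambda>\<omega>. \<bar>?B \<omega>\<bar>)"
    using int1 A'(1) B'(1) by simp
  also have "\<dots> \<le> 12 * e" using m A' B' by simp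
  finally show ?thesis unfolding r_def .
qed

lemma Z_approx:
  assumes \<kappa>: "0 \<le> \<kappa>" and e: "0 < e" and T: "0 < T"
  shows "eventually (\<lambda>n. \<forall>j. real j / 2 ^ n \<le> T \<longrightarrow>
    expectation (\<lambda>\<omega>. indicator (Om (\<kappa>\<^sup>2) (real j / 2 ^ n)) \<omega> * min 1 \<bar>Y (real j / 2 ^ n) \<omega> - Z \<kappa> n j \<omega>\<bar>) \<le> e) sequentially"
proof -
  have "0 < (e / 12)\<^sup>2 / T" using e T by simp
  from G_modulus[OF \<kappa> this, of T] obtain d where d: "d > 0"
    "\<forall>s r. 0 \<le> s \<longrightarrow> s \<le> T \<longrightarrow> 0 \<le> r \<longrightarrow> r \<le> T \<longrightarrow> \<bar>s - r\<bar> \<le> d \<longrightarrow>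
      expectation (\<lambda>\<omega>. (G \<kappa> s \<omega> - G \<kappa> r \<omega>)\<^sup>2) \<le> (e / 12)\<^sup>2 / T"
    by blast
  have "(\<lambda>n. 1 / 2 ^ n :: real) \<longlonglongrightarrow> 0" by (rule LIMSEQ_divide_realpow_zero) simp
  then have "eventually (\<lambda>n. 1 / 2 ^ n < d) sequentially" using d(1) by (rule order_tendstoD)
  then show ?thesis
  proof eventually_elim
    case (elim n)
    show ?case
      using Z_approx_single[OF \<kappa> _ T _ _ d(2), where n = n] e elim by auto
  qed
qed

end

section \<open>Dynkin's formula\<close>

text \<open>\<open>xf''_bound\<close> makes the generator bounded although its coefficient 2
  \<bar>x\<bar> is not. The Lipschitz condition takes the place of a third derivative, which the
  functions glued at 0 below need not have there.\<close>

locale test_function =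
  fixes f f' f'' :: "real \<Rightarrow> real" and B :: real
  assumes f_deriv: "\<And>x. (f has_real_derivative f' x) (at x)"
    and f'_deriv: "\<And>x. (f' has_real_derivative f'' x) (at x)"
    and f_bound: "\<And>x. \<bar>f x\<bar> \<le> B" and f'_bound: "\<And>x. \<bar>f' x\<bar> \<le> B"
    and f''_bound: "\<And>x. \<bar>f'' x\<bar> \<le> B" and xf''_bound: "\<And>x. \<bar>x * f'' x\<bar> \<le> B"
    and f''_lipschitz: "\<And>x y. \<bar>f'' x - f'' y\<bar> \<le> B * \<bar>x - y\<bar>"
begin

lemma B_nonneg: "0 \<le> B"
  using f_bound[of 0] by linarith

text \<open>Expansion to second order with f'' at an intermediate point; moving this point to x
  costs at most B \<bar>d\<bar> by the Lipschitz condition and makes the remainder cubic.\<close>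

lemma taylor: "\<bar>f (x + d) - f x - f' x * d - f'' x / 2 * d\<^sup>2\<bar> \<le> B * \<bar>d\<bar> ^ 3"
proof (cases "d = 0")
  case False
  let ?D = "\<lambda>m::nat. if m = 0 then f else if m = 1 then f' else f''"
  have "\<exists>t. (if x + d < x then x + d < t \<and> t < x else x < t \<and> t < x + d) \<and>
    f (x + d) = (\<Sum>m<2. ?D m x / fact m * (x + d - x) ^ m) + ?D 2 t / fact 2 * (x + d - x) ^ 2"
    by (rule Taylor[where a = "min x (x + d)" and b = "max x (x + d)"])
      (use False f_deriv f'_deriv in \<open>auto simp: less_2_cases_iff\<close>)
  then obtain t where t0: "if x + d < x then x + d < t \<and> t < x else x < t \<and> t < x + d"
    and t1: "f (x + d) = (\<Sum>m<2. ?D m x / fact m * (x + d - x) ^ m) + ?D 2 t / fact 2 * (x + d - x) ^ 2"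
    by blast
  have t: "\<bar>t - x\<bar> \<le> \<bar>d\<bar>" "f (x + d) = f x + f' x * d + f'' t / 2 * d\<^sup>2"
    using t0 t1 by (auto simp: numeral_2_eq_2 split: if_splits)
  have "\<bar>f (x + d) - f x - f' x * d - f'' x / 2 * d\<^sup>2\<bar> = \<bar>(f'' t - f'' x) / 2 * d\<^sup>2\<bar>"
    unfolding t(2) by (simp add: algebra_simps diff_divide_distrib)
  also have "\<dots> = \<bar>f'' t - f'' x\<bar> / 2 * \<bar>d\<bar>\<^sup>2"
    by (simp add: abs_mult)
  also have "\<dots> \<le> (B * \<bar>d\<bar>) * \<bar>d\<bar>\<^sup>2"
  proof (rule mult_right_mono)
    have "\<bar>f'' t - f'' x\<bar> \<le> B * \<bar>d\<bar>"
      using f''_lipschitz[of t x] mult_left_mono[OF t(1) B_nonneg] by linarith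
    moreover have "0 \<le> B * \<bar>d\<bar>" using B_nonneg by simp
    ultimately show "\<bar>f'' t - f'' x\<bar> / 2 \<le> B * \<bar>d\<bar>" by (simp add: field_simps)
  qed simp
  finally show ?thesis by (simp add: power2_eq_square power3_eq_cube)
qed simp

text \<open>Brings differences into the form min 1 \<bar>a - b\<bar>, the distance in which
  \<open>Z_approx\<close> is stated.\<close>

lemma bounded_lipschitz_min:
  fixes u v a b :: real
  assumes "\<bar>u\<bar> \<le> B" "\<bar>v\<bar> \<le> B" "\<bar>u - v\<bar> \<le> B * \<bar>a - b\<bar>"
  shows "\<bar>u - v\<bar> \<le> 2 * B * min 1 \<bar>a - b\<bar>"
proof (cases "1 \<le> \<bar>a - b\<bar>")
  case False
  then have "min 1 \<bar>a - b\<bar> = \<bar>a - b\<bar>" by simp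
  moreover have "B * \<bar>a - b\<bar> \<le> 2 * B * \<bar>a - b\<bar>" using B_nonneg by simp
  ultimately show ?thesis using assms by linarith
qed (use assms in auto)

lemma lipschitz_derivative:
  fixes g g' :: "real \<Rightarrow> real"
  assumes "\<And>x. (g has_real_derivative g' x) (at x)" "\<And>x. \<bar>g' x\<bar> \<le> B"
  shows "\<bar>g a - g b\<bar> \<le> B * \<bar>a - b\<bar>"
  using field_differentiable_bound[of UNIV g g' B a b] assms by simp

lemma f_diff: "\<bar>f a - f b\<bar> \<le> 2 * B * min 1 \<bar>a - b\<bar>"
  by (intro bounded_lipschitz_min f_bound lipschitz_derivative[OF f_deriv f'_bound])

lemma f'_diff: "\<bar>f' a - f' b\<bar> \<le> 2 * B * min 1 \<bar>a - b\<bar>"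
  by (intro bounded_lipschitz_min f'_bound lipschitz_derivative[OF f'_deriv f''_bound])

lemma f''_diff: "\<bar>f'' a - f'' b\<bar> \<le> 2 * B * min 1 \<bar>a - b\<bar>"
  by (intro bounded_lipschitz_min f''_bound f''_lipschitz)

lemma f_continuous: "continuous_on UNIV f"
  using f_deriv by (meson DERIV_continuous continuous_at_imp_continuous_on)

lemma f'_continuous: "continuous_on UNIV f'"
  using f'_deriv by (meson DERIV_continuous continuous_at_imp_continuous_on)

lemma f''_continuous: "continuous_on UNIV f''"
proof (rule lipschitz_on_continuous_on)
  show "B-lipschitz_on UNIV f''"
    using f''_lipschitz B_nonneg by (intro lipschitz_onI) (auto simp: dist_real_def)
qed

lemma f_measurable [measurable]: "f \<in> borel_measurable borel" "f' \<in> borel_measurable borel" "f'' \<in> borel_measurable borel"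
  using f_continuous f'_continuous f''_continuous by (auto intro: borel_measurable_continuous_onI)

end

context besq_sol
begin

text \<open>The generator of the squared Bessel process, applied to a function with derivatives \<open>f'\<close> and \<open>f''\<close>;
  with \<open>\<bar>x\<bar>\<close>, because nonnegativity of \<open>Y\<close> is not yet available.\<close>

definition gen :: "(real \<Rightarrow> real) \<Rightarrow> (real \<Rightarrow> real) \<Rightarrow> real \<Rightarrow> real" where
  "gen f' f'' x = \<delta> * f' x + 2 * \<bar>x\<bar> * f'' x"

text \<open>Taylor's formula with increment \<delta> h + 2 g D, where h = t - s and D is the
  Brownian increment. By independence the terms linear in D have mean 0 and D^2 may be replaced by
  h. What remains is (\<delta> h)^2 f'' / 2 and the cubic remainder; for h \<le> 1 both are of order
  h^(3/2), so that 1 / h such steps still have a vanishing total error.\<close>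

lemma one_step:
  assumes tf: "test_function f f' f'' B"
    and U: "U \<in> borel_measurable (Fm s)" "\<And>\<omega>. \<bar>U \<omega>\<bar> \<le> 1"
    and z: "z \<in> borel_measurable (Fm s)"
    and g: "g \<in> borel_measurable (Fm s)" "\<And>\<omega>. \<bar>g \<omega>\<bar> \<le> \<kappa>"
    and st: "0 \<le> s" "s < t" "t - s \<le> 1"
  shows "\<bar>expectation (\<lambda>\<omega>. U \<omega> * (f (z \<omega> + \<delta> * (t - s) + 2 * g \<omega> * (W t \<omega> - W s \<omega>)) - f (z \<omega>)))
     - (t - s) * expectation (\<lambda>\<omega>. U \<omega> * (\<delta> * f' (z \<omega>) + 2 * (g \<omega>)\<^sup>2 * f'' (z \<omega>)))\<bar>
    \<le> (t - s) * sqrt (t - s) * (B * (\<delta>\<^sup>2 + 4 * \<delta> ^ 3 + 64 * \<kappa> ^ 3))"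
proof -
  interpret test_function f f' f'' B by fact
  define h where "h = t - s"
  have h: "0 < h" "h \<le> 1" using st by (auto simp: h_def)
  have \<kappa>: "0 \<le> \<kappa>" using g(2) abs_ge_zero order_trans by blast
  let ?D = "\<lambda>\<omega>. W t \<omega> - W s \<omega>"
  let ?d = "\<lambda>\<omega>. \<delta> * h + 2 * g \<omega> * ?D \<omega>"
  define R where "R \<omega> = f (z \<omega> + ?d \<omega>) - f (z \<omega>) - f' (z \<omega>) * ?d \<omega> - f'' (z \<omega>) / 2 * (?d \<omega>)\<^sup>2" for \<omega>
  note st2 = st(1,2)
  note [measurable] = U(1) z g(1)
  have [measurable]: "U \<in> borel_measurable M" "z \<in> borel_measurable M" "g \<in> borel_measurable M"
    using measurable_FmD[OF U(1) st(1)] measurable_FmD[OF z st(1)] measurable_FmD[OF g(1) st(1)] by auto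
  have [measurable]: "W t \<in> borel_measurable M" "W s \<in> borel_measurable M" using st by auto
  \<comment> \<open>From (a + b)^3 \<le> 4 (a^3 + b^3): the second cube contributes 4 (2 \<kappa>)^3
    = 32 \<kappa>^3, which the third moment 2 h^(3/2) turns into 64 \<kappa>^3.\<close>
  have Rb: "\<bar>R \<omega>\<bar> \<le> B * (4 * \<delta> ^ 3 * h ^ 3 + 32 * \<kappa> ^ 3 * \<bar>?D \<omega>\<bar> ^ 3)" for \<omega>
  proof -
    have cube: "(a + b) ^ 3 \<le> 4 * (a ^ 3 + b ^ 3)" if "0 \<le> a" "0 \<le> b" for a b :: real
    proof -
      have "4 * (a ^ 3 + b ^ 3) - (a + b) ^ 3 = 3 * (a + b) * (a - b)\<^sup>2"
        by (simp add: power2_eq_square power3_eq_cube algebra_simps)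
      moreover have "0 \<le> 3 * (a + b) * (a - b)\<^sup>2" using that by simp
      ultimately show ?thesis by linarith
    qed
    have "\<bar>?d \<omega>\<bar> \<le> \<bar>\<delta> * h\<bar> + \<bar>2 * g \<omega> * ?D \<omega>\<bar>" by (rule abs_triangle_ineq)
    also have "\<dots> \<le> \<delta> * h + 2 * \<kappa> * \<bar>?D \<omega>\<bar>"
      using h \<delta>_pos g(2)[of \<omega>] by (auto simp: abs_mult intro!: mult_right_mono)
    finally have "\<bar>?d \<omega>\<bar> ^ 3 \<le> (\<delta> * h + 2 * \<kappa> * \<bar>?D \<omega>\<bar>) ^ 3" by (intro power_mono) auto
    also have "\<dots> \<le> 4 * ((\<delta> * h) ^ 3 + (2 * \<kappa> * \<bar>?D \<omega>\<bar>) ^ 3)"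
      using h \<delta>_pos \<kappa> by (intro cube) auto
    also have "\<dots> = 4 * \<delta> ^ 3 * h ^ 3 + 32 * \<kappa> ^ 3 * \<bar>?D \<omega>\<bar> ^ 3"
      by (simp add: power_mult_distrib)
    finally have "B * \<bar>?d \<omega>\<bar> ^ 3 \<le> B * (4 * \<delta> ^ 3 * h ^ 3 + 32 * \<kappa> ^ 3 * \<bar>?D \<omega>\<bar> ^ 3)"
      using B_nonneg by (rule mult_left_mono)
    then show ?thesis using taylor[of "z \<omega>" "?d \<omega>"] unfolding R_def by linarith
  qed
  have D3: "integrable M (\<lambda>\<omega>. \<bar>?D \<omega>\<bar> ^ 3)" by (rule increment_moments(1)[OF st2])
  have URi: "integrable M (\<lambda>\<omega>. U \<omega> * R \<omega>)"
    and URb: "\<bar>expectation (\<lambda>\<omega>. U \<omega> * R \<omega>)\<bar> \<le> B * (4 * \<delta> ^ 3 * h ^ 3 + 64 * \<kappa> ^ 3 * (h * sqrt h))"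
  proof -
    have i: "integrable M (\<lambda>\<omega>. B * (4 * \<delta> ^ 3 * h ^ 3 + 32 * \<kappa> ^ 3 * \<bar>?D \<omega>\<bar> ^ 3))" using D3 by simp
    have le: "\<bar>U \<omega> * R \<omega>\<bar> \<le> B * (4 * \<delta> ^ 3 * h ^ 3 + 32 * \<kappa> ^ 3 * \<bar>?D \<omega>\<bar> ^ 3)" for \<omega>
    proof -
      have "\<bar>U \<omega> * R \<omega>\<bar> \<le> 1 * \<bar>R \<omega>\<bar>" unfolding abs_mult using U(2) by (intro mult_right_mono) auto
      then show ?thesis using Rb[of \<omega>] by simp
    qed
    show ii: "integrable M (\<lambda>\<omega>. U \<omega> * R \<omega>)"
    proof (rule Bochner_Integration.integrable_bound[OF i])
      show "(\<lambda>\<omega>. U \<omega> * R \<omega>) \<in> borel_measurable M" unfolding R_def by measurable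
      show "AE \<omega> in M. norm (U \<omega> * R \<omega>) \<le> norm (B * (4 * \<delta> ^ 3 * h ^ 3 + 32 * \<kappa> ^ 3 * \<bar>?D \<omega>\<bar> ^ 3))"
        unfolding real_norm_def by (intro AE_I2 order_trans[OF le abs_ge_self])
    qed
    have "\<bar>expectation (\<lambda>\<omega>. U \<omega> * R \<omega>)\<bar> \<le> expectation (\<lambda>\<omega>. \<bar>U \<omega> * R \<omega>\<bar>)"
      by (rule integral_abs_bound)
    also have "\<dots> \<le> expectation (\<lambda>\<omega>. B * (4 * \<delta> ^ 3 * h ^ 3 + 32 * \<kappa> ^ 3 * \<bar>?D \<omega>\<bar> ^ 3))"
      using ii i le by (intro integral_mono) auto
    also have "\<dots> = B * (4 * \<delta> ^ 3 * h ^ 3 + 32 * \<kappa> ^ 3 * expectation (\<lambda>\<omega>. \<bar>?D \<omega>\<bar> ^ 3))"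
      using D3 by (simp add: prob_space)
    also have "\<dots> \<le> B * (4 * \<delta> ^ 3 * h ^ 3 + 32 * \<kappa> ^ 3 * (2 * h * sqrt h))"
      using increment_moments(5)[OF st2] B_nonneg \<kappa> unfolding h_def
      by (intro mult_left_mono add_left_mono) auto
    finally show "\<bar>expectation (\<lambda>\<omega>. U \<omega> * R \<omega>)\<bar> \<le> B * (4 * \<delta> ^ 3 * h ^ 3 + 64 * \<kappa> ^ 3 * (h * sqrt h))"
      by (simp only: mult.assoc) (simp add: mult_ac)
  qed
  have bd: "\<bar>U \<omega> * a\<bar> \<le> b" if "\<bar>a\<bar> \<le> b" for \<omega> a b
  proof -
    have "\<bar>U \<omega> * a\<bar> \<le> 1 * \<bar>a\<bar>" unfolding abs_mult using U(2) by (intro mult_right_mono) auto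
    then show ?thesis using that by simp
  qed
  let ?p1 = "\<lambda>\<omega>. U \<omega> * f' (z \<omega>)"
  let ?p2 = "\<lambda>\<omega>. U \<omega> * f'' (z \<omega>)"
  \<comment> \<open>\<open>?q1\<close> is the coefficient of the increment in the expansion,
    \<open>?q2\<close> half the coefficient of its square.\<close>
  let ?q1 = "\<lambda>\<omega>. 2 * (?p1 \<omega> * g \<omega>) + 2 * \<delta> * h * (?p2 \<omega> * g \<omega>)"
  let ?q2 = "\<lambda>\<omega>. ?p2 \<omega> * (g \<omega>)\<^sup>2"
  have p1: "integrable M ?p1" by (rule bounded_integrable[where B = B]) (auto intro!: bd f'_bound)
  have p2: "integrable M ?p2" by (rule bounded_integrable[where B = B]) (auto intro!: bd f''_bound)
  have p1g: "integrable M (\<lambda>\<omega>. ?p1 \<omega> * g \<omega>)"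
  proof (rule bounded_integrable[where B = "B * \<kappa>"])
    show "\<bar>?p1 \<omega> * g \<omega>\<bar> \<le> B * \<kappa>" for \<omega>
      unfolding abs_mult[of "?p1 \<omega>"] using B_nonneg by (intro mult_mono bd f'_bound g) auto
  qed measurable
  have p2g: "integrable M (\<lambda>\<omega>. ?p2 \<omega> * g \<omega>)"
  proof (rule bounded_integrable[where B = "B * \<kappa>"])
    show "\<bar>?p2 \<omega> * g \<omega>\<bar> \<le> B * \<kappa>" for \<omega>
      unfolding abs_mult[of "?p2 \<omega>"] using B_nonneg by (intro mult_mono bd f''_bound g) auto
  qed measurable
  have q1: "integrable M ?q1" using p1g p2g by simp
  have q2: "integrable M ?q2"
  proof (rule bounded_integrable[where B = "B * \<kappa>\<^sup>2"])
    show "\<bar>?p2 \<omega> * (g \<omega>)\<^sup>2\<bar> \<le> B * \<kappa>\<^sup>2" for \<omega>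
    proof -
      have "\<bar>(g \<omega>)\<^sup>2\<bar> \<le> \<kappa>\<^sup>2" unfolding power_abs by (intro power_mono g) auto
      then show ?thesis
        unfolding abs_mult[of "?p2 \<omega>"] using B_nonneg by (intro mult_mono bd f''_bound) auto
    qed
  qed measurable
  have q1m: "?q1 \<in> borel_measurable (Fm s)" and q2m: "?q2 \<in> borel_measurable (Fm s)" by measurable
  have D: "integrable M ?D" "integrable M (\<lambda>\<omega>. (?D \<omega>)\<^sup>2)" "expectation ?D = 0" "expectation (\<lambda>\<omega>. (?D \<omega>)\<^sup>2) = h"
    using increment_moments(2)[OF st2, of 1] increment_moments(2)[OF st2, of 2] increment_moments(3,4)[OF st2]
    by (auto simp: h_def)
  have q1D: "integrable M (\<lambda>\<omega>. ?q1 \<omega> * ?D \<omega>)" "expectation (\<lambda>\<omega>. ?q1 \<omega> * ?D \<omega>) = expectation ?q1 * expectation ?D"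
    by (rule increment_product[OF q1m q1 st2, of "\<lambda>x. x"]; use D in simp)+
  have q2D: "integrable M (\<lambda>\<omega>. ?q2 \<omega> * (?D \<omega>)\<^sup>2)" "expectation (\<lambda>\<omega>. ?q2 \<omega> * (?D \<omega>)\<^sup>2) = expectation ?q2 * expectation (\<lambda>\<omega>. (?D \<omega>)\<^sup>2)"
    by (rule increment_product[OF q2m q2 st2, of "\<lambda>x. x\<^sup>2"]; use D in simp)+
  have eq: "U \<omega> * (f (z \<omega> + \<delta> * (t - s) + 2 * g \<omega> * ?D \<omega>) - f (z \<omega>)) =
    \<delta> * h * ?p1 \<omega> + \<delta>\<^sup>2 * h\<^sup>2 / 2 * ?p2 \<omega> + ?q1 \<omega> * ?D \<omega> + 2 * (?q2 \<omega> * (?D \<omega>)\<^sup>2) + U \<omega> * R \<omega>" for \<omega>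
  proof -
    have "f (z \<omega> + \<delta> * (t - s) + 2 * g \<omega> * ?D \<omega>) - f (z \<omega>) =
      f' (z \<omega>) * ?d \<omega> + f'' (z \<omega>) / 2 * (?d \<omega>)\<^sup>2 + R \<omega>"
      by (simp add: R_def h_def add.assoc)
    then show ?thesis by (simp only:) (simp add: power2_eq_square field_simps)
  qed
  have "expectation (\<lambda>\<omega>. U \<omega> * (f (z \<omega> + \<delta> * (t - s) + 2 * g \<omega> * ?D \<omega>) - f (z \<omega>))) =
    \<delta> * h * expectation ?p1 + \<delta>\<^sup>2 * h\<^sup>2 / 2 * expectation ?p2 + 2 * h * expectation ?q2 + expectation (\<lambda>\<omega>. U \<omega> * R \<omega>)"
  proof -
    have "expectation (\<lambda>\<omega>. U \<omega> * (f (z \<omega> + \<delta> * (t - s) + 2 * g \<omega> * ?D \<omega>) - f (z \<omega>))) =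
      \<delta> * h * expectation ?p1 + \<delta>\<^sup>2 * h\<^sup>2 / 2 * expectation ?p2 + expectation (\<lambda>\<omega>. ?q1 \<omega> * ?D \<omega>)
       + 2 * expectation (\<lambda>\<omega>. ?q2 \<omega> * (?D \<omega>)\<^sup>2) + expectation (\<lambda>\<omega>. U \<omega> * R \<omega>)"
      unfolding eq by (subst Bochner_Integration.integral_add
          | intro Bochner_Integration.integrable_add integrable_mult_right p1 p2 q1D(1) q2D(1) URi
          | simp only: integral_mult_right_zero)+
    then show ?thesis using q1D q2D D by simp
  qed
  moreover have "expectation (\<lambda>\<omega>. U \<omega> * (\<delta> * f' (z \<omega>) + 2 * (g \<omega>)\<^sup>2 * f'' (z \<omega>))) =
    \<delta> * expectation ?p1 + 2 * expectation ?q2"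
  proof -
    have "U \<omega> * (\<delta> * f' (z \<omega>) + 2 * (g \<omega>)\<^sup>2 * f'' (z \<omega>)) = \<delta> * ?p1 \<omega> + 2 * ?q2 \<omega>" for \<omega>
      by (simp add: algebra_simps)
    then show ?thesis using p1 q2 by simp
  qed
  ultimately have "expectation (\<lambda>\<omega>. U \<omega> * (f (z \<omega> + \<delta> * (t - s) + 2 * g \<omega> * ?D \<omega>) - f (z \<omega>)))
     - (t - s) * expectation (\<lambda>\<omega>. U \<omega> * (\<delta> * f' (z \<omega>) + 2 * (g \<omega>)\<^sup>2 * f'' (z \<omega>))) =
     \<delta>\<^sup>2 * h\<^sup>2 / 2 * expectation ?p2 + expectation (\<lambda>\<omega>. U \<omega> * R \<omega>)"
    unfolding h_def by (simp add: algebra_simps)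
  moreover have "\<bar>\<delta>\<^sup>2 * h\<^sup>2 / 2 * expectation ?p2\<bar> \<le> \<delta>\<^sup>2 * (h * sqrt h) * B"
  proof -
    have "\<bar>expectation ?p2\<bar> \<le> expectation (\<lambda>\<omega>. \<bar>?p2 \<omega>\<bar>)" by (rule integral_abs_bound)
    also have "\<dots> \<le> expectation (\<lambda>\<omega>. B)" using p2 by (intro integral_mono) (auto intro!: bd f''_bound)
    finally have "\<bar>expectation ?p2\<bar> \<le> B" by (simp add: prob_space)
    moreover have "\<delta>\<^sup>2 * h\<^sup>2 / 2 \<le> \<delta>\<^sup>2 * (h * sqrt h)"
    proof -
      have "h * h \<le> h * sqrt h"
        using h by (intro mult_left_mono real_le_rsqrt) (auto simp: power2_eq_square mult_left_le)
      then have "\<delta>\<^sup>2 * h\<^sup>2 \<le> \<delta>\<^sup>2 * (h * sqrt h)" by (intro mult_left_mono) (auto simp: power2_eq_square)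
      moreover have "0 \<le> \<delta>\<^sup>2 * (h * sqrt h)" using h by simp
      ultimately show ?thesis by linarith
    qed
    ultimately have "\<delta>\<^sup>2 * h\<^sup>2 / 2 * \<bar>expectation ?p2\<bar> \<le> \<delta>\<^sup>2 * (h * sqrt h) * B"
      using h by (intro mult_mono) auto
    then show ?thesis by (simp add: abs_mult)
  qed
  moreover have "B * (4 * \<delta> ^ 3 * h ^ 3 + 64 * \<kappa> ^ 3 * (h * sqrt h)) \<le> B * (4 * \<delta> ^ 3 * (h * sqrt h) + 64 * \<kappa> ^ 3 * (h * sqrt h))"
  proof -
    have "h * h\<^sup>2 \<le> h * sqrt h"
    proof (intro mult_left_mono real_le_rsqrt)
      have "h ^ 4 \<le> h ^ 1" using h by (intro power_decreasing) auto
      then show "(h\<^sup>2)\<^sup>2 \<le> h" by simp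
    qed (use h in auto)
    then have "h ^ 3 \<le> h * sqrt h" by (simp add: power3_eq_cube power2_eq_square)
    then show ?thesis using \<delta>_pos B_nonneg by (intro mult_left_mono add_right_mono) auto
  qed
  ultimately have "\<bar>expectation (\<lambda>\<omega>. U \<omega> * (f (z \<omega> + \<delta> * (t - s) + 2 * g \<omega> * ?D \<omega>) - f (z \<omega>)))
     - (t - s) * expectation (\<lambda>\<omega>. U \<omega> * (\<delta> * f' (z \<omega>) + 2 * (g \<omega>)\<^sup>2 * f'' (z \<omega>)))\<bar>
     \<le> \<delta>\<^sup>2 * (h * sqrt h) * B + B * (4 * \<delta> ^ 3 * (h * sqrt h) + 64 * \<kappa> ^ 3 * (h * sqrt h))"
    using URb by linarith
  also have "\<dots> = h * sqrt h * (B * (\<delta>\<^sup>2 + 4 * \<delta> ^ 3 + 64 * \<kappa> ^ 3))"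
    by (simp add: algebra_simps)
  finally show ?thesis unfolding h_def .
qed

lemma Z_Suc: "Z \<kappa> n (Suc j) \<omega> = Z \<kappa> n j \<omega> + \<delta> * (real (Suc j) / 2 ^ n - real j / 2 ^ n)
    + 2 * G \<kappa> (real j / 2 ^ n) \<omega> * (W (real (Suc j) / 2 ^ n) \<omega> - W (real j / 2 ^ n) \<omega>)"
  by (simp add: Z_def dsum_def algebra_simps add_divide_distrib)

lemma expectation_diff_le:
  fixes X a b c :: "'a \<Rightarrow> real"
  assumes "integrable M (\<lambda>\<omega>. X \<omega> * a \<omega>)" "integrable M (\<lambda>\<omega>. X \<omega> * b \<omega>)" "integrable M c"
    and "\<And>\<omega>. \<bar>X \<omega>\<bar> \<le> 1" "\<And>\<omega>. \<omega> \<in> space M \<Longrightarrow> \<bar>a \<omega> - b \<omega>\<bar> \<le> c \<omega>"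
  shows "\<bar>expectation (\<lambda>\<omega>. X \<omega> * a \<omega>) - expectation (\<lambda>\<omega>. X \<omega> * b \<omega>)\<bar> \<le> expectation c"
proof -
  have "\<bar>expectation (\<lambda>\<omega>. X \<omega> * a \<omega>) - expectation (\<lambda>\<omega>. X \<omega> * b \<omega>)\<bar>
    = \<bar>expectation (\<lambda>\<omega>. X \<omega> * a \<omega> - X \<omega> * b \<omega>)\<bar>" using assms by simp
  also have "\<dots> \<le> expectation (\<lambda>\<omega>. \<bar>X \<omega> * a \<omega> - X \<omega> * b \<omega>\<bar>)" by (rule integral_abs_bound)
  also have "\<dots> \<le> expectation c"
  proof (rule integral_mono)
    show "integrable M (\<lambda>\<omega>. \<bar>X \<omega> * a \<omega> - X \<omega> * b \<omega>\<bar>)" using assms by simp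
    fix \<omega> assume \<omega>: "\<omega> \<in> space M"
    have "\<bar>X \<omega> * a \<omega> - X \<omega> * b \<omega>\<bar> = \<bar>X \<omega>\<bar> * \<bar>a \<omega> - b \<omega>\<bar>"
      by (simp add: abs_mult[symmetric] right_diff_distrib)
    also have "\<dots> \<le> 1 * c \<omega>" using assms(4) assms(5)[OF \<omega>] by (intro mult_mono) auto
    finally show "\<bar>X \<omega> * a \<omega> - X \<omega> * b \<omega>\<bar> \<le> c \<omega>" by simp
  qed fact
  finally show ?thesis .
qed

text \<open>Since \<theta> once lost never returns, the counted increments form an initial block,
  and \<sigma> is where this block ends.\<close>

lemma stopped_telescope:
  fixes a :: "nat \<Rightarrow> real"
  assumes dec: "\<And>j. \<theta> (Suc j) \<Longrightarrow> \<theta> j" and le: "i \<le> N"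
  shows "\<exists>\<sigma>. (\<Sum>j=i..<N. of_bool (\<theta> j) * (a (Suc j) - a j)) = a \<sigma> - a i \<and> (\<theta> N \<longrightarrow> \<sigma> = N)"
  using le
proof (induction N rule: dec_induct)
  case base
  then show ?case by auto
next
  case (step N)
  then obtain \<sigma> where \<sigma>: "(\<Sum>j=i..<N. of_bool (\<theta> j) * (a (Suc j) - a j)) = a \<sigma> - a i" "\<theta> N \<longrightarrow> \<sigma> = N"
    by blast
  show ?case
  proof (cases "\<theta> N")
    case True
    then show ?thesis using \<sigma> step.hyps by (intro exI[of _ "Suc N"]) simp
  next
    case False
    then show ?thesis using \<sigma> step.hyps dec by (intro exI[of _ "\<sigma>"]) auto
  qed
qed

text \<open>The increments of \<open>f (Z \<kappa> n j)\<close> are counted only while the path is in \<open>Om\<close>; by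
  \<open>stopped_telescope\<close> the sum telescopes up to a path-dependent index, and exactly on \<open>Om\<close> at the last time.\<close>

lemma dyadic_error:
  assumes tf: "test_function f f' f'' B"
    and X: "X \<in> borel_measurable (Fm (real i / 2 ^ n))" "\<And>\<omega>. \<bar>X \<omega>\<bar> \<le> 1"
    and iN: "i \<le> N" and \<kappa>: "0 \<le> \<kappa>"
    and e: "\<And>j. j \<le> N \<Longrightarrow> expectation (\<lambda>\<omega>. indicator (Om (\<kappa>\<^sup>2) (real j / 2 ^ n)) \<omega> * min 1 \<bar>Y (real j / 2 ^ n) \<omega> - Z \<kappa> n j \<omega>\<bar>) \<le> e"
    and \<eta>: "prob (space M - Om (\<kappa>\<^sup>2) (real N / 2 ^ n)) \<le> \<eta>"
  shows "\<bar>expectation (\<lambda>\<omega>. X \<omega> * (f (Y (real N / 2 ^ n) \<omega>) - f (Y (real i / 2 ^ n) \<omega>)))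
      - (\<Sum>j=i..<N. 1 / 2 ^ n * expectation (\<lambda>\<omega>. X \<omega> * gen f' f'' (Y (real j / 2 ^ n) \<omega>)))\<bar>
    \<le> 4 * B * e + 4 * B * \<eta> + (real N - real i) / 2 ^ n *
      (sqrt (1 / 2 ^ n) * (B * (\<delta>\<^sup>2 + 4 * \<delta> ^ 3 + 64 * \<kappa> ^ 3)) + ((2 * \<delta> * B + 4 * \<kappa>\<^sup>2 * B) * e + (\<delta> * B + 2 * B) * \<eta>))"
proof -
  interpret test_function f f' f'' B by fact
  define t where "t j = real j / 2 ^ n" for j :: nat
  define h :: real where "h = 1 / 2 ^ n"
  have h: "0 < h" "h \<le> 1" by (auto simp: h_def field_simps)
  have t0 [simp, measurable]: "0 \<le> t j" for j by (simp add: t_def)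
  have t1: "t j < t (Suc j)" "t (Suc j) - t j = h" for j by (auto simp: t_def h_def field_simps)
  have tm: "t j \<le> t k" if "j \<le> k" for j k using that by (simp add: t_def divide_right_mono)
  let ?\<Theta> = "\<lambda>j. indicator (Om (\<kappa>\<^sup>2) (t j)) :: 'a \<Rightarrow> real"
  let ?\<Lambda> = "indicator (space M - Om (\<kappa>\<^sup>2) (t N)) :: 'a \<Rightarrow> real"
  let ?m = "\<lambda>j \<omega>. ?\<Theta> j \<omega> * min 1 \<bar>Y (t j) \<omega> - Z \<kappa> n j \<omega>\<bar>"
  let ?D = "\<lambda>j \<omega>. \<delta> * f' (Z \<kappa> n j \<omega>) + 2 * (G \<kappa> (t j) \<omega>)\<^sup>2 * f'' (Z \<kappa> n j \<omega>)"
  let ?S = "\<lambda>\<omega>. \<Sum>j=i..<N. ?\<Theta> j \<omega> * (f (Z \<kappa> n (Suc j) \<omega>) - f (Z \<kappa> n j \<omega>))"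
  let ?C1 = "B * (\<delta>\<^sup>2 + 4 * \<delta> ^ 3 + 64 * \<kappa> ^ 3)"
  \<comment> \<open>\<open>?C2\<close> is the price of replacing \<open>Z\<close> by Y in the drift
    on \<open>Om\<close>, where the coefficient G^2 equals \<bar>Y\<bar> and is at most \<kappa>^2.
    \<open>?C3\<close> bounds the generator everywhere and is paid only off
    \<open>Om\<close>.\<close>
  let ?C2 = "2 * \<delta> * B + 4 * \<kappa>\<^sup>2 * B"
  let ?C3 = "\<delta> * B + 2 * B"
  have XM [measurable]: "X \<in> borel_measurable M" by (rule measurable_FmD[OF X(1)]) simp
  have [measurable]: "gen f' f'' \<in> borel_measurable borel" unfolding gen_def by measurable
  have Xb: "\<bar>X \<omega> * a\<bar> \<le> b" if "\<bar>a\<bar> \<le> b" for \<omega> a b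
  proof -
    have "\<bar>X \<omega> * a\<bar> \<le> 1 * \<bar>a\<bar>" unfolding abs_mult using X(2) by (intro mult_right_mono) auto
    then show ?thesis using that by simp
  qed
  have \<Theta>b: "\<bar>?\<Theta> j \<omega> * a\<bar> \<le> \<bar>a\<bar>" for j \<omega> a by (simp add: indicator_def)
  have fd: "\<bar>f a - f b\<bar> \<le> 2 * B" for a b using f_bound[of a] f_bound[of b] by linarith
  have genb: "\<bar>gen f' f'' x\<bar> \<le> ?C3" for x
  proof -
    have "\<bar>\<delta> * f' x\<bar> \<le> \<delta> * B" using f'_bound \<delta>_pos by (simp add: abs_mult)
    moreover have "\<bar>2 * \<bar>x\<bar> * f'' x\<bar> \<le> 2 * B" using xf''_bound[of x] by (simp add: abs_mult)
    ultimately show ?thesis unfolding gen_def by linarith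
  qed
  have G2: "(G \<kappa> s \<omega>)\<^sup>2 \<le> \<kappa>\<^sup>2" for s \<omega>
    using G_bounded[OF \<kappa>, of s \<omega>] power_mono[of "\<bar>G \<kappa> s \<omega>\<bar>" \<kappa> 2] by simp
  have Db: "\<bar>?D j \<omega>\<bar> \<le> \<delta> * B + 2 * \<kappa>\<^sup>2 * B" for j \<omega>
  proof -
    have "\<bar>\<delta> * f' (Z \<kappa> n j \<omega>)\<bar> \<le> \<delta> * B" using f'_bound \<delta>_pos by (simp add: abs_mult)
    moreover have "\<bar>2 * (G \<kappa> (t j) \<omega>)\<^sup>2 * f'' (Z \<kappa> n j \<omega>)\<bar> \<le> 2 * \<kappa>\<^sup>2 * B"
      using G2[of "t j" \<omega>] f''_bound B_nonneg by (auto simp: abs_mult intro!: mult_mono)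
    ultimately show ?thesis by linarith
  qed
  have mi: "integrable M (?m j)" for j
    by (rule bounded_integrable[where B = 1]) (auto simp: indicator_def)
  have \<Lambda>i: "integrable M ?\<Lambda>" "expectation ?\<Lambda> \<le> \<eta>"
    using \<eta> by (auto simp: t_def intro!: bounded_integrable[where B = 1])
  have e': "expectation (?m j) \<le> e" if "j \<le> N" for j using e[OF that] by (simp add: t_def)
  have i1: "integrable M (\<lambda>\<omega>. X \<omega> * (?\<Theta> j \<omega> * (f (Z \<kappa> n (Suc j) \<omega>) - f (Z \<kappa> n j \<omega>))))" for j
    by (rule bounded_integrable[where B = "2 * B"]) (auto intro!: Xb order_trans[OF \<Theta>b fd])
  have i2: "integrable M (\<lambda>\<omega>. X \<omega> * (?\<Theta> j \<omega> * ?D j \<omega>))" for j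
    by (rule bounded_integrable) (auto intro!: Xb order_trans[OF \<Theta>b Db])
  have i3: "integrable M (\<lambda>\<omega>. X \<omega> * gen f' f'' (Y (t j) \<omega>))" for j
    by (rule bounded_integrable) (auto intro!: Xb genb)
  have i4: "integrable M (\<lambda>\<omega>. X \<omega> * (f (Y (t N) \<omega>) - f (Y (t i) \<omega>)))"
    by (rule bounded_integrable) (auto intro!: Xb fd)
  have XS: "X \<omega> * ?S \<omega> = (\<Sum>j=i..<N. X \<omega> * (?\<Theta> j \<omega> * (f (Z \<kappa> n (Suc j) \<omega>) - f (Z \<kappa> n j \<omega>))))" for \<omega>
    by (rule sum_distrib_left)
  have i5: "integrable M (\<lambda>\<omega>. X \<omega> * ?S \<omega>)"
    unfolding XS by (intro Bochner_Integration.integrable_sum i1)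
  have ES: "expectation (\<lambda>\<omega>. X \<omega> * ?S \<omega>) =
      (\<Sum>j=i..<N. expectation (\<lambda>\<omega>. X \<omega> * (?\<Theta> j \<omega> * (f (Z \<kappa> n (Suc j) \<omega>) - f (Z \<kappa> n j \<omega>)))))"
    unfolding XS by (intro Bochner_Integration.integral_sum i1)
  have "\<bar>expectation (\<lambda>\<omega>. X \<omega> * (f (Y (t N) \<omega>) - f (Y (t i) \<omega>))) - expectation (\<lambda>\<omega>. X \<omega> * ?S \<omega>)\<bar>
    \<le> expectation (\<lambda>\<omega>. 2 * B * ?m N \<omega> + 2 * B * ?m i \<omega> + 4 * B * ?\<Lambda> \<omega>)"
  proof (rule expectation_diff_le[OF i4 i5 _ X(2)])
    show "integrable M (\<lambda>\<omega>. 2 * B * ?m N \<omega> + 2 * B * ?m i \<omega> + 4 * B * ?\<Lambda> \<omega>)"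
      by (intro Bochner_Integration.integrable_add integrable_mult_right mi \<Lambda>i)
    fix \<omega> assume \<omega>: "\<omega> \<in> space M"
    have "\<exists>\<sigma>. (\<Sum>j=i..<N. of_bool (\<omega> \<in> Om (\<kappa>\<^sup>2) (t j)) * (f (Z \<kappa> n (Suc j) \<omega>) - f (Z \<kappa> n j \<omega>)))
        = f (Z \<kappa> n \<sigma> \<omega>) - f (Z \<kappa> n i \<omega>) \<and> (\<omega> \<in> Om (\<kappa>\<^sup>2) (t N) \<longrightarrow> \<sigma> = N)"
      by (rule stopped_telescope[OF _ iN]) (use Om_mono[OF tm[OF le_SucI[OF order_refl]]] in blast)
    then obtain \<sigma> where \<sigma>: "?S \<omega> = f (Z \<kappa> n \<sigma> \<omega>) - f (Z \<kappa> n i \<omega>)" "\<omega> \<in> Om (\<kappa>\<^sup>2) (t N) \<longrightarrow> \<sigma> = N"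
      by (auto simp: indicator_def of_bool_def)
    show "\<bar>f (Y (t N) \<omega>) - f (Y (t i) \<omega>) - ?S \<omega>\<bar> \<le> 2 * B * ?m N \<omega> + 2 * B * ?m i \<omega> + 4 * B * ?\<Lambda> \<omega>"
    proof (cases "\<omega> \<in> Om (\<kappa>\<^sup>2) (t N)")
      case True
      then have i: "\<omega> \<in> Om (\<kappa>\<^sup>2) (t i)" using Om_mono[OF tm[OF iN]] by blast
      have "\<bar>f (Y (t N) \<omega>) - f (Y (t i) \<omega>) - ?S \<omega>\<bar> \<le> \<bar>f (Y (t N) \<omega>) - f (Z \<kappa> n N \<omega>)\<bar> + \<bar>f (Y (t i) \<omega>) - f (Z \<kappa> n i \<omega>)\<bar>"
        using \<sigma> True by simp
      also have "\<dots> \<le> 2 * B * min 1 \<bar>Y (t N) \<omega> - Z \<kappa> n N \<omega>\<bar> + 2 * B * min 1 \<bar>Y (t i) \<omega> - Z \<kappa> n i \<omega>\<bar>"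
        by (intro add_mono f_diff)
      finally show ?thesis using True i by simp
    next
      case False
      have m0: "0 \<le> 2 * B * ?m j \<omega>" for j using B_nonneg by simp
      \<comment> \<open>Off the event only the size of f counts. Because the stopped sum telescopes,
        it is a difference of two values of f at whatever index \<sigma>, so the bound does not grow
        with the number of steps.\<close>
      have "\<bar>f (Y (t N) \<omega>) - f (Y (t i) \<omega>) - ?S \<omega>\<bar> \<le> 4 * B"
        unfolding \<sigma>(1) using fd[of "Y (t N) \<omega>" "Y (t i) \<omega>"] fd[of "Z \<kappa> n \<sigma> \<omega>" "Z \<kappa> n i \<omega>"] by linarith
      also have "4 * B = 4 * B * ?\<Lambda> \<omega>" using False \<omega> by simp
      finally show ?thesis using m0[of N] m0[of i] by linarith
    qed
  qed
  also have "\<dots> = 2 * B * expectation (?m N) + 2 * B * expectation (?m i) + 4 * B * expectation ?\<Lambda>"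
    using mi[of N] mi[of i] \<Lambda>i(1) by simp
  also have "\<dots> \<le> 2 * B * e + 2 * B * e + 4 * B * \<eta>"
    using e'[OF order_refl] e'[OF iN] \<Lambda>i(2) B_nonneg by (intro add_mono mult_left_mono) auto
  finally have s1: "\<bar>expectation (\<lambda>\<omega>. X \<omega> * (f (Y (t N) \<omega>) - f (Y (t i) \<omega>))) - expectation (\<lambda>\<omega>. X \<omega> * ?S \<omega>)\<bar>
    \<le> 4 * B * e + 4 * B * \<eta>" by simp
  have s2: "\<bar>expectation (\<lambda>\<omega>. X \<omega> * (?\<Theta> j \<omega> * (f (Z \<kappa> n (Suc j) \<omega>) - f (Z \<kappa> n j \<omega>))))
      - h * expectation (\<lambda>\<omega>. X \<omega> * gen f' f'' (Y (t j) \<omega>))\<bar>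
      \<le> h * (sqrt h * ?C1 + (?C2 * e + ?C3 * \<eta>))" if j: "j \<in> {i..<N}" for j
  proof -
    have ij: "i \<le> j" "j \<le> N" using j by auto
    have m1: "(\<lambda>\<omega>. X \<omega> * ?\<Theta> j \<omega>) \<in> borel_measurable (Fm (t j))"
      using measurable_Fm_mono[OF X(1), of "t j"] tm[OF ij(1)] Om_Fm[of "t j"]
      by (intro borel_measurable_times borel_measurable_indicator) (auto simp: t_def)
    have "\<bar>expectation (\<lambda>\<omega>. (X \<omega> * ?\<Theta> j \<omega>) * (f (Z \<kappa> n j \<omega> + \<delta> * (t (Suc j) - t j) + 2 * G \<kappa> (t j) \<omega> * (W (t (Suc j)) \<omega> - W (t j) \<omega>)) - f (Z \<kappa> n j \<omega>)))
     - (t (Suc j) - t j) * expectation (\<lambda>\<omega>. (X \<omega> * ?\<Theta> j \<omega>) * ?D j \<omega>)\<bar>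
      \<le> (t (Suc j) - t j) * sqrt (t (Suc j) - t j) * ?C1"
    proof (rule one_step[OF tf m1])
      show "\<bar>X \<omega> * ?\<Theta> j \<omega>\<bar> \<le> 1" for \<omega> using X(2)[of \<omega>] by (simp add: indicator_def)
      show "Z \<kappa> n j \<in> borel_measurable (Fm (t j))" unfolding t_def by (rule Z_measurable)
      show "G \<kappa> (t j) \<in> borel_measurable (Fm (t j))" by (rule G_adapted) simp
    qed (use t1 h G_bounded[OF \<kappa>] in auto)
    then have a1: "\<bar>expectation (\<lambda>\<omega>. X \<omega> * (?\<Theta> j \<omega> * (f (Z \<kappa> n (Suc j) \<omega>) - f (Z \<kappa> n j \<omega>))))
       - h * expectation (\<lambda>\<omega>. X \<omega> * (?\<Theta> j \<omega> * ?D j \<omega>))\<bar> \<le> h * (sqrt h * ?C1)"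
      unfolding t_def[of j, symmetric] Z_Suc t_def[of "Suc j", symmetric] t1(2) by (simp only: mult.assoc t1(2))
    have "\<bar>expectation (\<lambda>\<omega>. X \<omega> * (?\<Theta> j \<omega> * ?D j \<omega>)) - expectation (\<lambda>\<omega>. X \<omega> * gen f' f'' (Y (t j) \<omega>))\<bar>
      \<le> expectation (\<lambda>\<omega>. ?C2 * ?m j \<omega> + ?C3 * ?\<Lambda> \<omega>)"
    proof (rule expectation_diff_le[OF i2 i3 _ X(2)])
      show "integrable M (\<lambda>\<omega>. ?C2 * ?m j \<omega> + ?C3 * ?\<Lambda> \<omega>)"
        by (intro Bochner_Integration.integrable_add integrable_mult_right mi \<Lambda>i)
      fix \<omega> assume \<omega>: "\<omega> \<in> space M"
      have nn: "0 \<le> ?C2 * ?m j \<omega>" "0 \<le> ?C3 * ?\<Lambda> \<omega>" using B_nonneg \<delta>_pos by (auto simp: indicator_def)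
      show "\<bar>?\<Theta> j \<omega> * ?D j \<omega> - gen f' f'' (Y (t j) \<omega>)\<bar> \<le> ?C2 * ?m j \<omega> + ?C3 * ?\<Lambda> \<omega>"
      proof (cases "\<omega> \<in> Om (\<kappa>\<^sup>2) (t j)")
        case True
        then have Yb: "\<bar>Y (t j) \<omega>\<bar> \<le> \<kappa>\<^sup>2" by (auto simp: Om_def)
        then have "sqrt \<bar>Y (t j) \<omega>\<bar> \<le> \<kappa>" using \<kappa> by (intro real_le_lsqrt) auto
        then have GY: "(G \<kappa> (t j) \<omega>)\<^sup>2 = \<bar>Y (t j) \<omega>\<bar>" by (simp add: G_def)
        let ?mm = "min 1 \<bar>Y (t j) \<omega> - Z \<kappa> n j \<omega>\<bar>"
        have eq: "?\<Theta> j \<omega> * ?D j \<omega> - gen f' f'' (Y (t j) \<omega>) =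
          \<delta> * (f' (Z \<kappa> n j \<omega>) - f' (Y (t j) \<omega>)) + 2 * \<bar>Y (t j) \<omega>\<bar> * (f'' (Z \<kappa> n j \<omega>) - f'' (Y (t j) \<omega>))"
          using True by (simp add: gen_def GY algebra_simps)
        have "\<bar>\<delta> * (f' (Z \<kappa> n j \<omega>) - f' (Y (t j) \<omega>))\<bar> \<le> \<delta> * (2 * B * ?mm)"
          using f'_diff[of "Y (t j) \<omega>" "Z \<kappa> n j \<omega>"] \<delta>_pos by (simp add: abs_mult abs_minus_commute)
        moreover have "\<bar>2 * \<bar>Y (t j) \<omega>\<bar> * (f'' (Z \<kappa> n j \<omega>) - f'' (Y (t j) \<omega>))\<bar> \<le> 2 * \<kappa>\<^sup>2 * (2 * B * ?mm)"
          unfolding abs_mult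
          using f''_diff[of "Y (t j) \<omega>" "Z \<kappa> n j \<omega>"] Yb B_nonneg by (intro mult_mono) (auto simp: abs_minus_commute)
        ultimately have "\<bar>?\<Theta> j \<omega> * ?D j \<omega> - gen f' f'' (Y (t j) \<omega>)\<bar> \<le> \<delta> * (2 * B * ?mm) + 2 * \<kappa>\<^sup>2 * (2 * B * ?mm)"
          unfolding eq by linarith
        also have "\<dots> = ?C2 * ?m j \<omega>" using True by (simp add: algebra_simps)
        finally show ?thesis using nn by linarith
      next
        case False
        then have "\<omega> \<notin> Om (\<kappa>\<^sup>2) (t N)" using Om_mono[OF tm[OF ij(2)]] by blast
        then have "?\<Lambda> \<omega> = 1" using \<omega> by simp
        then show ?thesis using False genb[of "Y (t j) \<omega>"] nn by simp
      qed
    qed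
    also have "\<dots> = ?C2 * expectation (?m j) + ?C3 * expectation ?\<Lambda>"
      using mi[of j] \<Lambda>i(1) by simp
    also have "\<dots> \<le> ?C2 * e + ?C3 * \<eta>"
      using e'[OF ij(2)] \<Lambda>i(2) B_nonneg \<delta>_pos by (intro add_mono mult_left_mono) auto
    finally have "h * \<bar>expectation (\<lambda>\<omega>. X \<omega> * (?\<Theta> j \<omega> * ?D j \<omega>)) - expectation (\<lambda>\<omega>. X \<omega> * gen f' f'' (Y (t j) \<omega>))\<bar> \<le> h * (?C2 * e + ?C3 * \<eta>)"
      using h by (intro mult_left_mono) auto
    then have "\<bar>h * expectation (\<lambda>\<omega>. X \<omega> * (?\<Theta> j \<omega> * ?D j \<omega>)) - h * expectation (\<lambda>\<omega>. X \<omega> * gen f' f'' (Y (t j) \<omega>))\<bar> \<le> h * (?C2 * e + ?C3 * \<eta>)"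
      using h by (simp only: right_diff_distrib[symmetric] abs_mult abs_of_pos)
    with a1 show ?thesis unfolding distrib_left[of h] by linarith
  qed
  have "\<bar>expectation (\<lambda>\<omega>. X \<omega> * ?S \<omega>) - (\<Sum>j=i..<N. h * expectation (\<lambda>\<omega>. X \<omega> * gen f' f'' (Y (t j) \<omega>)))\<bar>
    \<le> (\<Sum>j=i..<N. h * (sqrt h * ?C1 + (?C2 * e + ?C3 * \<eta>)))"
    unfolding ES sum_subtractf[symmetric] by (rule order_trans[OF sum_abs sum_mono[OF s2]])
  also have "\<dots> = (real N - real i) / 2 ^ n * (sqrt h * ?C1 + (?C2 * e + ?C3 * \<eta>))"
    using iN by (simp add: h_def of_nat_diff)
  finally have s3: "\<bar>expectation (\<lambda>\<omega>. X \<omega> * ?S \<omega>) - (\<Sum>j=i..<N. h * expectation (\<lambda>\<omega>. X \<omega> * gen f' f'' (Y (t j) \<omega>)))\<bar>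
    \<le> (real N - real i) / 2 ^ n * (sqrt h * ?C1 + (?C2 * e + ?C3 * \<eta>))" .
  show ?thesis using s1 s3 unfolding t_def h_def by linarith
qed

lemma expectation_continuous:
  fixes \<phi> :: "real \<Rightarrow> real"
  assumes \<phi>: "continuous_on UNIV \<phi>" "\<And>x. \<bar>\<phi> x\<bar> \<le> C" and X: "X \<in> borel_measurable M" "\<And>\<omega>. \<bar>X \<omega>\<bar> \<le> 1"
  shows "continuous_on {0..} (\<lambda>t. expectation (\<lambda>\<omega>. X \<omega> * \<phi> (Y t \<omega>)))"
proof (rule continuous_on_sequentiallyI)
  fix u :: "nat \<Rightarrow> real" and a assume u: "\<forall>n. u n \<in> {0..}" "a \<in> {0..}" "u \<longlonglongrightarrow> a"
  note [measurable] = X(1) borel_measurable_continuous_onI[OF \<phi>(1)]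
  have ua: "\<And>n. 0 \<le> u n" "0 \<le> a" using u by auto
  show "(\<lambda>n. expectation (\<lambda>\<omega>. X \<omega> * \<phi> (Y (u n) \<omega>))) \<longlonglongrightarrow> expectation (\<lambda>\<omega>. X \<omega> * \<phi> (Y a \<omega>))"
  proof (rule integral_dominated_convergence[where w = "\<lambda>_. C"])
    show "AE \<omega> in M. (\<lambda>n. X \<omega> * \<phi> (Y (u n) \<omega>)) \<longlonglongrightarrow> X \<omega> * \<phi> (Y a \<omega>)"
    proof (rule AE_I2)
      fix \<omega> assume "\<omega> \<in> space M"
      then have "(\<lambda>n. Y (u n) \<omega>) \<longlonglongrightarrow> Y a \<omega>"
        by (rule continuous_on_tendsto_compose[OF Y_continuous u(3)]) (use u in auto)
      then have "(\<lambda>n. \<phi> (Y (u n) \<omega>)) \<longlonglongrightarrow> \<phi> (Y a \<omega>)"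
        by (rule continuous_on_tendsto_compose[OF \<phi>(1)]) auto
      then show "(\<lambda>n. X \<omega> * \<phi> (Y (u n) \<omega>)) \<longlonglongrightarrow> X \<omega> * \<phi> (Y a \<omega>)" by (rule tendsto_mult_left)
    qed
    show "AE \<omega> in M. norm (X \<omega> * \<phi> (Y (u n) \<omega>)) \<le> C" for n
    proof (rule AE_I2)
      fix \<omega>
      have "\<bar>X \<omega>\<bar> * \<bar>\<phi> (Y (u n) \<omega>)\<bar> \<le> 1 * C" using X(2) \<phi>(2) by (intro mult_mono) auto
      then show "norm (X \<omega> * \<phi> (Y (u n) \<omega>)) \<le> C" by (simp add: abs_mult)
    qed
  qed (use ua in measurable)
qed

text \<open>The number v stands for the mean of the generator, assumed nearly constant over the
  interval, so that no integral over time appears. The order of the choices is essential: \<kappa>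
  from the exceptional probability \<eta>, then e small against \<kappa>^2, then n large against
  \<kappa>^3. The error is then at most \<eta> C with C free of \<kappa>, and \<eta> is
  arbitrary.\<close>

lemma dynkin_dyadic:
  assumes tf: "test_function f f' f'' B"
    and X: "X \<in> borel_measurable (Fm (real i / 2 ^ n0))" "\<And>\<omega>. \<bar>X \<omega>\<bar> \<le> 1"
    and iN: "i \<le> N"
    and v: "\<And>r. real i / 2 ^ n0 \<le> r \<Longrightarrow> r \<le> real N / 2 ^ n0 \<Longrightarrow> \<bar>expectation (\<lambda>\<omega>. X \<omega> * gen f' f'' (Y r \<omega>)) - v\<bar> \<le> \<epsilon>"
  shows "\<bar>expectation (\<lambda>\<omega>. X \<omega> * (f (Y (real N / 2 ^ n0) \<omega>) - f (Y (real i / 2 ^ n0) \<omega>)))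
      - (real N / 2 ^ n0 - real i / 2 ^ n0) * v\<bar> \<le> \<epsilon> * (real N / 2 ^ n0 - real i / 2 ^ n0)"
proof -
  interpret test_function f f' f'' B by fact
  define s where "s = real i / 2 ^ n0"
  define t where "t = real N / 2 ^ n0"
  have st: "0 \<le> s" "s \<le> t" using iN by (auto simp: s_def t_def divide_right_mono)
  define D where "D = expectation (\<lambda>\<omega>. X \<omega> * (f (Y t \<omega>) - f (Y s \<omega>)))"
  define C where "C = 8 * B + (t - s) * (1 + 2 * \<delta> * B + 4 * B + (\<delta> * B + 2 * B))"
  have C: "0 \<le> C" using B_nonneg st \<delta>_pos by (simp add: C_def)
  have main: "\<bar>D - (t - s) * v\<bar> \<le> \<epsilon> * (t - s) + \<eta> * C" if \<eta>: "0 < \<eta>" for \<eta>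
  proof -
    obtain \<kappa> where \<kappa>: "0 \<le> \<kappa>" "prob (space M - Om (\<kappa>\<^sup>2) t) \<le> \<eta>"
      using Om_prob[of t \<eta>] st \<eta> by auto
    define e where "e = \<eta> / (1 + \<kappa>\<^sup>2)"
    have k1: "0 < 1 + \<kappa>\<^sup>2" by (simp add: add_pos_nonneg)
    have e: "0 < e" "e \<le> \<eta>" "\<kappa>\<^sup>2 * e \<le> \<eta>"
    proof -
      show "0 < e" using \<eta> k1 by (simp add: e_def)
      have "e * (1 + \<kappa>\<^sup>2) = \<eta>" using k1 by (simp add: e_def)
      then have "e + \<kappa>\<^sup>2 * e = \<eta>" by (simp add: algebra_simps)
      moreover have "0 \<le> \<kappa>\<^sup>2 * e" using \<open>0 < e\<close> by simp
      ultimately show "e \<le> \<eta>" "\<kappa>\<^sup>2 * e \<le> \<eta>" using \<open>0 < e\<close> by linarith+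
    qed
    let ?K = "B * (\<delta>\<^sup>2 + 4 * \<delta> ^ 3 + 64 * \<kappa> ^ 3)"
    have "eventually (\<lambda>n. \<forall>j. real j / 2 ^ n \<le> t + 1 \<longrightarrow>
        expectation (\<lambda>\<omega>. indicator (Om (\<kappa>\<^sup>2) (real j / 2 ^ n)) \<omega> * min 1 \<bar>Y (real j / 2 ^ n) \<omega> - Z \<kappa> n j \<omega>\<bar>) \<le> e) sequentially"
      using st by (intro Z_approx \<kappa> e) auto
    moreover have "eventually (\<lambda>n. sqrt (1 / 2 ^ n) * ?K < \<eta>) sequentially"
    proof (rule order_tendstoD(2)[OF _ \<eta>])
      have "(\<lambda>n. 1 / 2 ^ n :: real) \<longlonglongrightarrow> 0" by (rule LIMSEQ_divide_realpow_zero) simp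
      then have "(\<lambda>n. sqrt (1 / 2 ^ n) * ?K) \<longlonglongrightarrow> sqrt 0 * ?K" by (intro tendsto_intros)
      then show "(\<lambda>n. sqrt (1 / 2 ^ n) * ?K) \<longlonglongrightarrow> 0" by simp
    qed
    ultimately have "eventually (\<lambda>n. (\<forall>j. real j / 2 ^ n \<le> t + 1 \<longrightarrow>
        expectation (\<lambda>\<omega>. indicator (Om (\<kappa>\<^sup>2) (real j / 2 ^ n)) \<omega> * min 1 \<bar>Y (real j / 2 ^ n) \<omega> - Z \<kappa> n j \<omega>\<bar>) \<le> e)
        \<and> sqrt (1 / 2 ^ n) * ?K < \<eta> \<and> n0 \<le> n) sequentially"
      by (intro eventually_conj eventually_ge_at_top)
    then obtain n where n: "\<And>j. real j / 2 ^ n \<le> t + 1 \<Longrightarrow>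
        expectation (\<lambda>\<omega>. indicator (Om (\<kappa>\<^sup>2) (real j / 2 ^ n)) \<omega> * min 1 \<bar>Y (real j / 2 ^ n) \<omega> - Z \<kappa> n j \<omega>\<bar>) \<le> e"
      "sqrt (1 / 2 ^ n) * ?K < \<eta>" "n0 \<le> n"
      by (auto simp: eventually_sequentially)
    obtain k where k: "n = n0 + k" using n(3) le_Suc_ex by blast
    let ?i = "i * 2 ^ k" and ?N = "N * 2 ^ k"
    have si: "real ?i / 2 ^ n = s" "real ?N / 2 ^ n = t" by (auto simp: s_def t_def k power_add)
    have iN': "?i \<le> ?N" using iN by simp
    have Xm: "X \<in> borel_measurable (Fm (real ?i / 2 ^ n))" using X(1) unfolding si s_def .
    have jt: "real j / 2 ^ n \<le> t" if "j \<le> ?N" for j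
    proof -
      have "real j / 2 ^ n \<le> real ?N / 2 ^ n"
        using that by (intro divide_right_mono iffD2[OF of_nat_le_iff]) auto
      then show ?thesis unfolding si .
    qed
    have js: "s \<le> real j / 2 ^ n" if "?i \<le> j" for j
    proof -
      have "real ?i / 2 ^ n \<le> real j / 2 ^ n"
        using that by (intro divide_right_mono iffD2[OF of_nat_le_iff]) auto
      then show ?thesis unfolding si .
    qed
    have en: "expectation (\<lambda>\<omega>. indicator (Om (\<kappa>\<^sup>2) (real j / 2 ^ n)) \<omega> * min 1 \<bar>Y (real j / 2 ^ n) \<omega> - Z \<kappa> n j \<omega>\<bar>) \<le> e"
      if "j \<le> ?N" for j
      using n(1)[of j] jt[OF that] by linarith
    have pr: "prob (space M - Om (\<kappa>\<^sup>2) (real ?N / 2 ^ n)) \<le> \<eta>" unfolding si by (rule \<kappa>)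
    have len: "(real ?N - real ?i) / 2 ^ n = t - s" using si by (simp add: diff_divide_distrib)
    let ?R = "\<Sum>j=?i..<?N. 1 / 2 ^ n * expectation (\<lambda>\<omega>. X \<omega> * gen f' f'' (Y (real j / 2 ^ n) \<omega>))"
    have err: "\<bar>D - ?R\<bar> \<le> 4 * B * e + 4 * B * \<eta> + (t - s) *
      (sqrt (1 / 2 ^ n) * ?K + ((2 * \<delta> * B + 4 * \<kappa>\<^sup>2 * B) * e + (\<delta> * B + 2 * B) * \<eta>))"
      using dyadic_error[OF tf Xm X(2) iN' \<kappa>(1) en pr] unfolding len unfolding si D_def .
    also have "\<dots> \<le> 4 * B * \<eta> + 4 * B * \<eta> + (t - s) * (\<eta> + ((2 * \<delta> * B * \<eta> + 4 * B * \<eta>) + (\<delta> * B + 2 * B) * \<eta>))"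
    proof -
      have "4 * B * (\<kappa>\<^sup>2 * e) \<le> 4 * B * \<eta>" "2 * \<delta> * B * e \<le> 2 * \<delta> * B * \<eta>"
        using e B_nonneg \<delta>_pos by (auto intro!: mult_left_mono)
      then have "(2 * \<delta> * B + 4 * \<kappa>\<^sup>2 * B) * e \<le> 2 * \<delta> * B * \<eta> + 4 * B * \<eta>" by (simp add: algebra_simps)
      then show ?thesis using n(2) e st B_nonneg \<delta>_pos by (intro add_mono mult_left_mono) auto
    qed
    also have "\<dots> = \<eta> * C" by (simp add: C_def algebra_simps)
    finally have err': "\<bar>D - ?R\<bar> \<le> \<eta> * C" .
    have "\<bar>?R - (t - s) * v\<bar> \<le> \<epsilon> * (t - s)"
    proof -
      have "(t - s) * v = (\<Sum>j=?i..<?N. 1 / 2 ^ n * v)"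
        unfolding len[symmetric] using iN' by (simp add: of_nat_diff)
      then have "\<bar>?R - (t - s) * v\<bar> = \<bar>\<Sum>j=?i..<?N. 1 / 2 ^ n * expectation (\<lambda>\<omega>. X \<omega> * gen f' f'' (Y (real j / 2 ^ n) \<omega>)) - 1 / 2 ^ n * v\<bar>"
        by (simp only: sum_subtractf)
      also have "\<dots> \<le> (\<Sum>j=?i..<?N. \<bar>1 / 2 ^ n * expectation (\<lambda>\<omega>. X \<omega> * gen f' f'' (Y (real j / 2 ^ n) \<omega>)) - 1 / 2 ^ n * v\<bar>)"
        by (rule sum_abs)
      also have "\<dots> \<le> (\<Sum>j=?i..<?N. 1 / 2 ^ n * \<epsilon>)"
      proof (rule sum_mono)
        fix j assume j: "j \<in> {?i..<?N}"
        have "\<bar>expectation (\<lambda>\<omega>. X \<omega> * gen f' f'' (Y (real j / 2 ^ n) \<omega>)) - v\<bar> \<le> \<epsilon>"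
          using js[of j] jt[of j] j by (intro v) (auto simp: s_def t_def)
        then have "1 / 2 ^ n * \<bar>expectation (\<lambda>\<omega>. X \<omega> * gen f' f'' (Y (real j / 2 ^ n) \<omega>)) - v\<bar> \<le> 1 / 2 ^ n * \<epsilon>"
          by (intro mult_left_mono) auto
        then show "\<bar>1 / 2 ^ n * expectation (\<lambda>\<omega>. X \<omega> * gen f' f'' (Y (real j / 2 ^ n) \<omega>)) - 1 / 2 ^ n * v\<bar> \<le> 1 / 2 ^ n * \<epsilon>"
          by (simp only: right_diff_distrib[symmetric] abs_mult) simp
      qed
      also have "\<dots> = \<epsilon> * (t - s)" unfolding len[symmetric] using iN' by (simp add: of_nat_diff)
      finally show ?thesis .
    qed
    with err' show ?thesis by linarith
  qed
  have "\<bar>D - (t - s) * v\<bar> \<le> \<epsilon> * (t - s)"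
  proof (rule field_le_epsilon)
    fix x :: real assume x: "0 < x"
    have "x / (C + 1) * C \<le> x" using x C by (simp add: field_simps)
    then show "\<bar>D - (t - s) * v\<bar> \<le> \<epsilon> * (t - s) + x"
      using main[of "x / (C + 1)"] x C by simp
  qed
  then show ?thesis unfolding D_def t_def s_def .
qed

text \<open>Rounding goes upward so that a weight measurable at time s is still measurable at the
  dyadic time that replaces some a \<ge> s.\<close>

lemma dyadic_above:
  fixes a :: real
  assumes "0 \<le> a"
  shows "(\<lambda>n. real (nat \<lceil>2 ^ n * a\<rceil>) / 2 ^ n) \<longlonglongrightarrow> a" "a \<le> real (nat \<lceil>2 ^ n * a\<rceil>) / 2 ^ n"
proof -
  have eq: "real (nat \<lceil>2 ^ n * a\<rceil>) = real_of_int \<lceil>2 ^ n * a\<rceil>" for n :: nat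
    using assms by simp
  show ge: "a \<le> real (nat \<lceil>2 ^ n * a\<rceil>) / 2 ^ n" for n
    unfolding eq using le_of_int_ceiling[of "2 ^ n * a"] by (simp add: field_simps)
  have le: "real (nat \<lceil>2 ^ n * a\<rceil>) / 2 ^ n \<le> a + 1 / 2 ^ n" for n
    unfolding eq using ceiling_correct[of "2 ^ n * a"] by (simp add: field_simps)
  have "(\<lambda>n. 1 / 2 ^ n :: real) \<longlonglongrightarrow> 0" by (rule LIMSEQ_divide_realpow_zero) simp
  then have "(\<lambda>n. a + 1 / 2 ^ n) \<longlonglongrightarrow> a + 0" by (rule tendsto_add[OF tendsto_const])
  then have lim: "(\<lambda>n. a + 1 / 2 ^ n) \<longlonglongrightarrow> a" by simp
  show "(\<lambda>n. real (nat \<lceil>2 ^ n * a\<rceil>) / 2 ^ n) \<longlonglongrightarrow> a"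
    by (rule real_tendsto_sandwich[OF always_eventually[OF allI[OF ge]] always_eventually[OF allI[OF le]] tendsto_const lim])
qed

text \<open>In differential form the statement needs no integral over time: the mean of the
  generator is continuous, hence almost constant near t, and the dyadic estimate controls the
  difference quotient. The derivative is taken within \<open>{s..}\<close> because X is known only
  from s on; at t = s it is one-sided.\<close>

theorem dynkin:
  assumes tf: "test_function f f' f'' B"
    and X: "X \<in> borel_measurable (Fm s)" "\<And>\<omega>. \<bar>X \<omega>\<bar> \<le> 1"
    and st: "0 \<le> s" "s \<le> t"
  shows "((\<lambda>t. expectation (\<lambda>\<omega>. X \<omega> * f (Y t \<omega>))) has_real_derivative
    expectation (\<lambda>\<omega>. X \<omega> * gen f' f'' (Y t \<omega>))) (at t within {s..})"
proof -
  interpret test_function f f' f'' B by fact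
  let ?m = "\<lambda>t. expectation (\<lambda>\<omega>. X \<omega> * f (Y t \<omega>))"
  let ?g = "\<lambda>t. expectation (\<lambda>\<omega>. X \<omega> * gen f' f'' (Y t \<omega>))"
  have XM [measurable]: "X \<in> borel_measurable M" by (rule measurable_FmD[OF X(1) st(1)])
  have gc: "continuous_on UNIV (gen f' f'')"
    unfolding gen_def by (intro continuous_intros f'_continuous f''_continuous)
  have gb: "\<bar>gen f' f'' x\<bar> \<le> \<delta> * B + 2 * B" for x
  proof -
    have "\<bar>\<delta> * f' x\<bar> \<le> \<delta> * B" using f'_bound \<delta>_pos by (simp add: abs_mult)
    moreover have "\<bar>2 * \<bar>x\<bar> * f'' x\<bar> \<le> 2 * B" using xf''_bound[of x] by (simp add: abs_mult)
    ultimately show ?thesis unfolding gen_def by linarith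
  qed
  have mc: "continuous_on {0..} ?m" by (rule expectation_continuous[OF f_continuous f_bound XM X(2)])
  have gcont: "continuous_on {0..} ?g" by (rule expectation_continuous[OF gc gb XM X(2)])
  have key: "\<bar>?m b - ?m a - (b - a) * ?g t\<bar> \<le> \<epsilon> * (b - a)"
    if ab: "s \<le> a" "a \<le> b" "t - d < a" "b < t + d"
      and d: "\<And>r. s \<le> r \<Longrightarrow> t - d < r \<Longrightarrow> r < t + d \<Longrightarrow> \<bar>?g r - ?g t\<bar> \<le> \<epsilon>" for a b d \<epsilon>
  proof -
    let ?i = "\<lambda>(a::real) n. nat \<lceil>2 ^ n * a\<rceil>"
    let ?d = "\<lambda>(a::real) n. real (?i a n) / 2 ^ n"
    have a0: "0 \<le> a" "0 \<le> b" using ab st by auto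
    have lim: "(\<lambda>n. ?m (?d a n)) \<longlonglongrightarrow> ?m a" if "0 \<le> a" for a
      by (rule continuous_on_tendsto_compose[OF mc dyadic_above(1)[OF that]]) (use that in \<open>simp_all only: atLeast_iff divide_nonneg_nonneg of_nat_0_le_iff zero_le_power zero_le_numeral eventually_True\<close>)
    have "eventually (\<lambda>n. ?d b n < t + d) sequentially"
      by (rule order_tendstoD(2)[OF dyadic_above(1)[OF a0(2)] ab(4)])
    then have ev: "eventually (\<lambda>n. \<bar>?m (?d b n) - ?m (?d a n) - (?d b n - ?d a n) * ?g t\<bar> \<le> \<epsilon> * (?d b n - ?d a n)) sequentially"
    proof eventually_elim
      case (elim n)
      have Xn: "X \<in> borel_measurable (Fm (?d a n))"
        using dyadic_above(2)[OF a0(1), of n] ab st by (intro measurable_Fm_mono[OF X(1)]) auto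
      have ii: "?i a n \<le> ?i b n" using ab by (intro nat_mono ceiling_mono mult_left_mono) auto
      have "\<bar>expectation (\<lambda>\<omega>. X \<omega> * (f (Y (?d b n) \<omega>) - f (Y (?d a n) \<omega>))) - (?d b n - ?d a n) * ?g t\<bar> \<le> \<epsilon> * (?d b n - ?d a n)"
      proof (rule dynkin_dyadic[OF tf Xn X(2) ii])
        fix r assume "?d a n \<le> r" "r \<le> ?d b n"
        then show "\<bar>?g r - ?g t\<bar> \<le> \<epsilon>"
          using elim dyadic_above(2)[OF a0(1), of n] ab by (intro d) auto
      qed
      moreover have "expectation (\<lambda>\<omega>. X \<omega> * (f (Y (?d b n) \<omega>) - f (Y (?d a n) \<omega>))) = ?m (?d b n) - ?m (?d a n)"
      proof -
        have i: "integrable M (\<lambda>\<omega>. X \<omega> * f (Y (?d c n) \<omega>))" for c :: real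
        proof (rule bounded_integrable[where B = "1 * B"])
          show "\<bar>X \<omega> * f (Y (?d c n) \<omega>)\<bar> \<le> 1 * B" for \<omega>
            unfolding abs_mult using X(2) f_bound by (intro mult_mono) auto
        qed measurable
        show ?thesis unfolding right_diff_distrib by (rule Bochner_Integration.integral_diff[OF i i])
      qed
      ultimately show ?case by (simp only:)
    qed
    note l = lim[OF a0(1)] lim[OF a0(2)] dyadic_above(1)[OF a0(1)] dyadic_above(1)[OF a0(2)]
    have L1: "(\<lambda>n. \<bar>?m (?d b n) - ?m (?d a n) - (?d b n - ?d a n) * ?g t\<bar>) \<longlonglongrightarrow> \<bar>?m b - ?m a - (b - a) * ?g t\<bar>"
      by (rule tendsto_rabs[OF tendsto_diff[OF tendsto_diff[OF l(2,1)] tendsto_mult_right[OF tendsto_diff[OF l(4,3)]]]])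
    have L2: "(\<lambda>n. \<epsilon> * (?d b n - ?d a n)) \<longlonglongrightarrow> \<epsilon> * (b - a)"
      by (rule tendsto_mult_left[OF tendsto_diff[OF l(4,3)]])
    show ?thesis by (rule tendsto_le[OF sequentially_bot L2 L1 ev])
  qed
  show ?thesis
    unfolding has_field_derivative_def has_derivative_within_alt
  proof (intro conjI allI impI)
    show "bounded_linear (times (?g t))" by (rule bounded_linear_mult_right)
    fix \<epsilon> :: real assume \<epsilon>: "0 < \<epsilon>"
    have "t \<in> {0..}" using st by simp
    from gcont[unfolded continuous_on_iff, rule_format, OF this \<epsilon>]
    obtain d where d: "d > 0" "\<forall>r\<in>{0..}. dist r t < d \<longrightarrow> dist (?g r) (?g t) < \<epsilon>"
      by blast
    have d': "\<bar>?g r - ?g t\<bar> \<le> \<epsilon>" if "s \<le> r" "t - d < r" "r < t + d" for r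
    proof -
      have "dist (?g r) (?g t) < \<epsilon>"
        by (rule d(2)[rule_format]) (use that st in \<open>auto simp: dist_real_def\<close>)
      then show ?thesis by (simp add: dist_real_def)
    qed
    show "\<exists>d>0. \<forall>u\<in>{s..}. norm (u - t) < d \<longrightarrow> norm (?m u - ?m t - ?g t * (u - t)) \<le> \<epsilon> * norm (u - t)"
    proof (intro exI[of _ d] conjI ballI impI d(1))
      fix u assume u: "u \<in> {s..}" "norm (u - t) < d"
      show "norm (?m u - ?m t - ?g t * (u - t)) \<le> \<epsilon> * norm (u - t)"
      proof (cases "t \<le> u")
        case True
        then have "\<bar>?m u - ?m t - (u - t) * ?g t\<bar> \<le> \<epsilon> * (u - t)"
          by (intro key[of t u d \<epsilon>] d') (use u d(1) st in auto)
        then show ?thesis using True by (simp only: real_norm_def mult.commute[of "u - t"] abs_of_nonneg diff_ge_0_iff_ge)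
      next
        case False
        then have "\<bar>?m t - ?m u - (t - u) * ?g t\<bar> \<le> \<epsilon> * (t - u)" by (intro key[of u t d \<epsilon>] d') (use u d(1) in auto)
        moreover have "?m t - ?m u - (t - u) * ?g t = - (?m u - ?m t - ?g t * (u - t))" by (simp add: algebra_simps)
        ultimately show ?thesis using False by simp
      qed
    qed
  qed
qed

end

section \<open>Test functions glued at the origin\<close>

lemma DERIV_glue:
  fixes f1 f2 f1' f2' :: "real \<Rightarrow> real"
  assumes d1: "\<And>x. (f1 has_real_derivative f1' x) (at x)" and d2: "\<And>x. (f2 has_real_derivative f2' x) (at x)"
    and eq: "f1 0 = f2 0" "f1' 0 = f2' 0"
  shows "((\<lambda>x. if x \<le> 0 then f1 x else f2 x) has_real_derivative (if x \<le> 0 then f1' x else f2' x)) (at x)"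
proof -
  let ?f = "\<lambda>x. if x \<le> 0 then f1 x else f2 x"
  consider "x < 0" | "x > 0" | "x = 0" by linarith
  then show ?thesis
  proof cases
    case 1
    have "(?f has_real_derivative f1' x) (at x)"
      by (rule has_field_derivative_transform_within_open[OF d1[of x], of "{..<0}"]) (use 1 in auto)
    then show ?thesis using 1 by simp
  next
    case 2
    have "(?f has_real_derivative f2' x) (at x)"
      by (rule has_field_derivative_transform_within_open[OF d2[of x], of "{0<..}"]) (use 2 in auto)
    then show ?thesis using 2 by simp
  next
    case 3
    have l1: "((\<lambda>y. (f1 y - f1 0) / (y - 0)) \<longlongrightarrow> f1' 0) (at 0)"
      using d1[of 0] unfolding has_field_derivative_iff .
    have l2: "((\<lambda>y. (f2 y - f2 0) / (y - 0)) \<longlongrightarrow> f2' 0) (at 0)"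
      using d2[of 0] unfolding has_field_derivative_iff .
    have "((\<lambda>y. (?f y - ?f 0) / (y - 0)) \<longlongrightarrow> f1' 0) (at 0)"
    proof (rule filterlim_split_at)
      show "((\<lambda>y. (?f y - ?f 0) / (y - 0)) \<longlongrightarrow> f1' 0) (at_left 0)"
        using filterlim_mono[OF l1 order_refl at_le[of "{..<0}" UNIV]]
        by (rule Lim_transform_eventually) (auto simp: eventually_at_filter)
      show "((\<lambda>y. (?f y - ?f 0) / (y - 0)) \<longlongrightarrow> f1' 0) (at_right 0)"
        using filterlim_mono[OF l2 order_refl at_le[of "{0<..}" UNIV]] eq
        by (simp, elim Lim_transform_eventually) (auto simp: eventually_at_filter)
    qed
    then show ?thesis using 3 by (simp add: has_field_derivative_iff)
  qed
qed

text \<open>The third derivatives of the two pieces may differ at 0. Being bounded, they make f''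
  Lipschitz on either side, and an increment across 0 is split at 0.\<close>

lemma test_function_glue:
  fixes f1 f1' f1'' f1''' f2 f2' f2'' f2''' :: "real \<Rightarrow> real"
  assumes d1: "\<And>x. (f1 has_real_derivative f1' x) (at x)" "\<And>x. (f1' has_real_derivative f1'' x) (at x)"
      "\<And>x. (f1'' has_real_derivative f1''' x) (at x)"
    and d2: "\<And>x. (f2 has_real_derivative f2' x) (at x)" "\<And>x. (f2' has_real_derivative f2'' x) (at x)"
      "\<And>x. (f2'' has_real_derivative f2''' x) (at x)"
    and eq: "f1 0 = f2 0" "f1' 0 = f2' 0" "f1'' 0 = f2'' 0"
    and b1: "\<And>x. x \<le> 0 \<Longrightarrow> \<bar>f1 x\<bar> \<le> B" "\<And>x. x \<le> 0 \<Longrightarrow> \<bar>f1' x\<bar> \<le> B" "\<And>x. x \<le> 0 \<Longrightarrow> \<bar>f1'' x\<bar> \<le> B"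
      "\<And>x. x \<le> 0 \<Longrightarrow> \<bar>x * f1'' x\<bar> \<le> B" "\<And>x. x \<le> 0 \<Longrightarrow> \<bar>f1''' x\<bar> \<le> B"
    and b2: "\<And>x. 0 \<le> x \<Longrightarrow> \<bar>f2 x\<bar> \<le> B" "\<And>x. 0 \<le> x \<Longrightarrow> \<bar>f2' x\<bar> \<le> B" "\<And>x. 0 \<le> x \<Longrightarrow> \<bar>f2'' x\<bar> \<le> B"
      "\<And>x. 0 \<le> x \<Longrightarrow> \<bar>x * f2'' x\<bar> \<le> B" "\<And>x. 0 \<le> x \<Longrightarrow> \<bar>f2''' x\<bar> \<le> B"
  shows "test_function (\<lambda>x. if x \<le> 0 then f1 x else f2 x) (\<lambda>x. if x \<le> 0 then f1' x else f2' x)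
    (\<lambda>x. if x \<le> 0 then f1'' x else f2'' x) B"
proof
  let ?g = "\<lambda>x. if x \<le> 0 then f1'' x else f2'' x"
  have L1: "\<bar>f1'' x - f1'' y\<bar> \<le> B * \<bar>x - y\<bar>" if "x \<le> 0" "y \<le> 0" for x y
    using field_differentiable_bound[of "{..0}" f1'' f1''' B x y] d1(3) b1(5) that
    by (auto intro: has_field_derivative_at_within)
  have L2: "\<bar>f2'' x - f2'' y\<bar> \<le> B * \<bar>x - y\<bar>" if "0 \<le> x" "0 \<le> y" for x y
    using field_differentiable_bound[of "{0..}" f2'' f2''' B x y] d2(3) b2(5) that
    by (auto intro: has_field_derivative_at_within)
  have L3: "\<bar>f1'' x - f2'' y\<bar> \<le> B * \<bar>x - y\<bar>" if "x \<le> 0" "0 \<le> y" for x y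
  proof -
    have "\<bar>f1'' x - f2'' y\<bar> \<le> B * \<bar>x - 0\<bar> + B * \<bar>0 - y\<bar>"
      using L1[of x 0] L2[of 0 y] eq that by linarith
    also have "\<dots> = B * \<bar>x - y\<bar>" using that by (simp add: algebra_simps)
    finally show ?thesis .
  qed
  show "\<bar>?g x - ?g y\<bar> \<le> B * \<bar>x - y\<bar>" for x y
    using L1[of x y] L2[of x y] L3[of x y] L3[of y x] by (auto simp: abs_minus_commute)
  show "((\<lambda>x. if x \<le> 0 then f1 x else f2 x) has_real_derivative (if x \<le> 0 then f1' x else f2' x)) (at x)" for x
    by (rule DERIV_glue[OF d1(1) d2(1) eq(1,2)])
  show "((\<lambda>x. if x \<le> 0 then f1' x else f2' x) has_real_derivative (if x \<le> 0 then f1'' x else f2'' x)) (at x)" for x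
    by (rule DERIV_glue[OF d1(2) d2(2) eq(2,3)])
qed (use b1 b2 in auto)

text \<open>The inequality z / n \<le> exp (z / n), raised to the power n.\<close>

lemma power_exp_neg_le:
  fixes z :: real
  assumes "0 \<le> z" "0 < n"
  shows "z ^ n * exp (- z) \<le> real n ^ n"
proof -
  have "(z / real n) ^ n \<le> exp (z / real n) ^ n"
    using exp_ge_add_one_self[of "z / real n"] assms by (intro power_mono order_trans[OF _ exp_ge_add_one_self]) auto
  also have "\<dots> = exp z" using assms by (simp add: exp_of_nat_mult[symmetric])
  finally have "z ^ n \<le> real n ^ n * exp z" using assms by (simp add: field_simps)
  then show ?thesis by (simp add: exp_minus field_simps)
qed

text \<open>exp (- l x) is unbounded on the negative axis, so it is continued there by a combination
  of exp (k l x) with k = 1, 2, 3. The coefficients 6, -8, 3 solve the three equations for value 1,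
  slope - l and second derivative l^2 at 0. The bound collects sums of absolute coefficients: 17 = 6
  + 8 + 3, 65 = 6 + 32 + 27 for f'' and x f'', 151 = 6 + 64 + 81; the sum 31 = 6 + 16 + 9 for f' is
  absorbed in 65 l.\<close>

lemma exp_test_function:
  fixes l :: real
  assumes l: "0 < l"
  shows "test_function (\<lambda>x. if x \<le> 0 then 6 * exp (l * x) - 8 * exp (2 * l * x) + 3 * exp (3 * l * x) else exp (- (l * x)))
    (\<lambda>x. if x \<le> 0 then l * (6 * exp (l * x) - 16 * exp (2 * l * x) + 9 * exp (3 * l * x)) else - (l * exp (- (l * x))))
    (\<lambda>x. if x \<le> 0 then l\<^sup>2 * (6 * exp (l * x) - 32 * exp (2 * l * x) + 27 * exp (3 * l * x)) else l\<^sup>2 * exp (- (l * x)))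
    (17 + 65 * l + 65 * l\<^sup>2 + 151 * l ^ 3)"
proof (rule test_function_glue[where f1''' = "\<lambda>x. l ^ 3 * (6 * exp (l * x) - 64 * exp (2 * l * x) + 81 * exp (3 * l * x))"
      and f2''' = "\<lambda>x. - (l ^ 3 * exp (- (l * x)))"])
  fix x :: real
  show "((\<lambda>x. 6 * exp (l * x) - 8 * exp (2 * l * x) + 3 * exp (3 * l * x)) has_real_derivative
         l * (6 * exp (l * x) - 16 * exp (2 * l * x) + 9 * exp (3 * l * x))) (at x)"
    by (auto intro!: derivative_eq_intros simp: algebra_simps)
  show "((\<lambda>x. l * (6 * exp (l * x) - 16 * exp (2 * l * x) + 9 * exp (3 * l * x))) has_real_derivative
         l\<^sup>2 * (6 * exp (l * x) - 32 * exp (2 * l * x) + 27 * exp (3 * l * x))) (at x)"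
    by (auto intro!: derivative_eq_intros simp: algebra_simps power2_eq_square)
  show "((\<lambda>x. l\<^sup>2 * (6 * exp (l * x) - 32 * exp (2 * l * x) + 27 * exp (3 * l * x))) has_real_derivative
         l ^ 3 * (6 * exp (l * x) - 64 * exp (2 * l * x) + 81 * exp (3 * l * x))) (at x)"
    by (auto intro!: derivative_eq_intros simp: algebra_simps power2_eq_square power3_eq_cube)
  show "((\<lambda>x. exp (- (l * x))) has_real_derivative - (l * exp (- (l * x)))) (at x)"
    by (auto intro!: derivative_eq_intros)
  show "((\<lambda>x. - (l * exp (- (l * x)))) has_real_derivative l\<^sup>2 * exp (- (l * x))) (at x)"
    by (auto intro!: derivative_eq_intros simp: power2_eq_square)
  show "((\<lambda>x. l\<^sup>2 * exp (- (l * x))) has_real_derivative - (l ^ 3 * exp (- (l * x)))) (at x)"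
    by (auto intro!: derivative_eq_intros simp: power2_eq_square power3_eq_cube)
next
  fix x :: real assume x: "x \<le> 0"
  let ?e1 = "exp (l * x)" and ?e2 = "exp (2 * l * x)" and ?e3 = "exp (3 * l * x)"
  have lx: "l * x \<le> 0" using x l by (simp add: mult_nonneg_nonpos)
  have e: "0 < ?e1" "?e1 \<le> 1" "0 < ?e2" "?e2 \<le> ?e1" "0 < ?e3" "?e3 \<le> ?e1" using lx by auto
  have lp: "0 < l\<^sup>2" "0 < l ^ 3" using l by auto
  have comb: "\<bar>a * ?e1 - b * ?e2 + c * ?e3\<bar> \<le> (a + b + c) * ?e1" if "0 \<le> a" "0 \<le> b" "0 \<le> c" for a b c
  proof -
    have "a * ?e1 \<le> a * ?e1" "b * ?e2 \<le> b * ?e1" "c * ?e3 \<le> c * ?e1"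
      using e that by (auto intro: mult_left_mono)
    moreover have "0 \<le> a * ?e1" "0 \<le> b * ?e2" "0 \<le> c * ?e3" using that by auto
    ultimately show ?thesis by (simp add: algebra_simps)
  qed
  have comb1: "\<bar>a * ?e1 - b * ?e2 + c * ?e3\<bar> \<le> a + b + c" if "0 \<le> a" "0 \<le> b" "0 \<le> c" for a b c
  proof -
    have "(a + b + c) * ?e1 \<le> (a + b + c) * 1" using e that by (intro mult_left_mono) auto
    then show ?thesis using comb[OF that] by simp
  qed
  have "\<bar>6 * ?e1 - 8 * ?e2 + 3 * ?e3\<bar> \<le> 17" using comb1[of 6 8 3] by simp
  then show "\<bar>6 * ?e1 - 8 * ?e2 + 3 * ?e3\<bar> \<le> 17 + 65 * l + 65 * l\<^sup>2 + 151 * l ^ 3" using l lp by linarith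
  have "\<bar>l * (6 * ?e1 - 16 * ?e2 + 9 * ?e3)\<bar> \<le> l * 31"
    using comb1[of 6 16 9] l by (simp add: abs_mult)
  then show "\<bar>l * (6 * ?e1 - 16 * ?e2 + 9 * ?e3)\<bar> \<le> 17 + 65 * l + 65 * l\<^sup>2 + 151 * l ^ 3" using l lp by linarith
  have "\<bar>l\<^sup>2 * (6 * ?e1 - 32 * ?e2 + 27 * ?e3)\<bar> \<le> l\<^sup>2 * 65"
    using comb1[of 6 32 27] l by (simp add: abs_mult)
  then show "\<bar>l\<^sup>2 * (6 * ?e1 - 32 * ?e2 + 27 * ?e3)\<bar> \<le> 17 + 65 * l + 65 * l\<^sup>2 + 151 * l ^ 3" using l lp by linarith
  have "\<bar>l ^ 3 * (6 * ?e1 - 64 * ?e2 + 81 * ?e3)\<bar> \<le> l ^ 3 * 151"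
    using comb1[of 6 64 81] l by (simp add: abs_mult)
  then show "\<bar>l ^ 3 * (6 * ?e1 - 64 * ?e2 + 81 * ?e3)\<bar> \<le> 17 + 65 * l + 65 * l\<^sup>2 + 151 * l ^ 3" using l lp by linarith
  have "\<bar>x * (l\<^sup>2 * (6 * ?e1 - 32 * ?e2 + 27 * ?e3))\<bar> = \<bar>x\<bar> * l\<^sup>2 * \<bar>6 * ?e1 - 32 * ?e2 + 27 * ?e3\<bar>"
    by (simp add: abs_mult)
  also have "\<dots> \<le> \<bar>x\<bar> * l\<^sup>2 * (65 * ?e1)"
    using comb[of 6 32 27] by (intro mult_left_mono) auto
  also have "\<dots> = 65 * l * ((- (l * x)) ^ 1 * exp (- (- (l * x))))"
    using x by (simp add: power2_eq_square)
  also have "\<dots> \<le> 65 * l * 1"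
    using power_exp_neg_le[of "- (l * x)" 1] lx l by (intro mult_left_mono) auto
  finally show "\<bar>x * (l\<^sup>2 * (6 * ?e1 - 32 * ?e2 + 27 * ?e3))\<bar> \<le> 17 + 65 * l + 65 * l\<^sup>2 + 151 * l ^ 3" using l lp by linarith
next
  fix x :: real assume x: "0 \<le> x"
  have lx: "0 \<le> l * x" using x l by simp
  have e: "0 < exp (- (l * x))" "exp (- (l * x)) \<le> 1" using lx by auto
  have lp: "0 < l\<^sup>2" "0 < l ^ 3" using l by auto
  show "\<bar>exp (- (l * x))\<bar> \<le> 17 + 65 * l + 65 * l\<^sup>2 + 151 * l ^ 3" using e l lp by linarith
  have c: "\<bar>c * exp (- (l * x))\<bar> \<le> c" if "0 < c" for c
    using e that by (simp add: abs_mult)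
  show "\<bar>- (l * exp (- (l * x)))\<bar> \<le> 17 + 65 * l + 65 * l\<^sup>2 + 151 * l ^ 3" using c[OF l] l lp by linarith
  show "\<bar>l\<^sup>2 * exp (- (l * x))\<bar> \<le> 17 + 65 * l + 65 * l\<^sup>2 + 151 * l ^ 3" using c[OF lp(1)] l lp by linarith
  show "\<bar>- (l ^ 3 * exp (- (l * x)))\<bar> \<le> 17 + 65 * l + 65 * l\<^sup>2 + 151 * l ^ 3" using c[OF lp(2)] l lp by linarith
  have "\<bar>x * (l\<^sup>2 * exp (- (l * x)))\<bar> = l * ((l * x) ^ 1 * exp (- (l * x)))"
    using x l by (simp add: abs_mult power2_eq_square)
  also have "\<dots> \<le> l * 1" using power_exp_neg_le[of "l * x" 1] lx l by (intro mult_left_mono) auto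
  finally show "\<bar>x * (l\<^sup>2 * exp (- (l * x)))\<bar> \<le> 17 + 65 * l + 65 * l\<^sup>2 + 151 * l ^ 3" using l lp by linarith
qed (auto)

text \<open>A bounded version of the Yamada--Watanabe function of the negative half line: its drift
  under the generator is at most 4 uniformly in \<open>a\<close>, while it blows up there as \<open>a\<close> tends to 0.\<close>

lemma negative_part_test_function:
  fixes a :: real
  assumes a: "0 < a"
  obtains f f' f'' where "test_function f f' f'' (2 + 27 / a)" "\<And>x. 0 \<le> x \<Longrightarrow> f x = 0" "\<And>x. 0 \<le> f x"
    "\<And>x. f' x \<le> 0" "\<And>x. 2 * \<bar>x\<bar> * f'' x \<le> 4"
    "\<And>\<epsilon> x. 0 < \<epsilon> \<Longrightarrow> x \<le> - \<epsilon> \<Longrightarrow> \<epsilon> / 2 * (ln (1 + \<epsilon>\<^sup>2 / (4 * a)) * exp (- \<epsilon>)) \<le> f x"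
proof -
  let ?L = "\<lambda>x::real. ln (1 + x\<^sup>2 / a)"
  have pos: "0 < 1 + x\<^sup>2 / a" "0 < a + x\<^sup>2" for x using a by (auto simp: add_pos_nonneg)
  have Lb: "0 \<le> ?L x" "?L x \<le> x\<^sup>2 / a" for x
    using a ln_add_one_self_le_self[of "x\<^sup>2 / a"] by auto
  \<comment> \<open>\<open>k\<close> is the first derivative of the function sought. The logarithm
    tends to infinity as a tends to 0, while x times its derivative 2 x / (a + x^2) is at most 2 for
    every a; the factor exp x keeps the antiderivative bounded on the negative axis.\<close>
  define k where "k x = - (?L x * exp x)" for x
  define k' where "k' x = - ((2 * x / (a + x\<^sup>2) + ?L x) * exp x)" for x
  define k'' where "k'' x = - ((2 * (a - x\<^sup>2) / (a + x\<^sup>2)\<^sup>2 + 4 * x / (a + x\<^sup>2) + ?L x) * exp x)" for x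
  have dL: "(?L has_real_derivative 2 * x / (a + x\<^sup>2)) (at x)" for x
  proof -
    have "inverse (1 + x\<^sup>2 / a) = a / (a + x\<^sup>2)"
      using a pos[of x] by (simp add: field_simps)
    then have eq: "inverse (1 + x\<^sup>2 / a) * (2 * x / a) = 2 * x / (a + x\<^sup>2)" using a by simp
    have d1: "((\<lambda>x. 1 + x\<^sup>2 / a) has_real_derivative 2 * x / a) (at x)"
      using a by (auto intro!: derivative_eq_intros)
    from DERIV_chain2[where f = ln and g = "\<lambda>x. 1 + x\<^sup>2 / a" and x = x, OF DERIV_ln[OF pos(1)] d1]
    show ?thesis unfolding eq .
  qed
  have dk: "(k has_real_derivative k' x) (at x)" for x
    unfolding k_def k'_def
    by (rule DERIV_cong[OF DERIV_minus[OF DERIV_mult[OF dL DERIV_exp]]]) (simp add: algebra_simps)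
  have dq: "((\<lambda>x. 2 * x / (a + x\<^sup>2)) has_real_derivative 2 * (a - x\<^sup>2) / (a + x\<^sup>2)\<^sup>2) (at x)" for x
  proof -
    have "((\<lambda>x. 2 * x) has_real_derivative 2) (at x)" "((\<lambda>x. a + x\<^sup>2) has_real_derivative 2 * x) (at x)"
      by (auto intro!: derivative_eq_intros)
    moreover have "a + x\<^sup>2 \<noteq> 0" using pos(2)[of x] by linarith
    ultimately show ?thesis
      by (rule DERIV_cong[OF DERIV_divide]) (simp add: power2_eq_square algebra_simps)
  qed
  have dk': "(k' has_real_derivative k'' x) (at x)" for x
    unfolding k'_def k''_def
    by (rule DERIV_cong[OF DERIV_minus[OF DERIV_mult[OF DERIV_add[OF dq dL] DERIV_exp]]]) (simp add: algebra_simps)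
  have "\<exists>F. \<forall>x. -\<infinity> < ereal x \<longrightarrow> ereal x < \<infinity> \<longrightarrow> (F has_vector_derivative k x) (at x)"
    by (rule einterval_antiderivative) (use dk in \<open>auto intro: DERIV_isCont\<close>)
  then obtain F0 where F0: "\<And>x. (F0 has_real_derivative k x) (at x)"
    by (auto simp: has_real_derivative_iff_has_vector_derivative)
  define F where "F x = F0 x - F0 0" for x
  have dF: "(F has_real_derivative k x) (at x)" for x
    unfolding F_def using F0[of x] by (auto intro!: derivative_eq_intros)
  have kn: "k x \<le> 0" for x using Lb(1)[of x] by (simp add: k_def)
  have anti: "F v \<le> F u" if "u \<le> v" for u v
    by (rule DERIV_nonpos_imp_nonincreasing[OF that]) (use dF kn in blast)
  have F00: "F 0 = 0" by (simp add: F_def)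
  have Fb: "0 \<le> F x" "F x \<le> 2 / a" if "x \<le> 0" for x
  proof -
    show "0 \<le> F x" using anti[OF that] F00 by simp
    \<comment> \<open>The logarithm is at most x^2 / a, and (x^2 - 2 x + 2) exp x is an
      antiderivative of x^2 exp x. Its value 2 at the origin gives the bound 2 / a.\<close>
    define P where "P x = F x + (x\<^sup>2 - 2 * x + 2) * exp x / a" for x
    have dP: "(P has_real_derivative (k x + x\<^sup>2 / a * exp x)) (at x)" for x
    proof -
      have "((\<lambda>x. (x\<^sup>2 - 2 * x + 2) * exp x) has_real_derivative x\<^sup>2 * exp x) (at x)"
        by (auto intro!: derivative_eq_intros simp: algebra_simps)
      from DERIV_add[OF dF DERIV_cdivide[OF this, of a]] show ?thesis
        unfolding P_def by simp
    qed
    have "k x + x\<^sup>2 / a * exp x \<ge> 0" for x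
      using Lb(2)[of x] mult_right_mono[OF Lb(2)[of x], of "exp x"] by (simp add: k_def)
    then have "P x \<le> P 0"
      by (intro DERIV_nonneg_imp_nondecreasing[OF that]) (use dP in blast)
    moreover have "P x \<ge> F x"
    proof -
      have "0 \<le> x\<^sup>2 - 2 * x + 2" using that zero_le_power2[of x] by linarith
      then show ?thesis using a by (simp add: P_def)
    qed
    ultimately show "F x \<le> 2 / a" by (simp add: P_def F00)
  qed
  have pe: "\<bar>x\<bar> ^ n * exp x \<le> real n ^ n" if "x \<le> 0" "0 < n" for x :: real and n
    using power_exp_neg_le[of "- x" n] that by simp
  have e1: "exp x \<le> 1" if "x \<le> 0" for x :: real using that by simp
  have x2: "x\<^sup>2 / a * exp x \<le> 4 / a" if "x \<le> 0" for x
    using divide_right_mono[OF pe[OF that, of 2], of a] a by simp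
  have x1: "\<bar>x\<bar> * exp x \<le> 1" if "x \<le> 0" for x :: real using pe[OF that, of 1] by simp
  have Le: "?L x * exp x \<le> 4 / a" "0 \<le> ?L x * exp x" if "x \<le> 0" for x
    using x2[OF that] mult_right_mono[OF Lb(2)[of x], of "exp x"] Lb(1)[of x] by auto
  have q: "\<bar>2 * x / (a + x\<^sup>2)\<bar> \<le> 2 * \<bar>x\<bar> / a" for x
    using a by (auto simp: abs_mult intro!: divide_left_mono mult_pos_pos add_pos_nonneg)
  have qe: "\<bar>2 * x / (a + x\<^sup>2) * exp x\<bar> \<le> 2 / a" if "x \<le> 0" for x
  proof -
    have "\<bar>2 * x / (a + x\<^sup>2) * exp x\<bar> = \<bar>2 * x / (a + x\<^sup>2)\<bar> * exp x" by (simp add: abs_mult)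
    also have "\<dots> \<le> 2 * \<bar>x\<bar> / a * exp x" using q by (intro mult_right_mono) auto
    also have "\<dots> = 2 / a * (\<bar>x\<bar> * exp x)" by simp
    also have "\<dots> \<le> 2 / a * 1" using x1[OF that] a by (intro mult_left_mono) auto
    finally show ?thesis by simp
  qed
  have tri: "\<bar>c\<bar> \<le> A + B" if "c = - u - v" "\<bar>u\<bar> \<le> A" "\<bar>v\<bar> \<le> B" for c u v A B :: real
    using that by linarith
  have Le': "\<bar>?L x * exp x\<bar> \<le> 4 / a" if "x \<le> 0" for x using Le[OF that] by simp
  have k'b: "\<bar>k' x\<bar> \<le> 6 / a" if "x \<le> 0" for x
  proof -
    have "k' x = - (2 * x / (a + x\<^sup>2) * exp x) - ?L x * exp x" by (simp add: k'_def algebra_simps)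
    from tri[OF this qe[OF that] Le'[OF that]] have "\<bar>k' x\<bar> \<le> 2 / a + 4 / a" .
    then show ?thesis by simp
  qed
  have xq: "\<bar>x * (2 * x / (a + x\<^sup>2))\<bar> \<le> 2" for x
    using a pos(2)[of x] by (simp add: abs_mult field_simps power2_eq_square)
  \<comment> \<open>This estimate fixes the constant 2 + 27 / a: the 2 is \<open>xq\<close>, and 27
    = 3^3 bounds \<bar>x\<bar>^3 exp x.\<close>
  have xk'b: "\<bar>x * k' x\<bar> \<le> 2 + 27 / a" if "x \<le> 0" for x
  proof -
    have e: "x * k' x = - (x * (2 * x / (a + x\<^sup>2)) * exp x) - x * (?L x * exp x)" by (simp add: k'_def algebra_simps)
    have i: "\<bar>x * (2 * x / (a + x\<^sup>2)) * exp x\<bar> \<le> 2 * 1"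
      unfolding abs_mult[of _ "exp x"] using xq[of x] e1[OF that] by (intro mult_mono) auto
    have ii: "\<bar>x * (?L x * exp x)\<bar> \<le> 27 / a"
    proof -
      have "\<bar>x * (?L x * exp x)\<bar> = \<bar>x\<bar> * exp x * ?L x" using Lb(1)[of x] by (simp add: abs_mult)
      also have "\<dots> \<le> \<bar>x\<bar> * exp x * (x\<^sup>2 / a)" using Lb(2) by (intro mult_left_mono) auto
      also have "\<dots> = \<bar>x\<bar> ^ 3 * exp x / a" by (simp add: power2_eq_square power3_eq_cube)
      also have "\<dots> \<le> 27 / a" using pe[OF that, of 3] a by (intro divide_right_mono) auto
      finally show ?thesis .
    qed
    show ?thesis using tri[OF e i ii] by simp
  qed
  have k''b: "\<bar>k'' x\<bar> \<le> 10 / a" if "x \<le> 0" for x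
  proof -
    have i: "\<bar>2 * (a - x\<^sup>2) / (a + x\<^sup>2)\<^sup>2 * exp x\<bar> \<le> 2 / a * 1"
      unfolding abs_mult[of _ "exp x"]
    proof (rule mult_mono)
      have "\<bar>a - x\<^sup>2\<bar> \<le> a + x\<^sup>2" using a by (simp add: abs_le_iff)
      then have "\<bar>2 * (a - x\<^sup>2) / (a + x\<^sup>2)\<^sup>2\<bar> \<le> 2 * (a + x\<^sup>2) / (a + x\<^sup>2)\<^sup>2"
        using pos(2)[of x] by (auto simp: abs_mult intro!: divide_right_mono)
      also have "\<dots> = 2 / (a + x\<^sup>2)" using pos(2)[of x] unfolding power2_eq_square[of "a + x\<^sup>2"] by (simp del: distrib_left_numeral)
      also have "\<dots> \<le> 2 / a" using a by (auto intro!: divide_left_mono mult_pos_pos add_pos_nonneg)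
      finally show "\<bar>2 * (a - x\<^sup>2) / (a + x\<^sup>2)\<^sup>2\<bar> \<le> 2 / a" .
    qed (use e1[OF that] a in auto)
    have e: "k'' x = - (2 * (a - x\<^sup>2) / (a + x\<^sup>2)\<^sup>2 * exp x) - (2 * (2 * x / (a + x\<^sup>2) * exp x) + ?L x * exp x)"
      by (simp add: k''_def algebra_simps)
    have ii: "\<bar>2 * (2 * x / (a + x\<^sup>2) * exp x) + ?L x * exp x\<bar> \<le> 2 * (2 / a) + 4 / a"
      by (intro order_trans[OF abs_triangle_ineq] add_mono Le'[OF that])
        (simp only: abs_mult[of 2] abs_numeral mult_left_mono[OF qe[OF that]] zero_le_numeral)
    show ?thesis using tri[OF e i ii] by simp
  qed
  have ab: "c / a \<le> 2 + 27 / a" if "c \<le> 27" for c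
    using divide_right_mono[OF that, of a] a by linarith
  have tf: "test_function (\<lambda>x. if x \<le> 0 then F x else 0) (\<lambda>x. if x \<le> 0 then k x else 0) (\<lambda>x. if x \<le> 0 then k' x else 0) (2 + 27 / a)"
  proof (rule test_function_glue[OF dF dk dk', where f2''' = "\<lambda>_. 0"])
    fix x :: real assume x: "x \<le> 0"
    show "\<bar>F x\<bar> \<le> 2 + 27 / a" using Fb[OF x] ab[of 2] by simp
    show "\<bar>k x\<bar> \<le> 2 + 27 / a" using Le[OF x] ab[of 4] by (simp add: k_def)
    show "\<bar>k' x\<bar> \<le> 2 + 27 / a" using k'b[OF x] ab[of 6] by simp
    show "\<bar>k'' x\<bar> \<le> 2 + 27 / a" using k''b[OF x] ab[of 10] by simp
    show "\<bar>x * k' x\<bar> \<le> 2 + 27 / a" by (rule xk'b[OF x])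
  qed (use a F00 in \<open>auto simp: k_def k'_def\<close>)
  show ?thesis
  proof (rule that[OF tf])
    show "(if x \<le> 0 then F x else 0) = 0" if "0 \<le> x" for x using that F00 by (cases "x = 0") auto
    show "0 \<le> (if x \<le> 0 then F x else 0)" for x using Fb by simp
    show "(if x \<le> 0 then k x else 0) \<le> 0" for x using kn by simp
    show "2 * \<bar>x\<bar> * (if x \<le> 0 then k' x else 0) \<le> 4" for x
    proof (cases "x \<le> 0")
      case True
      \<comment> \<open>The term with the logarithm, which is not bounded uniformly in a, has the
        favourable sign and is dropped.\<close>
      have "\<bar>x\<bar> * k' x = x * (2 * x / (a + x\<^sup>2)) * exp x - \<bar>x\<bar> * (?L x * exp x)"
        using True by (simp add: k'_def algebra_simps)
      also have "\<dots> \<le> x * (2 * x / (a + x\<^sup>2)) * exp x" using Le(2)[OF True] by simp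
      also have "\<dots> \<le> 2 * 1"
      proof (rule mult_mono)
        show "x * (2 * x / (a + x\<^sup>2)) \<le> 2" using xq[of x] by (rule order_trans[OF abs_ge_self])
      qed (use e1[OF True] in auto)
      finally show ?thesis using True by simp
    qed simp
    fix \<epsilon> x :: real assume \<epsilon>: "0 < \<epsilon>" "x \<le> - \<epsilon>"
    \<comment> \<open>Between - \<epsilon> and - \<epsilon> / 2 the slope is already large, since
      z^2 \<ge> \<epsilon>^2 / 4 there; as F is nonincreasing, the value reached at - \<epsilon>
      bounds F from below further left.\<close>
    have "\<exists>z. - \<epsilon> < z \<and> z < - \<epsilon> / 2 \<and> F (- \<epsilon> / 2) - F (- \<epsilon>) = (- \<epsilon> / 2 - - \<epsilon>) * k z"
      by (rule MVT2) (use \<epsilon> dF in auto)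
    then obtain z where z: "- \<epsilon> < z" "z < - \<epsilon> / 2" "F (- \<epsilon> / 2) - F (- \<epsilon>) = \<epsilon> / 2 * k z"
      by (auto simp: field_simps)
    have "(\<epsilon> / 2)\<^sup>2 \<le> z\<^sup>2" using z \<epsilon> power_mono[of "\<epsilon> / 2" "- z" 2] by auto
    then have "\<epsilon>\<^sup>2 / (4 * a) \<le> z\<^sup>2 / a" using a by (simp add: power_divide field_simps)
    then have "ln (1 + \<epsilon>\<^sup>2 / (4 * a)) \<le> ?L z" using a by (intro iffD2[OF ln_le_cancel_iff]) (auto simp: add_pos_nonneg)
    moreover have "exp (- \<epsilon>) \<le> exp z" using z by simp
    moreover have "0 \<le> ln (1 + \<epsilon>\<^sup>2 / (4 * a))" using a by simp
    ultimately have "ln (1 + \<epsilon>\<^sup>2 / (4 * a)) * exp (- \<epsilon>) \<le> ?L z * exp z"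
      using Lb(1)[of z] by (intro mult_mono) auto
    then have "\<epsilon> / 2 * (ln (1 + \<epsilon>\<^sup>2 / (4 * a)) * exp (- \<epsilon>)) \<le> \<epsilon> / 2 * (- k z)"
      using \<epsilon> unfolding k_def by (intro mult_left_mono) auto
    also have "\<dots> = F (- \<epsilon>) - F (- \<epsilon> / 2)" using z(3) by simp
    also have "\<dots> \<le> F (- \<epsilon>)" using Fb(1)[of "- \<epsilon> / 2"] \<epsilon> by simp
    also have "\<dots> \<le> F x" using anti[OF \<epsilon>(2)] .
    finally show "\<epsilon> / 2 * (ln (1 + \<epsilon>\<^sup>2 / (4 * a)) * exp (- \<epsilon>)) \<le> (if x \<le> 0 then F x else 0)" using \<epsilon> by simp
  qed
qed

section \<open>Nonnegativity and Laplace transforms\<close>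

text \<open>Taylor in the parameter b. The intermediate parameter is at least \<beta>, so the
  remainder keeps a factor exp (- \<beta> v) and is bounded in v. It serves both for moving along
  the characteristic and for differentiating Laplace transforms.\<close>

lemma exp_second_order:
  fixes v b b' \<beta> :: real
  assumes "0 \<le> v" "\<beta> \<le> b" "\<beta> \<le> b'"
  shows "\<bar>exp (- (b' * v)) - exp (- (b * v)) + (b' - b) * (v * exp (- (b * v)))\<bar> \<le> v\<^sup>2 * exp (- (\<beta> * v)) * (b' - b)\<^sup>2"
proof (cases "b' = b")
  case False
  let ?D = "\<lambda>(m::nat) c. (- v) ^ m * exp (- (c * v))"
  have "\<exists>t. (if b' < b then b' < t \<and> t < b else b < t \<and> t < b') \<and>
    exp (- (b' * v)) = (\<Sum>m<2. ?D m b / fact m * (b' - b) ^ m) + ?D 2 t / fact 2 * (b' - b) ^ 2"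
  proof (rule Taylor[where a = "min b b'" and b = "max b b'"])
    show "\<forall>m t. m < 2 \<and> min b b' \<le> t \<and> t \<le> max b b' \<longrightarrow> (?D m has_real_derivative ?D (Suc m) t) (at t)"
      by (auto intro!: derivative_eq_intros)
  qed (use False in auto)
  then obtain t where t0: "if b' < b then b' < t \<and> t < b else b < t \<and> t < b'"
    and eq0: "exp (- (b' * v)) = (\<Sum>m<2. ?D m b / fact m * (b' - b) ^ m) + ?D 2 t / fact 2 * (b' - b) ^ 2"
    by blast
  have t: "\<beta> \<le> t" using t0 assms by (auto split: if_splits)
  have eq: "exp (- (b' * v)) = exp (- (b * v)) - v * exp (- (b * v)) * (b' - b) + v\<^sup>2 * exp (- (t * v)) / 2 * (b' - b)\<^sup>2"
    unfolding eq0 by (simp add: numeral_2_eq_2)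
  have e: "exp (- (b' * v)) - exp (- (b * v)) + (b' - b) * (v * exp (- (b * v))) = v\<^sup>2 * exp (- (t * v)) / 2 * (b' - b)\<^sup>2"
    unfolding eq by (simp add: algebra_simps)
  have "v\<^sup>2 * exp (- (t * v)) \<le> v\<^sup>2 * exp (- (\<beta> * v))"
    using t assms by (intro mult_left_mono) (auto intro: mult_right_mono)
  moreover have "0 \<le> v\<^sup>2 * exp (- (t * v))" by simp
  ultimately have le: "v\<^sup>2 * exp (- (t * v)) / 2 \<le> v\<^sup>2 * exp (- (\<beta> * v))" by linarith
  have "\<bar>v\<^sup>2 * exp (- (t * v)) / 2 * (b' - b)\<^sup>2\<bar> = v\<^sup>2 * exp (- (t * v)) / 2 * (b' - b)\<^sup>2" by simp
  also have "\<dots> \<le> v\<^sup>2 * exp (- (\<beta> * v)) * (b' - b)\<^sup>2" by (rule mult_right_mono[OF le]) simp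
  finally show ?thesis unfolding e .
qed simp

lemma scaled_power_exp_le:
  fixes v \<beta> :: real
  assumes "0 \<le> v" "0 < \<beta>" "0 < n"
  shows "v ^ n * exp (- (\<beta> * v)) \<le> (real n / \<beta>) ^ n"
  using power_exp_neg_le[of "\<beta> * v" n] assms by (simp add: power_mult_distrib power_divide field_simps)

context besq_sol
begin

text \<open>The mean of the test function grows at most at rate 4, whatever a, while on the event
  that Y is below - \<epsilon> the function exceeds any number once a is small. The event must
  therefore be null.\<close>

lemma Y_nonneg_at:
  assumes t: "0 \<le> t"
  shows "AE \<omega> in M. 0 \<le> Y t \<omega>"
proof -
  have bound: "expectation (\<lambda>\<omega>. f (Y t \<omega>)) \<le> 4 * t"
    if tf: "test_function f f' f'' B" and f0: "\<And>x. 0 \<le> x \<Longrightarrow> f x = 0" and f'n: "\<And>x. f' x \<le> 0"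
      and f''b: "\<And>x. 2 * \<bar>x\<bar> * f'' x \<le> 4" for f f' f'' B
  proof -
    interpret test_function f f' f'' B by fact
    let ?m = "\<lambda>t. expectation (\<lambda>\<omega>. 1 * f (Y t \<omega>))"
    have gl: "gen f' f'' x \<le> 4" for x
      using f'n[of x] f''b[of x] \<delta>_pos mult_nonneg_nonpos[of \<delta> "f' x"] unfolding gen_def by linarith
    have dm: "(?m has_real_derivative expectation (\<lambda>\<omega>. 1 * gen f' f'' (Y r \<omega>))) (at r within {0..})" if "0 \<le> r" for r
      by (rule dynkin[OF tf _ _ _ that]) auto
    have "?m t - 4 * t \<le> ?m 0 - 4 * 0"
    proof (cases "t = 0")
      case False
      show ?thesis
      proof (rule DERIV_nonpos_imp_decreasing_open[of 0 t "\<lambda>r. ?m r - 4 * r"])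
        show "continuous_on {0..t} (\<lambda>r. ?m r - 4 * r)"
        proof (intro continuous_intros)
          show "continuous_on {0..t} ?m"
            by (rule continuous_on_subset[OF expectation_continuous[OF f_continuous f_bound]]) auto
        qed
        fix r assume r: "0 < r" "r < t"
        have "at r within {0..} = at r"
          by (rule at_within_open_subset[of r "{0<..}"]) (use r in auto)
        then have "(?m has_real_derivative expectation (\<lambda>\<omega>. 1 * gen f' f'' (Y r \<omega>))) (at r)"
          using dm[of r] r by simp
        then have "((\<lambda>r. ?m r - 4 * r) has_real_derivative expectation (\<lambda>\<omega>. 1 * gen f' f'' (Y r \<omega>)) - 4) (at r)"
          by (auto intro!: derivative_eq_intros)
        \<comment> \<open>If the integrand were not integrable, the expectation would have the
          default value 0, which obeys the same bound.\<close>
        moreover have "expectation (\<lambda>\<omega>. 1 * gen f' f'' (Y r \<omega>)) \<le> 4"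
        proof (cases "integrable M (\<lambda>\<omega>. 1 * gen f' f'' (Y r \<omega>))")
          case True
          have "expectation (\<lambda>\<omega>. 1 * gen f' f'' (Y r \<omega>)) \<le> expectation (\<lambda>\<omega>. 4)"
            using True gl by (intro integral_mono) auto
          then show ?thesis by (simp add: prob_space)
        qed (simp add: not_integrable_integral_eq)
        ultimately show "\<exists>y. ((\<lambda>r. ?m r - 4 * r) has_real_derivative y) (at r) \<and> y \<le> 0" by force
      qed (use t in auto)
    qed auto
    moreover have "?m 0 = expectation (\<lambda>\<omega>. 0)"
      by (rule integral_cong_AE) (use Y_start f0 y_nonneg in auto)
    ultimately show ?thesis by simp
  qed
  have null: "prob {\<omega>\<in>space M. Y t \<omega> \<le> - \<epsilon>} = 0" if \<epsilon>: "0 < \<epsilon>" for \<epsilon>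
  proof -
    let ?A = "{\<omega>\<in>space M. Y t \<omega> \<le> - \<epsilon>}"
    define c where "c = \<epsilon> / 2 * exp (- \<epsilon>)"
    have c: "0 < c" using \<epsilon> by (simp add: c_def)
    have [measurable]: "Y t \<in> borel_measurable M" using t by simp
    have le: "real N * c * prob ?A \<le> 4 * t" for N
    proof -
      \<comment> \<open>Chosen so that \<epsilon>^2 / (4 a) = exp N, which makes the logarithm at
        least N.\<close>
      define a where "a = \<epsilon>\<^sup>2 / (4 * exp (real N))"
      have a: "0 < a" using \<epsilon> by (simp add: a_def)
      have aN: "\<epsilon>\<^sup>2 / (4 * a) = exp (real N)" using \<epsilon> by (simp add: a_def)
      obtain f f' f'' where f: "test_function f f' f'' (2 + 27 / a)" "\<And>x. 0 \<le> x \<Longrightarrow> f x = 0" "\<And>x. 0 \<le> f x"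
        "\<And>x. f' x \<le> 0" "\<And>x. 2 * \<bar>x\<bar> * f'' x \<le> 4"
        "\<And>\<epsilon> x. 0 < \<epsilon> \<Longrightarrow> x \<le> - \<epsilon> \<Longrightarrow> \<epsilon> / 2 * (ln (1 + \<epsilon>\<^sup>2 / (4 * a)) * exp (- \<epsilon>)) \<le> f x"
        using negative_part_test_function[OF a] by blast
      interpret test_function f f' f'' "2 + 27 / a" by fact
      have "real N \<le> ln (1 + exp (real N))"
        by (subst ln_exp[symmetric], subst ln_le_cancel_iff) (auto simp: add_pos_pos)
      then have "real N * c \<le> \<epsilon> / 2 * (ln (1 + \<epsilon>\<^sup>2 / (4 * a)) * exp (- \<epsilon>))"
        unfolding aN c_def using \<epsilon> by (simp add: mult_ac)
      then have low: "real N * c \<le> f x" if "x \<le> - \<epsilon>" for x using f(6)[OF \<epsilon> that] by linarith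
      have "real N * c * prob ?A = expectation (\<lambda>\<omega>. real N * c * indicator ?A \<omega>)" by simp
      also have "\<dots> \<le> expectation (\<lambda>\<omega>. f (Y t \<omega>))"
      proof (rule integral_mono)
        show "integrable M (\<lambda>\<omega>. real N * c * indicator ?A \<omega>)"
          by (rule bounded_integrable[where B = "real N * c"]) (use c in \<open>auto simp: indicator_def\<close>)
        show "integrable M (\<lambda>\<omega>. f (Y t \<omega>))"
          by (rule bounded_integrable[OF _ f_bound]) measurable
        fix \<omega>
        show "real N * c * indicator ?A \<omega> \<le> f (Y t \<omega>)" using low f(3) by (auto simp: indicator_def)
      qed
      also have "\<dots> \<le> 4 * t" by (rule bound[OF f(1,2,4,5)])
      finally show ?thesis .
    qed
    show ?thesis
    proof (rule ccontr)
      assume "prob ?A \<noteq> 0"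
      then have p: "0 < c * prob ?A" using c by (simp add: zero_less_measure_iff)
      obtain N where "4 * t / (c * prob ?A) < real N" using reals_Archimedean2 by blast
      then have "4 * t < real N * c * prob ?A" using p by (simp add: field_simps)
      with le[of N] show False by simp
    qed
  qed
  have [measurable]: "Y t \<in> borel_measurable M" using t by simp
  have "AE \<omega> in M. \<forall>n. - 1 / real (Suc n) \<le> Y t \<omega>"
    unfolding AE_all_countable
  proof
    fix n
    have "prob {\<omega>\<in>space M. Y t \<omega> \<le> - (1 / real (Suc n))} = 0" by (rule null) simp
    then have "AE \<omega> in M. \<omega> \<notin> {\<omega>\<in>space M. Y t \<omega> \<le> - (1 / real (Suc n))}"
      by (subst (asm) prob_eq_0) auto
    then show "AE \<omega> in M. - 1 / real (Suc n) \<le> Y t \<omega>"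
      by (rule AE_mp) (intro AE_I2, auto)
  qed
  then show ?thesis
  proof eventually_elim
    case (elim \<omega>)
    have "(\<lambda>n. - (1 / real (Suc n))) \<longlonglongrightarrow> - 0" by (intro tendsto_minus LIMSEQ_Suc[OF lim_1_over_n])
    then have "- 0 \<le> Y t \<omega>" by (rule LIMSEQ_le_const2) (use elim in auto)
    then show ?case by simp
  qed
qed

lemma Y_nonneg: "AE \<omega> in M. \<forall>t\<ge>0. 0 \<le> Y t \<omega>"
proof -
  have "AE \<omega> in M. \<forall>q\<in>{0..} \<inter> \<rat>. 0 \<le> Y q \<omega>"
    by (subst AE_ball_countable) (auto intro!: Y_nonneg_at countable_Int2 countable_rat)
  moreover have "AE \<omega> in M. \<omega> \<in> space M" by simp
  ultimately show ?thesis
  proof eventually_elim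
    case (elim \<omega>)
    show ?case
    proof (intro allI impI)
      fix t :: real assume t: "0 \<le> t"
      have cl: "t \<in> closure ({0..} \<inter> \<rat>)"
      proof (subst closure_approachable, intro allI impI)
        fix e :: real assume "0 < e"
        then obtain q where "q \<in> \<rat>" "t < q" "q < t + e" using Rats_dense_in_real[of t "t + e"] by auto
        then show "\<exists>q\<in>{0..} \<inter> \<rat>. dist q t < e" using t by (intro bexI[of _ q]) (auto simp: dist_real_def)
      qed
      have sub: "closure ({0..} \<inter> \<rat>) \<subseteq> {0::real..}" by (rule closure_minimal) auto
      show "0 \<le> Y t \<omega>"
        by (rule continuous_ge_on_closure[OF continuous_on_subset[OF Y_continuous sub] cl]) (use elim in auto)
    qed
  qed
qed

text \<open>A version of Y that is nonnegative and has a continuous path on all of the real line for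
  every \<omega>, so that later pathwise arguments carry no exceptional set.\<close>

definition V :: "real \<Rightarrow> 'a \<Rightarrow> real" where
  "V t \<omega> = max 0 (Y (max 0 t) \<omega>)"

lemma V_nonneg: "0 \<le> V t \<omega>"
  by (simp add: V_def)

lemma V_adapted: "0 \<le> t \<Longrightarrow> V t \<in> borel_measurable (Fm t)"
  using Y_adapted[of t] unfolding V_def by (simp add: max_absorb2)

lemma V_measurable [measurable]: "V t \<in> borel_measurable M"
  unfolding V_def by measurable

lemma V_continuous: "\<omega> \<in> space M \<Longrightarrow> continuous_on UNIV (\<lambda>t. V t \<omega>)"
  unfolding V_def by (intro continuous_intros continuous_on_compose2[OF Y_continuous, where f = "max 0"]) auto

lemma V_eq: "AE \<omega> in M. \<forall>t\<ge>0. V t \<omega> = Y t \<omega>"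
  using Y_nonneg by eventually_elim (simp add: V_def)

lemma V_start: "AE \<omega> in M. V 0 \<omega> = y"
  using Y_start y_nonneg by (auto simp: V_def)

lemma laplace_dynkin:
  assumes l: "0 < l" and X: "X \<in> borel_measurable (Fm s)" "\<And>\<omega>. \<bar>X \<omega>\<bar> \<le> 1" and st: "0 \<le> s" "s \<le> t"
  shows "((\<lambda>t. expectation (\<lambda>\<omega>. X \<omega> * exp (- (l * V t \<omega>)))) has_real_derivative
    expectation (\<lambda>\<omega>. X \<omega> * (2 * l\<^sup>2 * V t \<omega> * exp (- (l * V t \<omega>)) - \<delta> * l * exp (- (l * V t \<omega>))))) (at t within {s..})"
proof -
  define f where "f x = (if x \<le> 0 then 6 * exp (l * x) - 8 * exp (2 * l * x) + 3 * exp (3 * l * x) else exp (- (l * x)))" for x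
  define f' where "f' x = (if x \<le> 0 then l * (6 * exp (l * x) - 16 * exp (2 * l * x) + 9 * exp (3 * l * x)) else - (l * exp (- (l * x))))" for x
  define f'' where "f'' x = (if x \<le> 0 then l\<^sup>2 * (6 * exp (l * x) - 32 * exp (2 * l * x) + 27 * exp (3 * l * x)) else l\<^sup>2 * exp (- (l * x)))" for x
  have tf: "test_function f f' f'' (17 + 65 * l + 65 * l\<^sup>2 + 151 * l ^ 3)"
    unfolding f_def[abs_def] f'_def[abs_def] f''_def[abs_def] by (rule exp_test_function[OF l])
  have f0: "f x = exp (- (l * x))" "f' x = - (l * exp (- (l * x)))" "f'' x = l\<^sup>2 * exp (- (l * x))" if "0 \<le> x" for x
    using that by (cases "x = 0"; simp add: f_def f'_def f''_def)+
  interpret test_function f f' f'' "17 + 65 * l + 65 * l\<^sup>2 + 151 * l ^ 3" by (rule tf)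
  have [measurable]: "X \<in> borel_measurable M" by (rule measurable_FmD[OF X(1) st(1)])
  have Ym: "Y r \<in> borel_measurable M" if "s \<le> r" for r using st that by simp
  have gm: "gen f' f'' \<in> borel_measurable borel"
    unfolding gen_def[abs_def] by measurable
  have e1: "expectation (\<lambda>\<omega>. X \<omega> * f (Y r \<omega>)) = expectation (\<lambda>\<omega>. X \<omega> * exp (- (l * V r \<omega>)))" if r: "s \<le> r" for r
  proof (rule integral_cong_AE)
    have [measurable]: "(\<lambda>\<omega>. f (Y r \<omega>)) \<in> borel_measurable M"
      by (rule measurable_compose[OF Ym[OF r] f_measurable(1)])
    show "(\<lambda>\<omega>. X \<omega> * f (Y r \<omega>)) \<in> borel_measurable M" by measurable
    show "AE \<omega> in M. X \<omega> * f (Y r \<omega>) = X \<omega> * exp (- (l * V r \<omega>))"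
      using Y_nonneg
    proof eventually_elim
      case (elim \<omega>)
      then have "0 \<le> Y r \<omega>" "V r \<omega> = Y r \<omega>" using r st by (auto simp: V_def)
      then show ?case by (simp add: f0)
    qed
  qed measurable
  have e2: "expectation (\<lambda>\<omega>. X \<omega> * gen f' f'' (Y t \<omega>)) =
    expectation (\<lambda>\<omega>. X \<omega> * (2 * l\<^sup>2 * V t \<omega> * exp (- (l * V t \<omega>)) - \<delta> * l * exp (- (l * V t \<omega>))))"
  proof (rule integral_cong_AE)
    have [measurable]: "(\<lambda>\<omega>. gen f' f'' (Y t \<omega>)) \<in> borel_measurable M"
      by (rule measurable_compose[OF Ym[OF st(2)] gm])
    show "(\<lambda>\<omega>. X \<omega> * gen f' f'' (Y t \<omega>)) \<in> borel_measurable M" by measurable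
    show "AE \<omega> in M. X \<omega> * gen f' f'' (Y t \<omega>) = X \<omega> * (2 * l\<^sup>2 * V t \<omega> * exp (- (l * V t \<omega>)) - \<delta> * l * exp (- (l * V t \<omega>)))"
      using Y_nonneg
    proof eventually_elim
      case (elim \<omega>)
      then have Yt: "0 \<le> Y t \<omega>" "V t \<omega> = Y t \<omega>" using st by (auto simp: V_def)
      then show ?case by (simp add: gen_def f0)
    qed
  qed measurable
  have d: "((\<lambda>t. expectation (\<lambda>\<omega>. X \<omega> * f (Y t \<omega>))) has_real_derivative
    expectation (\<lambda>\<omega>. X \<omega> * gen f' f'' (Y t \<omega>))) (at t within {s..})"
    by (rule dynkin[OF tf X st])
  show ?thesis
    unfolding e2[symmetric]
    by (rule has_field_derivative_transform_within[OF d zero_less_one]) (use st e1 in auto)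
qed

text \<open>Along \<open>b' = 2 b\<^sup>2\<close> the term with \<open>V exp (- b V)\<close> cancels, which solves the first-order
  equation for the Laplace transform by characteristics.\<close>

theorem conditional_laplace:
  assumes l: "0 < l" and X: "X \<in> borel_measurable (Fm s)" "\<And>\<omega>. \<bar>X \<omega>\<bar> \<le> 1" and st: "0 \<le> s" "s \<le> T"
  shows "expectation (\<lambda>\<omega>. X \<omega> * exp (- (l * V T \<omega>))) =
    (1 + 2 * l * (T - s)) powr (- \<delta> / 2) * expectation (\<lambda>\<omega>. X \<omega> * exp (- (l / (1 + 2 * l * (T - s)) * V s \<omega>)))"
proof -
  define c where "c r = 1 + 2 * l * (T - r)" for r
  define b where "b r = l / c r" for r
  have c1: "1 \<le> c r" if "r \<le> T" for r using that l by (simp add: c_def)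
  \<comment> \<open>The exponent b increases with r, so its value at s is the minimum over [s,T],
    and exp (- \<beta> V) dominates all remainders below.\<close>
  define \<beta> where "\<beta> = l / c s"
  have \<beta>: "0 < \<beta>" "\<And>r. s \<le> r \<Longrightarrow> r \<le> T \<Longrightarrow> \<beta> \<le> b r"
  proof -
    show "0 < \<beta>" using l c1[OF st(2)] by (simp add: \<beta>_def)
    fix r assume r: "s \<le> r" "r \<le> T"
    have "c r \<le> c s" using r l by (simp add: c_def)
    then show "\<beta> \<le> b r" unfolding \<beta>_def b_def using l c1[OF r(2)] by (intro divide_left_mono) auto
  qed
  have bpos: "0 < b r" if "r \<le> T" for r using l c1[OF that] by (simp add: b_def)
  have dc: "(c has_real_derivative - (2 * l)) (at r within S)" for r S
    unfolding c_def by (auto intro!: derivative_eq_intros)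
  have db: "(b has_real_derivative 2 * (b r)\<^sup>2) (at r within S)" if "r \<le> T" for r S
  proof -
    have "((\<lambda>r. l / c r) has_real_derivative (0 * c r - l * (- (2 * l))) / (c r * c r)) (at r within S)"
      by (rule DERIV_divide[OF DERIV_const dc]) (use c1[OF that] in simp)
    then show ?thesis unfolding b_def[abs_def] by (simp add: power2_eq_square mult_ac)
  qed
  have [measurable]: "X \<in> borel_measurable M" by (rule measurable_FmD[OF X(1) st(1)])
  let ?G = "\<lambda>r. expectation (\<lambda>\<omega>. X \<omega> * exp (- (b r * V r \<omega>)))"
  have Xb: "\<bar>X \<omega> * u\<bar> \<le> B" if "\<bar>u\<bar> \<le> B" for \<omega> u B
  proof -
    have "\<bar>X \<omega> * u\<bar> \<le> 1 * \<bar>u\<bar>" unfolding abs_mult using X(2) by (intro mult_right_mono) auto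
    then show ?thesis using that by simp
  qed
  have e1: "\<bar>exp (- (d * V r \<omega>))\<bar> \<le> 1" if "0 < d" for d r \<omega> using that V_nonneg[of r \<omega>] by simp
  have ve: "\<bar>V r \<omega> * exp (- (d * V r \<omega>))\<bar> \<le> 1 / d" if "0 < d" for d r \<omega>
  proof -
    have "d * V r \<omega> * exp (- (d * V r \<omega>)) \<le> 1"
      using power_exp_neg_le[of "d * V r \<omega>" 1] that V_nonneg[of r \<omega>] by simp
    then show ?thesis using that V_nonneg[of r \<omega>] by (simp add: field_simps abs_mult)
  qed
  have iE: "integrable M (\<lambda>\<omega>. X \<omega> * exp (- (d * V r \<omega>)))" if "0 < d" for d r
    by (rule bounded_integrable[OF _ Xb[OF e1[OF that]]]) measurable
  have iV: "integrable M (\<lambda>\<omega>. X \<omega> * (V r \<omega> * exp (- (d * V r \<omega>))))" if "0 < d" for d r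
    by (rule bounded_integrable[OF _ Xb[OF ve[OF that]]]) measurable
  \<comment> \<open>\<open>?G\<close> depends on r through the process and through the exponent.
    With the exponent frozen at d = b t, \<open>?P\<close> is differentiated by Dynkin's formula;
    the change of exponent \<open>?H\<close> is - (b r - d) \<open>?k\<close> up to a quadratic
    error. Since b' = 2 b^2, the two contributions 2 d^2 \<open>?k\<close> cancel.\<close>
  have dG: "(?G has_real_derivative - (\<delta> * b t * ?G t)) (at t within {s..T})" if t: "s \<le> t" "t \<le> T" for t
  proof -
    define d where "d = b t"
    have d: "0 < d" using bpos[OF t(2)] by (simp add: d_def)
    let ?P = "\<lambda>r. expectation (\<lambda>\<omega>. X \<omega> * exp (- (d * V r \<omega>)))"
    let ?k = "\<lambda>r. expectation (\<lambda>\<omega>. X \<omega> * (V r \<omega> * exp (- (d * V r \<omega>))))"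
    let ?H = "\<lambda>r. expectation (\<lambda>\<omega>. X \<omega> * (exp (- (b r * V r \<omega>)) - exp (- (d * V r \<omega>))))"
    have GPH: "?G r = ?P r + ?H r" if "r \<le> T" for r
      unfolding right_diff_distrib using iE[OF d, of r] iE[OF bpos[OF that], of r] by simp
    have "((\<lambda>r. ?P r) has_real_derivative
      expectation (\<lambda>\<omega>. X \<omega> * (2 * d\<^sup>2 * V t \<omega> * exp (- (d * V t \<omega>)) - \<delta> * d * exp (- (d * V t \<omega>))))) (at t within {s..})"
      by (rule laplace_dynkin[OF d X st(1) t(1)])
    moreover have "expectation (\<lambda>\<omega>. X \<omega> * (2 * d\<^sup>2 * V t \<omega> * exp (- (d * V t \<omega>)) - \<delta> * d * exp (- (d * V t \<omega>)))) =
      2 * d\<^sup>2 * ?k t - \<delta> * d * ?P t"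
    proof -
      have "X \<omega> * (2 * d\<^sup>2 * V t \<omega> * exp (- (d * V t \<omega>)) - \<delta> * d * exp (- (d * V t \<omega>))) =
        2 * d\<^sup>2 * (X \<omega> * (V t \<omega> * exp (- (d * V t \<omega>)))) - \<delta> * d * (X \<omega> * exp (- (d * V t \<omega>)))" for \<omega>
        by (simp add: algebra_simps)
      then show ?thesis using iE[OF d, of t] iV[OF d, of t] by simp
    qed
    ultimately have dP: "(?P has_real_derivative 2 * d\<^sup>2 * ?k t - \<delta> * d * ?P t) (at t within {s..T})"
      by (simp only:) (rule DERIV_subset, assumption, auto)
    have kcont: "(?k \<longlongrightarrow> ?k t) (at t within {s..T})"
    proof -
      have "continuous_on {0..} (\<lambda>r. expectation (\<lambda>\<omega>. X \<omega> * (max 0 (Y r \<omega>) * exp (- (d * max 0 (Y r \<omega>))))))"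
      proof (rule expectation_continuous[where \<phi> = "\<lambda>x. max 0 x * exp (- (d * max 0 x))"])
        show "\<bar>max 0 x * exp (- (d * max 0 x))\<bar> \<le> 1 / d" for x
        proof -
          have "d * max 0 x * exp (- (d * max 0 x)) \<le> 1"
            using power_exp_neg_le[of "d * max 0 x" 1] d by simp
          then show ?thesis using d by (simp add: field_simps abs_mult)
        qed
      qed (auto intro!: continuous_intros X)
      then have "continuous_on {s..T} (\<lambda>r. expectation (\<lambda>\<omega>. X \<omega> * (max 0 (Y r \<omega>) * exp (- (d * max 0 (Y r \<omega>))))))"
        by (rule continuous_on_subset) (use st in auto)
      moreover have "expectation (\<lambda>\<omega>. X \<omega> * (max 0 (Y r \<omega>) * exp (- (d * max 0 (Y r \<omega>))))) = ?k r" if "r \<in> {s..T}" for r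
        using that st by (simp add: V_def max_absorb2)
      ultimately have "continuous_on {s..T} ?k" by (simp only: cong: continuous_on_cong)
      then show ?thesis using t by (simp add: continuous_on_def)
    qed
    have rem: "\<bar>?H r + (b r - d) * ?k r\<bar> \<le> 4 / \<beta>\<^sup>2 * (b r - d)\<^sup>2" if r: "s \<le> r" "r \<le> T" for r
    proof -
      let ?u = "\<lambda>\<omega>. exp (- (b r * V r \<omega>)) - exp (- (d * V r \<omega>)) + (b r - d) * (V r \<omega> * exp (- (d * V r \<omega>)))"
      have u: "\<bar>?u \<omega>\<bar> \<le> 4 / \<beta>\<^sup>2 * (b r - d)\<^sup>2" for \<omega>
      proof -
        have "\<bar>?u \<omega>\<bar> \<le> (V r \<omega>)\<^sup>2 * exp (- (\<beta> * V r \<omega>)) * (b r - d)\<^sup>2"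
          by (rule exp_second_order[OF V_nonneg]) (use \<beta>(2) r t in \<open>auto simp: d_def\<close>)
        also have "\<dots> \<le> 4 / \<beta>\<^sup>2 * (b r - d)\<^sup>2"
          using scaled_power_exp_le[OF V_nonneg \<beta>(1), of 2 r \<omega>] by (intro mult_right_mono) (auto simp: power_divide)
        finally show ?thesis .
      qed
      have i: "integrable M (\<lambda>\<omega>. X \<omega> * ?u \<omega>)"
        by (rule bounded_integrable[OF _ Xb[OF u]]) measurable
      have eq: "?H r + (b r - d) * ?k r = expectation (\<lambda>\<omega>. X \<omega> * ?u \<omega>)"
      proof -
        have "X \<omega> * ?u \<omega> = X \<omega> * exp (- (b r * V r \<omega>)) - X \<omega> * exp (- (d * V r \<omega>)) + (b r - d) * (X \<omega> * (V r \<omega> * exp (- (d * V r \<omega>))))" for \<omega>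
          by (simp add: algebra_simps)
        then show ?thesis
          unfolding right_diff_distrib[of "X _"] using iE[OF d, of r] iV[OF d, of r] iE[OF bpos[OF r(2)], of r] by simp
      qed
      have "\<bar>expectation (\<lambda>\<omega>. X \<omega> * ?u \<omega>)\<bar> \<le> expectation (\<lambda>\<omega>. \<bar>X \<omega> * ?u \<omega>\<bar>)" by (rule integral_abs_bound)
      also have "\<dots> \<le> expectation (\<lambda>\<omega>. 4 / \<beta>\<^sup>2 * (b r - d)\<^sup>2)"
      proof (rule integral_mono)
        show "integrable M (\<lambda>\<omega>. \<bar>X \<omega> * ?u \<omega>\<bar>)" by (rule integrable_abs[OF i])
        show "\<bar>X \<omega> * ?u \<omega>\<bar> \<le> 4 / \<beta>\<^sup>2 * (b r - d)\<^sup>2" for \<omega> by (rule Xb[OF u])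
      qed simp
      finally show ?thesis unfolding eq by (simp add: prob_space)
    qed
    have dH: "(?H has_real_derivative - (2 * d\<^sup>2 * ?k t)) (at t within {s..T})"
      unfolding has_field_derivative_iff
    proof -
      have q: "((\<lambda>r. (b r - d) / (r - t)) \<longlongrightarrow> 2 * d\<^sup>2) (at t within {s..T})"
        using db[OF t(2), of "{s..T}"] unfolding has_field_derivative_iff d_def .
      have bd: "((\<lambda>r. b r - d) \<longlongrightarrow> 0) (at t within {s..T})"
      proof -
        have "(b \<longlongrightarrow> b t) (at t within {s..T})"
          using DERIV_continuous[OF db[OF t(2)]] by (simp add: continuous_within)
        then have "((\<lambda>r. b r - d) \<longlongrightarrow> b t - d) (at t within {s..T})" by (intro tendsto_intros)
        then show ?thesis by (simp add: d_def)
      qed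
      have "((\<lambda>r. (?H r + (b r - d) * ?k r) / (r - t)) \<longlongrightarrow> 0) (at t within {s..T})"
      proof (rule Lim_null_comparison)
        have "((\<lambda>r. 4 / \<beta>\<^sup>2 * \<bar>(b r - d) / (r - t)\<bar> * \<bar>b r - d\<bar>) \<longlongrightarrow> 4 / \<beta>\<^sup>2 * \<bar>2 * d\<^sup>2\<bar> * \<bar>0\<bar>) (at t within {s..T})"
          by (intro tendsto_mult tendsto_const tendsto_rabs q bd)
        then show "((\<lambda>r. 4 / \<beta>\<^sup>2 * \<bar>(b r - d) / (r - t)\<bar> * \<bar>b r - d\<bar>) \<longlongrightarrow> 0) (at t within {s..T})" by simp
        show "\<forall>\<^sub>F r in at t within {s..T}. norm ((?H r + (b r - d) * ?k r) / (r - t)) \<le> 4 / \<beta>\<^sup>2 * \<bar>(b r - d) / (r - t)\<bar> * \<bar>b r - d\<bar>"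
          unfolding eventually_at_filter
        proof (rule always_eventually, intro allI impI)
          fix r assume "r \<noteq> t" and r: "r \<in> {s..T}"
          have "norm ((?H r + (b r - d) * ?k r) / (r - t)) = \<bar>?H r + (b r - d) * ?k r\<bar> / \<bar>r - t\<bar>"
            by simp
          also have "\<dots> \<le> 4 / \<beta>\<^sup>2 * (b r - d)\<^sup>2 / \<bar>r - t\<bar>"
            using rem[of r] r by (intro divide_right_mono) auto
          also have "\<dots> = 4 / \<beta>\<^sup>2 * \<bar>(b r - d) / (r - t)\<bar> * \<bar>b r - d\<bar>"
            by (simp add: power2_eq_square abs_mult[symmetric])
          finally show "norm ((?H r + (b r - d) * ?k r) / (r - t)) \<le> 4 / \<beta>\<^sup>2 * \<bar>(b r - d) / (r - t)\<bar> * \<bar>b r - d\<bar>" .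
        qed
      qed
      moreover have "((\<lambda>r. (b r - d) / (r - t) * ?k r) \<longlongrightarrow> 2 * d\<^sup>2 * ?k t) (at t within {s..T})"
        by (intro tendsto_mult q kcont)
      ultimately have "((\<lambda>r. (?H r + (b r - d) * ?k r) / (r - t) - (b r - d) / (r - t) * ?k r) \<longlongrightarrow> 0 - 2 * d\<^sup>2 * ?k t) (at t within {s..T})"
        by (rule tendsto_diff)
      moreover have "(?H r + (b r - d) * ?k r) / (r - t) - (b r - d) / (r - t) * ?k r = (?H r - ?H t) / (r - t)" for r
        by (simp add: add_divide_distrib d_def)
      ultimately show "((\<lambda>r. (?H r - ?H t) / (r - t)) \<longlongrightarrow> - (2 * d\<^sup>2 * ?k t)) (at t within {s..T})"
        by (simp only: diff_0)
    qed
    have "((\<lambda>r. ?P r + ?H r) has_real_derivative 2 * d\<^sup>2 * ?k t - \<delta> * d * ?P t + - (2 * d\<^sup>2 * ?k t)) (at t within {s..T})"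
      by (rule DERIV_add[OF dP dH])
    then have "((\<lambda>r. ?P r + ?H r) has_real_derivative - (\<delta> * b t * ?G t)) (at t within {s..T})"
      by (simp add: d_def)
    then show ?thesis
      by (rule has_field_derivative_transform_within[OF _ zero_less_one]) (use t GPH in auto)
  qed
  \<comment> \<open>The logarithmic derivative of this factor is \<delta> b, the negative of that of
    \<open>?G\<close>, so the product of the two is constant on [s,T].\<close>
  have da: "((\<lambda>r. c r powr (- \<delta> / 2)) has_real_derivative \<delta> * b t * c t powr (- \<delta> / 2)) (at t within S)" if "t \<le> T" for t S
  proof -
    have ct: "0 < c t" using c1[OF that] by simp
    have "((\<lambda>r. c r powr (- \<delta> / 2)) has_real_derivative (- \<delta> / 2) * c t powr (- \<delta> / 2 - 1) * (- (2 * l))) (at t within S)"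
      using has_field_derivative_at_within[OF DERIV_fun_powr[OF dc ct, of "- \<delta> / 2"]] by simp
    moreover have "c t powr (- \<delta> / 2 - 1) = c t powr (- \<delta> / 2) / c t"
      using ct by (simp add: powr_diff)
    ultimately show ?thesis by (simp add: b_def mult_ac)
  qed
  have "\<exists>k. \<forall>r\<in>{s..T}. c r powr (- \<delta> / 2) * ?G r = k"
  proof (rule has_field_derivative_zero_constant)
    fix t assume t: "t \<in> {s..T}"
    have "((\<lambda>r. c r powr (- \<delta> / 2) * ?G r) has_real_derivative
      \<delta> * b t * c t powr (- \<delta> / 2) * ?G t + - (\<delta> * b t * ?G t) * c t powr (- \<delta> / 2)) (at t within {s..T})"
      using t by (intro DERIV_mult da dG) auto
    then show "((\<lambda>r. c r powr (- \<delta> / 2) * ?G r) has_real_derivative 0) (at t within {s..T})"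
      by (simp add: mult_ac)
  qed simp
  then have "c T powr (- \<delta> / 2) * ?G T = c s powr (- \<delta> / 2) * ?G s"
    using st by auto
  then show ?thesis by (simp add: c_def b_def)
qed

end

section \<open>Moments\<close>

text \<open>The signed \<open>k\<close>-th derivatives in \<open>l\<close> of the Laplace transform of dimension \<open>d\<close>.\<close>

fun laplace_derivative :: "real \<Rightarrow> real \<Rightarrow> nat \<Rightarrow> real \<Rightarrow> real \<Rightarrow> real" where
  "laplace_derivative t y 0 d l = (1 + 2 * l * t) powr (- d / 2) * exp (- (l / (1 + 2 * l * t) * y))"
| "laplace_derivative t y (Suc k) d l = d * t * laplace_derivative t y k (d + 2) l + y * laplace_derivative t y k (d + 4) l"

text \<open>Differentiating the power raises the dimension by 2; differentiating l / (1 + 2 l t),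
  whose derivative is the inverse square of 1 + 2 l t, raises it by 4. The family is thus closed
  under differentiation, which explains the recursion.\<close>

lemma laplace_derivative_deriv:
  assumes "0 \<le> t" "0 < l"
  shows "(laplace_derivative t y k d has_real_derivative - laplace_derivative t y (Suc k) d l) (at l)"
proof (induction k arbitrary: d)
  case 0
  define c where "c l = 1 + 2 * l * t" for l
  have c: "0 < c l" using assms by (simp add: c_def add_pos_nonneg)
  have dc: "(c has_real_derivative 2 * t) (at l)"
    unfolding c_def by (auto intro!: derivative_eq_intros)
  have d1: "((\<lambda>l. c l powr (- d / 2)) has_real_derivative (- d / 2) * c l powr (- d / 2 - 1) * (2 * t)) (at l)"
    using DERIV_fun_powr[OF dc c, of "- d / 2"] by simp
  have q: "((\<lambda>l. l / c l) has_real_derivative (1 * c l - l * (2 * t)) / (c l * c l)) (at l)"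
    by (rule DERIV_divide[OF DERIV_ident dc]) (use c in simp)
  have "((\<lambda>l. exp (- (l / c l * y))) has_real_derivative exp (- (l / c l * y)) * - ((1 * c l - l * (2 * t)) / (c l * c l) * y)) (at l)"
    by (rule DERIV_chain2[OF DERIV_exp DERIV_minus[OF DERIV_cmult_right[OF q]]])
  moreover have "1 * c l - l * (2 * t) = 1" by (simp add: c_def)
  ultimately have d2: "((\<lambda>l. exp (- (l / c l * y))) has_real_derivative exp (- (l / c l * y)) * - (1 / (c l * c l) * y)) (at l)"
    by (simp only:)
  have p: "c l powr (- d / 2 - 1) = c l powr (- (d + 2) / 2)" "c l powr (- (d + 4) / 2) = c l powr (- d / 2) / (c l * c l)"
  proof -
    have "- d / 2 - 1 = - (d + 2) / 2" by (simp add: field_simps)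
    then show "c l powr (- d / 2 - 1) = c l powr (- (d + 2) / 2)" by (rule arg_cong)
    have "- (d + 4) / 2 = - d / 2 - 2" by (simp add: field_simps)
    then have "c l powr (- (d + 4) / 2) = c l powr (- d / 2) / c l powr 2" by (simp only: powr_diff)
    then show "c l powr (- (d + 4) / 2) = c l powr (- d / 2) / (c l * c l)"
      using c by (simp add: power2_eq_square)
  qed
  have "((\<lambda>l. c l powr (- d / 2) * exp (- (l / c l * y))) has_real_derivative
    (- d / 2) * c l powr (- d / 2 - 1) * (2 * t) * exp (- (l / c l * y)) + exp (- (l / c l * y)) * - (1 / (c l * c l) * y) * c l powr (- d / 2)) (at l)"
    by (rule DERIV_mult[OF d1 d2])
  moreover have "(- d / 2) * c l powr (- d / 2 - 1) * (2 * t) * exp (- (l / c l * y)) + exp (- (l / c l * y)) * - (1 / (c l * c l) * y) * c l powr (- d / 2)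
    = - (d * t * (c l powr (- (d + 2) / 2) * exp (- (l / c l * y))) + y * (c l powr (- (d + 4) / 2) * exp (- (l / c l * y))))"
    unfolding p by (simp add: field_simps)
  moreover have "laplace_derivative t y 0 d = (\<lambda>l. c l powr (- d / 2) * exp (- (l / c l * y)))" for d
    by (rule ext) (simp add: c_def)
  ultimately show ?case by (simp only: laplace_derivative.simps(2))
next
  case (Suc k)
  have "((\<lambda>l. d * t * laplace_derivative t y k (d + 2) l + y * laplace_derivative t y k (d + 4) l) has_real_derivative
    d * t * - laplace_derivative t y (Suc k) (d + 2) l + y * - laplace_derivative t y (Suc k) (d + 4) l) (at l)"
    by (intro DERIV_add DERIV_cmult Suc)
  moreover have "laplace_derivative t y (Suc k) d = (\<lambda>l. d * t * laplace_derivative t y k (d + 2) l + y * laplace_derivative t y k (d + 4) l)"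
    by (rule ext) simp
  ultimately show ?case by (simp only: laplace_derivative.simps(2)) (simp add: algebra_simps)
qed

text \<open>All coefficients are nonnegative and the transform itself is at most 1; each
  differentiation contributes a factor d' t + y in which the dimension d' is still at most d + 4 k.
  The bound is uniform in l, so that l may tend to 0.\<close>

lemma laplace_derivative_bound:
  assumes "0 \<le> t" "0 < l" "0 \<le> y" "0 \<le> d"
  shows "0 \<le> laplace_derivative t y k d l \<and> laplace_derivative t y k d l \<le> ((d + 4 * real k) * t + y) ^ k"
  using assms(4)
proof (induction k arbitrary: d)
  case 0
  have c: "1 \<le> 1 + 2 * l * t" using assms by simp
  have "(1 + 2 * l * t) powr (- d / 2) \<le> (1 + 2 * l * t) powr 0"
    using c 0 by (intro powr_mono) auto
  then have "(1 + 2 * l * t) powr (- d / 2) \<le> 1" using c by simp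
  moreover have "exp (- (l / (1 + 2 * l * t) * y)) \<le> 1" using c assms by simp
  ultimately have "(1 + 2 * l * t) powr (- d / 2) * exp (- (l / (1 + 2 * l * t) * y)) \<le> 1 * 1"
    by (intro mult_mono) auto
  then show ?case by simp
next
  case (Suc k)
  let ?B = "(d + 4 * real (Suc k)) * t + y"
  have B: "0 \<le> ?B" using assms Suc.prems by simp
  have "laplace_derivative t y k (d + 2) l \<le> ?B ^ k"
  proof -
    have "(d + 2 + 4 * real k) * t + y \<le> ?B" using assms by (simp add: mult_right_mono)
    then have "((d + 2 + 4 * real k) * t + y) ^ k \<le> ?B ^ k" using assms Suc.prems by (intro power_mono) auto
    then show ?thesis using Suc.IH[of "d + 2"] Suc.prems by simp
  qed
  moreover have "laplace_derivative t y k (d + 4) l \<le> ?B ^ k"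
    using Suc.IH[of "d + 4"] Suc.prems by (simp add: add.assoc)
  ultimately have "laplace_derivative t y (Suc k) d l \<le> d * t * ?B ^ k + y * ?B ^ k"
    using assms Suc.prems by (auto intro!: add_mono mult_left_mono)
  also have "\<dots> = (d * t + y) * ?B ^ k" by (simp add: algebra_simps)
  also have "\<dots> \<le> ?B * ?B ^ k" using B assms by (intro mult_right_mono) (auto simp: algebra_simps)
  finally show ?case using Suc.IH[of "d + 2"] Suc.IH[of "d + 4"] Suc.prems assms by simp
qed

lemma rpow0_measurable [measurable]: "(\<lambda>x. rpow0 x a) \<in> borel_measurable borel"
  unfolding rpow0_def by measurable

lemma rpow0_nonneg: "0 \<le> rpow0 x a"
  by (simp add: rpow0_def)

lemma rpow0_mult: "0 \<le> c \<Longrightarrow> 0 < s \<Longrightarrow> rpow0 (s * c) a = s powr a * rpow0 c a"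
  by (simp add: rpow0_def powr_mult)

text \<open>Without integrability the left-hand side has the default value 0, so the inequality
  survives where equality may fail.\<close>

lemma ennreal_integral_le: "(\<And>x. 0 \<le> f x) \<Longrightarrow> ennreal (integral\<^sup>L M f) \<le> (\<integral>\<^sup>+ x. ennreal (f x) \<partial>M)"
  by (cases "integrable M f") (simp_all add: nn_integral_eq_integral not_integrable_integral_eq)

lemma ennreal_affine:
  assumes "0 \<le> a" "0 \<le> b" "0 \<le> c"
  shows "ennreal a * (1 + ennreal b * ennreal c) = ennreal (a * (1 + b * c))"
proof -
  have "ennreal (a * (1 + b * c)) = ennreal a * ennreal (1 + b * c)" using assms by (intro ennreal_mult) auto
  also have "ennreal (1 + b * c) = ennreal 1 + ennreal (b * c)" using assms by (intro ennreal_plus) auto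
  also have "ennreal (b * c) = ennreal b * ennreal c" using assms by (intro ennreal_mult) auto
  finally show ?thesis by simp
qed

lemma nn_integral_powr_at_top:
  assumes "e < -1"
  shows "(\<integral>\<^sup>+ s. ennreal (indicator {1..} s * s powr e) \<partial>lborel) = ennreal (- 1 / (e + 1))"
  using nn_integral_has_integral_lebesgue[OF _ has_integral_powr_to_inf[OF assms zero_less_one]] by simp

text \<open>The process is the limit of its values at the time rounded down to a multiple of 2^-n.
  Each of these approximations takes one of countably many random variables according to the time,
  and so is jointly measurable.\<close>

lemma continuous_process_measurable:
  fixes X :: "real \<Rightarrow> 'a \<Rightarrow> real"
  assumes X [measurable]: "\<And>s. X s \<in> borel_measurable M"
    and cont: "\<And>\<omega>. \<omega> \<in> space M \<Longrightarrow> continuous_on UNIV (\<lambda>s. X s \<omega>)"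
  shows "(\<lambda>p. X (fst p) (snd p)) \<in> borel_measurable (lborel \<Otimes>\<^sub>M M)"
proof (rule borel_measurable_LIMSEQ_real)
  let ?u = "\<lambda>(n::nat) (s::real). real_of_int \<lfloor>2 ^ n * s\<rfloor> / 2 ^ n"
  show "(\<lambda>p. X (?u n (fst p)) (snd p)) \<in> borel_measurable (lborel \<Otimes>\<^sub>M M)" for n
  proof (rule measurable_compose_countable[where f = "\<lambda>i p. X (real_of_int i / 2 ^ n) (snd p)" and g = "\<lambda>p. \<lfloor>2 ^ n * (fst p :: real)\<rfloor>"])
    show "(\<lambda>p. X (real_of_int i / 2 ^ n) (snd p)) \<in> borel_measurable (lborel \<Otimes>\<^sub>M M)" for i by measurable
    show "(\<lambda>p. \<lfloor>2 ^ n * (fst p :: real)\<rfloor>) \<in> measurable (lborel \<Otimes>\<^sub>M M) (count_space UNIV)" by measurable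
  qed
  fix p :: "real \<times> 'a" assume "p \<in> space (lborel \<Otimes>\<^sub>M M)"
  then have \<omega>: "snd p \<in> space M" by (simp add: space_pair_measure mem_Times_iff)
  have "(\<lambda>n. ?u n (fst p)) \<longlonglongrightarrow> fst p"
  proof (rule real_tendsto_sandwich)
    have "(\<lambda>n. fst p - 1 / 2 ^ n) \<longlonglongrightarrow> fst p - 0"
      by (intro tendsto_diff tendsto_const LIMSEQ_divide_realpow_zero) simp
    then show "(\<lambda>n. fst p - 1 / 2 ^ n) \<longlonglongrightarrow> fst p" by simp
    show "\<forall>\<^sub>F n in sequentially. fst p - 1 / 2 ^ n \<le> ?u n (fst p)"
    proof (rule always_eventually, rule allI)
      fix n :: nat
      have "2 ^ n * fst p - 1 \<le> real_of_int \<lfloor>2 ^ n * fst p\<rfloor>" by linarith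
      then have "(2 ^ n * fst p - 1) / 2 ^ n \<le> ?u n (fst p)" by (rule divide_right_mono) simp
      then show "fst p - 1 / 2 ^ n \<le> ?u n (fst p)" by (simp add: diff_divide_distrib)
    qed
    show "\<forall>\<^sub>F n in sequentially. ?u n (fst p) \<le> fst p"
    proof (rule always_eventually, rule allI)
      fix n :: nat
      have "real_of_int \<lfloor>2 ^ n * fst p\<rfloor> \<le> 2 ^ n * fst p" by linarith
      then show "?u n (fst p) \<le> fst p" by (simp add: field_simps)
    qed
  qed simp
  then show "(\<lambda>n. X (?u n (fst p)) (snd p)) \<longlonglongrightarrow> X (fst p) (snd p)"
    by (rule continuous_on_tendsto_compose[OF cont[OF \<omega>]]) auto
qed

context besq_sol
begin

lemma laplace_at:
  assumes "0 < l" "0 \<le> t"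
  shows "expectation (\<lambda>\<omega>. exp (- (l * V t \<omega>))) = laplace_derivative t y 0 \<delta> l"
proof -
  have "expectation (\<lambda>\<omega>. 1 * exp (- (l * V t \<omega>))) = (1 + 2 * l * (t - 0)) powr (- \<delta> / 2) *
      expectation (\<lambda>\<omega>. 1 * exp (- (l / (1 + 2 * l * (t - 0)) * V 0 \<omega>)))"
    by (rule conditional_laplace[OF assms(1) _ _ order_refl assms(2)]) auto
  moreover have "expectation (\<lambda>\<omega>. 1 * exp (- (l / (1 + 2 * l * (t - 0)) * V 0 \<omega>))) =
      expectation (\<lambda>\<omega>. exp (- (l / (1 + 2 * l * t) * y)))"
    by (rule integral_cong_AE) (use V_start in \<open>auto\<close>)
  ultimately show ?thesis by (simp add: prob_space)
qed

lemma V_power_exp_bound: "0 < l \<Longrightarrow> \<bar>V t \<omega> ^ k * exp (- (l * V t \<omega>))\<bar> \<le> (real k / l) ^ k"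
  using scaled_power_exp_le[of "V t \<omega>" l k] V_nonneg[of t \<omega>] by (cases "k = 0") auto

lemma V_power_exp_integrable: "0 < l \<Longrightarrow> integrable M (\<lambda>\<omega>. V t \<omega> ^ k * exp (- (l * V t \<omega>)))"
  by (rule bounded_integrable[OF _ V_power_exp_bound]) measurable

text \<open>Differentiation under the expectation through a remainder quadratic in m - l: for m > l
  / 2 it carries exp (- (l / 2) V), which bounds V^(k+2) by the constant C.\<close>

lemma V_power_exp_deriv:
  assumes l: "0 < l"
  shows "((\<lambda>l. expectation (\<lambda>\<omega>. V t \<omega> ^ k * exp (- (l * V t \<omega>)))) has_real_derivative
    - expectation (\<lambda>\<omega>. V t \<omega> ^ Suc k * exp (- (l * V t \<omega>)))) (at l)"
proof -
  let ?f = "\<lambda>l. expectation (\<lambda>\<omega>. V t \<omega> ^ k * exp (- (l * V t \<omega>)))"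
  let ?g = "expectation (\<lambda>\<omega>. V t \<omega> ^ Suc k * exp (- (l * V t \<omega>)))"
  define C where "C = (real (k + 2) / (l / 2)) ^ (k + 2)"
  have est: "\<bar>?f m - ?f l + (m - l) * ?g\<bar> \<le> C * (m - l)\<^sup>2" if m: "l / 2 < m" for m
  proof -
    let ?u = "\<lambda>\<omega>. V t \<omega> ^ k * (exp (- (m * V t \<omega>)) - exp (- (l * V t \<omega>)) + (m - l) * (V t \<omega> * exp (- (l * V t \<omega>))))"
    have m0: "0 < m" using m l by simp
    have u: "\<bar>?u \<omega>\<bar> \<le> C * (m - l)\<^sup>2" for \<omega>
    proof -
      have "\<bar>?u \<omega>\<bar> \<le> V t \<omega> ^ k * ((V t \<omega>)\<^sup>2 * exp (- (l / 2 * V t \<omega>)) * (m - l)\<^sup>2)"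
        unfolding abs_mult[of "V t \<omega> ^ k"] using V_nonneg[of t \<omega>]
        by (intro mult_mono exp_second_order) (use m l in auto)
      also have "\<dots> = V t \<omega> ^ (k + 2) * exp (- (l / 2 * V t \<omega>)) * (m - l)\<^sup>2"
        by (simp add: power_add power2_eq_square)
      also have "\<dots> \<le> C * (m - l)\<^sup>2"
        unfolding C_def by (intro mult_right_mono scaled_power_exp_le V_nonneg) (use l in auto)
      finally show ?thesis .
    qed
    have i: "integrable M ?u" by (rule bounded_integrable[OF _ u]) measurable
    have eq: "?f m - ?f l + (m - l) * ?g = expectation ?u"
    proof -
      have "?u \<omega> = V t \<omega> ^ k * exp (- (m * V t \<omega>)) - V t \<omega> ^ k * exp (- (l * V t \<omega>)) + (m - l) * (V t \<omega> ^ Suc k * exp (- (l * V t \<omega>)))" for \<omega>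
        by (simp add: algebra_simps)
      then show ?thesis
        using V_power_exp_integrable[OF l, of t k] V_power_exp_integrable[OF m0, of t k] V_power_exp_integrable[OF l, of t "Suc k"]
        by simp
    qed
    have "\<bar>expectation ?u\<bar> \<le> expectation (\<lambda>\<omega>. \<bar>?u \<omega>\<bar>)" by (rule integral_abs_bound)
    also have "\<dots> \<le> expectation (\<lambda>\<omega>. C * (m - l)\<^sup>2)"
    proof (rule integral_mono)
      show "integrable M (\<lambda>\<omega>. \<bar>?u \<omega>\<bar>)" by (rule integrable_abs[OF i])
      show "\<bar>?u \<omega>\<bar> \<le> C * (m - l)\<^sup>2" for \<omega> by (rule u)
    qed simp
    finally show ?thesis unfolding eq by (simp add: prob_space)
  qed
  have "((\<lambda>m. (?f m - ?f l) / (m - l) + ?g) \<longlongrightarrow> 0) (at l)"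
  proof (rule Lim_null_comparison)
    have "((\<lambda>m. C * \<bar>m - l\<bar>) \<longlongrightarrow> C * \<bar>l - l\<bar>) (at l)" by (intro tendsto_intros)
    then show "((\<lambda>m. C * \<bar>m - l\<bar>) \<longlongrightarrow> 0) (at l)" by simp
    have "eventually (\<lambda>m. l / 2 < m) (at l)"
      by (rule order_tendstoD(1)[OF tendsto_ident_at]) (use l in simp)
    moreover have "eventually (\<lambda>m. m \<noteq> l) (at l)" by (simp add: eventually_at_filter)
    ultimately show "\<forall>\<^sub>F m in at l. norm ((?f m - ?f l) / (m - l) + ?g) \<le> C * \<bar>m - l\<bar>"
    proof eventually_elim
      case (elim m)
      have "(?f m - ?f l) / (m - l) + ?g = (?f m - ?f l + (m - l) * ?g) / (m - l)"
        using elim by (simp add: add_divide_distrib)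
      then have "norm ((?f m - ?f l) / (m - l) + ?g) = \<bar>?f m - ?f l + (m - l) * ?g\<bar> / \<bar>m - l\<bar>"
        by (simp only: real_norm_def abs_divide)
      also have "\<dots> \<le> C * (m - l)\<^sup>2 / \<bar>m - l\<bar>" using est[OF elim(1)] by (rule divide_right_mono) simp
      also have "\<dots> = C * \<bar>m - l\<bar>"
      proof -
        have "(m - l)\<^sup>2 = \<bar>m - l\<bar> * \<bar>m - l\<bar>" by (simp add: power2_eq_square)
        then show ?thesis using elim by (simp only: times_divide_eq_right[symmetric]) simp
      qed
      finally show ?case .
    qed
  qed
  then have "((\<lambda>m. (?f m - ?f l) / (m - l) + ?g - ?g) \<longlongrightarrow> 0 - ?g) (at l)" by (intro tendsto_diff tendsto_const)
  then show ?thesis unfolding has_field_derivative_iff by simp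
qed

text \<open>The identity for k holds on an open half line, so both sides may be differentiated in l;
  uniqueness of the derivative gives the identity for k + 1.\<close>

lemma V_power_exp_eq:
  assumes t: "0 \<le> t"
  shows "0 < l \<Longrightarrow> expectation (\<lambda>\<omega>. V t \<omega> ^ k * exp (- (l * V t \<omega>))) = laplace_derivative t y k \<delta> l"
proof (induction k arbitrary: l)
  case 0
  then show ?case using laplace_at[OF 0 t] by simp
next
  case (Suc k)
  have "(laplace_derivative t y k \<delta> has_real_derivative
      - expectation (\<lambda>\<omega>. V t \<omega> ^ Suc k * exp (- (l * V t \<omega>)))) (at l)"
    by (rule has_field_derivative_transform_within_open[OF V_power_exp_deriv[OF Suc.prems, of t k] open_greaterThan[of 0]])
      (use Suc in auto)
  from DERIV_unique[OF this laplace_derivative_deriv[OF t Suc.prems]] show ?case by simp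
qed

text \<open>Fatou's lemma along l = 1 / (n + 1), since the bound on the derivatives does not depend
  on l.\<close>

lemma V_moment:
  assumes t: "0 \<le> t"
  shows "(\<integral>\<^sup>+ \<omega>. ennreal (V t \<omega> ^ k) \<partial>M) \<le> ennreal (((\<delta> + 4 * real k) * t + y) ^ k)"
proof -
  let ?u = "\<lambda>n \<omega>. ennreal (V t \<omega> ^ k * exp (- (1 / real (Suc n) * V t \<omega>)))"
  have "(\<integral>\<^sup>+ \<omega>. ennreal (V t \<omega> ^ k) \<partial>M) = (\<integral>\<^sup>+ \<omega>. liminf (\<lambda>n. ?u n \<omega>) \<partial>M)"
  proof (rule nn_integral_cong)
    fix \<omega>
    have "(\<lambda>n. V t \<omega> ^ k * exp (- (1 / real (Suc n) * V t \<omega>))) \<longlonglongrightarrow> V t \<omega> ^ k * exp (- (0 * V t \<omega>))"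
      by (intro tendsto_intros LIMSEQ_Suc[OF lim_1_over_n])
    then have "(\<lambda>n. ?u n \<omega>) \<longlonglongrightarrow> ennreal (V t \<omega> ^ k)" by (intro tendsto_ennrealI) simp
    from lim_imp_Liminf[OF _ this] show "ennreal (V t \<omega> ^ k) = liminf (\<lambda>n. ?u n \<omega>)" by simp
  qed
  also have "\<dots> \<le> liminf (\<lambda>n. \<integral>\<^sup>+ \<omega>. ?u n \<omega> \<partial>M)"
    by (rule nn_integral_liminf) measurable
  also have "\<dots> \<le> liminf (\<lambda>n. ennreal (((\<delta> + 4 * real k) * t + y) ^ k))"
  proof (rule Liminf_mono, rule always_eventually, rule allI)
    fix n
    have l: "0 < 1 / real (Suc n)" by simp
    have "(\<integral>\<^sup>+ \<omega>. ?u n \<omega> \<partial>M) = ennreal (laplace_derivative t y k \<delta> (1 / real (Suc n)))"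
      unfolding V_power_exp_eq[OF t l, symmetric]
      by (rule nn_integral_eq_integral[OF V_power_exp_integrable[OF l]]) (simp add: V_nonneg)
    also have "\<dots> \<le> ennreal (((\<delta> + 4 * real k) * t + y) ^ k)"
      by (intro ennreal_leI) (use laplace_derivative_bound[OF t l y_nonneg, of \<delta> k] \<delta>_pos in auto)
    finally show "(\<integral>\<^sup>+ \<omega>. ?u n \<omega> \<partial>M) \<le> ennreal (((\<delta> + 4 * real k) * t + y) ^ k)" .
  qed
  also have "\<dots> = ennreal (((\<delta> + 4 * real k) * t + y) ^ k)" by (simp add: Liminf_const)
  finally show ?thesis .
qed

text \<open>Comes from v^a \<le> 1 + v^k, with k the least natural number not below a, applied to v
  = V t / t, and from \<open>V_moment\<close> divided by t^k under y / t \<le> y.\<close>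

definition moment_const :: "real \<Rightarrow> real" where
  "moment_const a = 1 + (\<delta> + 4 * real (nat \<lceil>a\<rceil>) + y) ^ nat \<lceil>a\<rceil>"

lemma moment_const_nonneg: "0 \<le> moment_const a"
  using \<delta>_pos y_nonneg by (simp add: moment_const_def)

text \<open>The condition \<open>y \<le> y * t\<close> says that \<open>y = 0\<close> or \<open>t \<ge> 1\<close>, so that one bound serves both the process
  on \<open>[1,\<infinity>)\<close> and the process from 0 on \<open>(0,1]\<close>.\<close>

lemma V_rpow0_moment:
  assumes a: "0 \<le> a" and t: "0 < t" "y \<le> y * t"
  shows "(\<integral>\<^sup>+ \<omega>. ennreal (rpow0 (V t \<omega>) a) \<partial>M) \<le> ennreal (moment_const a * t powr a)"
proof -
  define k where "k = nat \<lceil>a\<rceil>"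
  have ak: "a \<le> real k" using a by (simp add: k_def)
  have le: "rpow0 (V t \<omega>) a \<le> t powr a * (1 + V t \<omega> ^ k / t ^ k)" for \<omega>
  proof -
    define v where "v = V t \<omega> / t"
    have v: "0 \<le> v" using V_nonneg[of t \<omega>] t by (simp add: v_def)
    have Vv: "V t \<omega> = t * v" using t by (simp add: v_def)
    have "rpow0 v a \<le> 1 + v ^ k"
    proof (cases "v \<le> 1")
      case True
      have "rpow0 v a \<le> 1" using v True a by (auto simp: rpow0_def powr_le1)
      then show ?thesis using v by (simp add: add_increasing2)
    next
      case False
      then have "rpow0 v a = v powr a" by (simp add: rpow0_def)
      also have "\<dots> \<le> v powr real k" using False ak by (intro powr_mono) auto
      also have "\<dots> = v ^ k" using False by (simp add: powr_realpow)
      finally show ?thesis by simp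
    qed
    then have "t powr a * rpow0 v a \<le> t powr a * (1 + v ^ k)" by (intro mult_left_mono) auto
    then show ?thesis unfolding Vv rpow0_mult[OF v t(1)] using t by (simp add: power_mult_distrib)
  qed
  have "(\<integral>\<^sup>+ \<omega>. ennreal (rpow0 (V t \<omega>) a) \<partial>M) \<le> (\<integral>\<^sup>+ \<omega>. ennreal (t powr a) * (1 + ennreal (1 / t ^ k) * ennreal (V t \<omega> ^ k)) \<partial>M)"
  proof (rule nn_integral_mono)
    fix \<omega>
    have "ennreal (rpow0 (V t \<omega>) a) \<le> ennreal (t powr a * (1 + V t \<omega> ^ k / t ^ k))" using le by (rule ennreal_leI)
    also have "\<dots> = ennreal (t powr a) * (1 + ennreal (1 / t ^ k) * ennreal (V t \<omega> ^ k))"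
      using t V_nonneg[of t \<omega>] by (subst ennreal_affine) auto
    finally show "ennreal (rpow0 (V t \<omega>) a) \<le> ennreal (t powr a) * (1 + ennreal (1 / t ^ k) * ennreal (V t \<omega> ^ k))" .
  qed
  also have "\<dots> = ennreal (t powr a) * (1 + ennreal (1 / t ^ k) * (\<integral>\<^sup>+ \<omega>. ennreal (V t \<omega> ^ k) \<partial>M))"
    by (simp add: nn_integral_cmult nn_integral_add emeasure_space_1)
  also have "\<dots> \<le> ennreal (t powr a) * (1 + ennreal (1 / t ^ k) * ennreal (((\<delta> + 4 * real k) * t + y) ^ k))"
    using t by (intro mult_left_mono add_left_mono V_moment) auto
  also have "\<dots> = ennreal (t powr a * (1 + 1 / t ^ k * ((\<delta> + 4 * real k) * t + y) ^ k))"
    using t \<delta>_pos y_nonneg by (intro ennreal_affine) auto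
  also have "\<dots> \<le> ennreal (moment_const a * t powr a)"
  proof (rule ennreal_leI)
    have "1 / t ^ k * ((\<delta> + 4 * real k) * t + y) ^ k = (((\<delta> + 4 * real k) * t + y) / t) ^ k"
      by (simp add: power_divide)
    also have "\<dots> \<le> (\<delta> + 4 * real k + y) ^ k"
    proof (rule power_mono)
      have "((\<delta> + 4 * real k) * t + y) / t = \<delta> + 4 * real k + y / t" using t by (simp add: field_simps)
      also have "y / t \<le> y" using t by (simp add: field_simps)
      finally show "((\<delta> + 4 * real k) * t + y) / t \<le> \<delta> + 4 * real k + y" by simp
    qed (use t \<delta>_pos y_nonneg in auto)
    finally have "1 + 1 / t ^ k * ((\<delta> + 4 * real k) * t + y) ^ k \<le> moment_const a"
      by (simp add: moment_const_def k_def)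
    then show "t powr a * (1 + 1 / t ^ k * ((\<delta> + 4 * real k) * t + y) ^ k) \<le> moment_const a * t powr a"
      by (subst mult.commute) (intro mult_right_mono, auto)
  qed
  finally show ?thesis .
qed

lemma V_measurable_pair [measurable]: "(\<lambda>p. V (fst p) (snd p)) \<in> borel_measurable (lborel \<Otimes>\<^sub>M M)"
  by (rule continuous_process_measurable[OF V_measurable V_continuous])

lemma V_measurable_path [measurable]: "\<omega> \<in> space M \<Longrightarrow> (\<lambda>s. V s \<omega>) \<in> borel_measurable borel"
  using V_continuous by (rule borel_measurable_continuous_onI)

lemma nn_Fubini:
  fixes g :: "real \<Rightarrow> real \<Rightarrow> real"
  assumes "(\<lambda>p. g (fst p) (snd p)) \<in> borel_measurable (lborel \<Otimes>\<^sub>M borel)"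
  shows "(\<integral>\<^sup>+ \<omega>. \<integral>\<^sup>+ s. ennreal (g s (V s \<omega>)) \<partial>lborel \<partial>M) = (\<integral>\<^sup>+ s. \<integral>\<^sup>+ \<omega>. ennreal (g s (V s \<omega>)) \<partial>M \<partial>lborel)"
proof -
  interpret pair_sigma_finite lborel M by unfold_locales
  have "(\<lambda>p. (fst p, V (fst p) (snd p))) \<in> measurable (lborel \<Otimes>\<^sub>M M) (lborel \<Otimes>\<^sub>M borel)" by measurable
  from measurable_compose[OF this assms]
  have [measurable]: "(\<lambda>p. g (fst p) (V (fst p) (snd p))) \<in> borel_measurable (lborel \<Otimes>\<^sub>M M)" by simp
  show ?thesis
    by (rule Fubini'[symmetric, THEN sym]) (simp add: case_prod_unfold)
qed

text \<open>Tonelli's theorem; the weight is required to vanish at the times that the moment bound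
  does not cover.\<close>

lemma weighted_moment:
  assumes a: "0 \<le> a" and w: "w \<in> borel_measurable borel" "\<And>s. 0 \<le> w s" "\<And>s. w s \<noteq> 0 \<Longrightarrow> 0 < s \<and> y \<le> y * s"
  shows "(\<integral>\<^sup>+ \<omega>. \<integral>\<^sup>+ s. ennreal (w s * rpow0 (V s \<omega>) a) \<partial>lborel \<partial>M)
    \<le> (\<integral>\<^sup>+ s. ennreal (moment_const a * (w s * s powr a)) \<partial>lborel)"
proof -
  note [measurable] = w(1)
  have "(\<integral>\<^sup>+ \<omega>. \<integral>\<^sup>+ s. ennreal (w s * rpow0 (V s \<omega>) a) \<partial>lborel \<partial>M) = (\<integral>\<^sup>+ s. \<integral>\<^sup>+ \<omega>. ennreal (w s * rpow0 (V s \<omega>) a) \<partial>M \<partial>lborel)"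
    by (rule nn_Fubini[where g = "\<lambda>s v. w s * rpow0 v a"]) measurable
  also have "\<dots> \<le> (\<integral>\<^sup>+ s. ennreal (moment_const a * (w s * s powr a)) \<partial>lborel)"
  proof (rule nn_integral_mono)
    fix s :: real
    show "(\<integral>\<^sup>+ \<omega>. ennreal (w s * rpow0 (V s \<omega>) a) \<partial>M) \<le> ennreal (moment_const a * (w s * s powr a))"
    proof (cases "w s = 0")
      case False
      then have s: "0 < s" "y \<le> y * s" using w(3) by auto
      have "(\<integral>\<^sup>+ \<omega>. ennreal (w s * rpow0 (V s \<omega>) a) \<partial>M) = ennreal (w s) * (\<integral>\<^sup>+ \<omega>. ennreal (rpow0 (V s \<omega>) a) \<partial>M)"
        using w(2) by (simp add: ennreal_mult' nn_integral_cmult)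
      also have "\<dots> \<le> ennreal (w s) * ennreal (moment_const a * s powr a)"
        by (intro mult_left_mono V_rpow0_moment a s) simp
      also have "\<dots> = ennreal (moment_const a * (w s * s powr a))"
        using w(2)[of s] moment_const_nonneg[of a] by (simp add: ennreal_mult'[symmetric] mult_ac)
      finally show ?thesis .
    qed simp
  qed
  finally show ?thesis .
qed

end

section \<open>Logarithmic asymptotics\<close>

text \<open>Half of e is spent on the exponent, the other half absorbs the constants once ln t
  exceeds L. Replacing U by \<open>max U 1\<close> keeps its logarithm meaningful whatever the sign
  of U.\<close>

lemma log_ratio_limit:
  fixes f :: "real \<Rightarrow> real"
  assumes up: "\<And>\<epsilon>. 0 < \<epsilon> \<Longrightarrow> \<exists>U. eventually (\<lambda>t. f t \<le> U * t powr (k + \<epsilon>)) at_top"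
    and lo: "\<And>\<epsilon>. 0 < \<epsilon> \<Longrightarrow> \<exists>c>0. eventually (\<lambda>t. c * t powr (k - \<epsilon>) \<le> f t) at_top"
  shows "((\<lambda>t. ln (f t) / ln t) \<longlongrightarrow> k) at_top"
proof (rule tendstoI)
  fix e :: real assume e: "0 < e"
  obtain U where U: "eventually (\<lambda>t. f t \<le> U * t powr (k + e / 2)) at_top" using up[of "e / 2"] e by auto
  obtain c where c: "0 < c" "eventually (\<lambda>t. c * t powr (k - e / 2) \<le> f t) at_top" using lo[of "e / 2"] e by auto
  define L where "L = max (2 * \<bar>ln (max U 1)\<bar> / e) (2 * \<bar>ln c\<bar> / e)"
  have "eventually (\<lambda>t. L < ln t) at_top"
    using ln_at_top by (auto simp: filterlim_at_top_dense)
  with U c(2) eventually_gt_at_top[of 1] show "eventually (\<lambda>t. dist (ln (f t) / ln t) k < e) at_top"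
  proof eventually_elim
    case (elim t)
    have t: "0 < t" "0 < ln t" using elim by auto
    have L1: "2 * \<bar>ln (max U 1)\<bar> / e < ln t" "2 * \<bar>ln c\<bar> / e < ln t" using elim by (auto simp: L_def)
    have b1: "\<bar>ln (max U 1)\<bar> < e / 2 * ln t" "\<bar>ln c\<bar> < e / 2 * ln t"
      using L1 e by (auto simp: field_simps)
    have cp: "0 < c * t powr (k - e / 2)" using c t by simp
    then have fp: "0 < f t" using elim by linarith
    have "U * t powr (k + e / 2) \<le> max U 1 * t powr (k + e / 2)" by (intro mult_right_mono) auto
    then have "f t \<le> max U 1 * t powr (k + e / 2)" using elim by linarith
    then have "ln (f t) \<le> ln (max U 1 * t powr (k + e / 2))" using fp t by (subst ln_le_cancel_iff) auto
    also have "\<dots> = ln (max U 1) + (k + e / 2) * ln t" using t by (subst ln_mult) (auto simp: ln_powr)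
    finally have u: "ln (f t) < (k + e) * ln t" using b1 by (simp add: algebra_simps)
    have "ln (c * t powr (k - e / 2)) \<le> ln (f t)" using cp fp elim by (subst ln_le_cancel_iff) auto
    moreover have "ln (c * t powr (k - e / 2)) = ln c + (k - e / 2) * ln t" using t c by (subst ln_mult) (auto simp: ln_powr)
    ultimately have l: "(k - e) * ln t < ln (f t)" using b1 by (simp add: algebra_simps)
    have "ln (f t) / ln t < k + e" "k - e < ln (f t) / ln t" using u l t by (auto simp: field_simps)
    then show "dist (ln (f t) / ln t) k < e" by (auto simp: dist_real_def)
  qed
qed

context besq_sol
begin

lemma V_measurable_pair' [measurable]: "(\<lambda>p. V (snd p) (fst p)) \<in> borel_measurable (M \<Otimes>\<^sub>M lborel)"
proof -
  have "(\<lambda>p. (snd p, fst p)) \<in> measurable (M \<Otimes>\<^sub>M lborel) (lborel \<Otimes>\<^sub>M M)" by measurable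
  from measurable_compose[OF this V_measurable_pair] show ?thesis by simp
qed

definition A :: "real \<Rightarrow> real \<Rightarrow> real \<Rightarrow> 'a \<Rightarrow> real" where
  "A \<alpha> \<gamma> t \<omega> = (LINT s:{1..t}|lborel. s powr \<gamma> * rpow0 (V s \<omega>) \<alpha>)"

text \<open>The null set is fixed before S, so one null set serves all times t at once.\<close>

lemma set_integral_V_eq:
  "AE \<omega> in M. \<forall>S\<subseteq>{0..}. (LINT s:S|lborel. s powr \<gamma> * rpow0 (Y s \<omega>) \<alpha>) = (LINT s:S|lborel. s powr \<gamma> * rpow0 (V s \<omega>) \<alpha>)"
  using V_eq
proof eventually_elim
  case (elim \<omega>)
  then show ?case
    unfolding set_lebesgue_integral_def
    by (auto intro!: Bochner_Integration.integral_cong simp: indicator_def)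
qed

lemma A_le_nn_integral:
  "ennreal (A \<alpha> \<gamma> t \<omega>) \<le> (\<integral>\<^sup>+ s. ennreal (indicator {1..t} s * s powr \<gamma> * rpow0 (V s \<omega>) \<alpha>) \<partial>lborel)"
  using ennreal_integral_le[of "\<lambda>s. indicator {1..t} s * s powr \<gamma> * rpow0 (V s \<omega>) \<alpha>" lborel]
  unfolding A_def set_lebesgue_integral_def by (simp add: rpow0_nonneg mult.assoc)

text \<open>The mean integrand is of order s^(\<gamma>+\<alpha>); as \<gamma> + \<alpha> > 0, it is
  largest at s = t, and the interval is shorter than t.\<close>

lemma A_expectation:
  assumes \<alpha>: "0 \<le> \<alpha>" and \<gamma>: "- \<alpha> < \<gamma>" and t: "1 \<le> t"
  shows "(\<integral>\<^sup>+ \<omega>. ennreal (A \<alpha> \<gamma> t \<omega>) \<partial>M) \<le> ennreal (moment_const \<alpha> * t powr (1 + \<gamma> + \<alpha>))"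
proof -
  have "(\<integral>\<^sup>+ \<omega>. ennreal (A \<alpha> \<gamma> t \<omega>) \<partial>M) \<le>
    (\<integral>\<^sup>+ \<omega>. \<integral>\<^sup>+ s. ennreal (indicator {1..t} s * s powr \<gamma> * rpow0 (V s \<omega>) \<alpha>) \<partial>lborel \<partial>M)"
    by (intro nn_integral_mono A_le_nn_integral)
  also have "\<dots> \<le> (\<integral>\<^sup>+ s. ennreal (moment_const \<alpha> * (indicator {1..t} s * s powr \<gamma> * s powr \<alpha>)) \<partial>lborel)"
  proof (rule weighted_moment[OF \<alpha>])
    fix s :: real assume "indicator {1..t} s * s powr \<gamma> \<noteq> 0"
    then have "1 \<le> s" by (auto simp: indicator_def split: if_splits)
    then show "0 < s \<and> y \<le> y * s" using y_nonneg mult_left_mono[of 1 s y] by auto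
  qed auto
  also have "\<dots> \<le> (\<integral>\<^sup>+ s. ennreal (moment_const \<alpha> * t powr (\<gamma> + \<alpha>)) * indicator {1..t} s \<partial>lborel)"
  proof (rule nn_integral_mono)
    fix s
    show "ennreal (moment_const \<alpha> * (indicator {1..t} s * s powr \<gamma> * s powr \<alpha>)) \<le> ennreal (moment_const \<alpha> * t powr (\<gamma> + \<alpha>)) * indicator {1..t} s"
    proof (cases "s \<in> {1..t}")
      case True
      have "s powr \<gamma> * s powr \<alpha> \<le> t powr (\<gamma> + \<alpha>)"
        using True \<gamma> by (auto simp: powr_add[symmetric] intro!: powr_mono2)
      then show ?thesis using True moment_const_nonneg[of \<alpha>] by (auto intro!: ennreal_leI mult_left_mono)
    qed simp
  qed
  also have "\<dots> = ennreal (moment_const \<alpha> * t powr (\<gamma> + \<alpha>)) * ennreal (t - 1)"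
    using t by (simp add: nn_integral_cmult_indicator)
  also have "\<dots> = ennreal (moment_const \<alpha> * t powr (\<gamma> + \<alpha>) * (t - 1))"
    using t moment_const_nonneg[of \<alpha>] by (simp add: ennreal_mult)
  also have "\<dots> \<le> ennreal (moment_const \<alpha> * t powr (1 + \<gamma> + \<alpha>))"
  proof (rule ennreal_leI)
    have "moment_const \<alpha> * t powr (\<gamma> + \<alpha>) * (t - 1) \<le> moment_const \<alpha> * t powr (\<gamma> + \<alpha>) * t"
      using t moment_const_nonneg[of \<alpha>] by (intro mult_left_mono) auto
    also have "t powr (1 + \<gamma> + \<alpha>) = t powr (\<gamma> + \<alpha>) * t"
      using t powr_add[of t 1 "\<gamma> + \<alpha>"] by (simp add: add.assoc)
    then have "moment_const \<alpha> * t powr (\<gamma> + \<alpha>) * t = moment_const \<alpha> * t powr (1 + \<gamma> + \<alpha>)" by simp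
    finally show "moment_const \<alpha> * t powr (\<gamma> + \<alpha>) * (t - 1) \<le> moment_const \<alpha> * t powr (1 + \<gamma> + \<alpha>)" .
  qed
  finally show ?thesis .
qed

text \<open>The random constant U is the convergent integral itself: on [1,t] the factor s^\<gamma>
  is at most t^k s^(\<gamma>-k). In the mean the weighted integrand becomes s^(-1-\<eta>), up to a
  constant.\<close>

lemma A_upper:
  assumes \<alpha>: "0 \<le> \<alpha>" and \<gamma>: "- \<alpha> < \<gamma>" and \<eta>: "0 < \<eta>"
  shows "AE \<omega> in M. \<exists>U. \<forall>t\<ge>1. A \<alpha> \<gamma> t \<omega> \<le> U * t powr (1 + \<gamma> + \<alpha> + \<eta>)"
proof -
  define k where "k = 1 + \<gamma> + \<alpha> + \<eta>"
  have k: "0 < k" using \<gamma> \<eta> by (simp add: k_def)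
  define w :: "real \<Rightarrow> real" where "w s = indicator {1..} s * s powr (\<gamma> - k)" for s
  have [measurable]: "w \<in> borel_measurable borel" unfolding w_def by measurable
  let ?J = "\<lambda>\<omega>. \<integral>\<^sup>+ s. ennreal (w s * rpow0 (V s \<omega>) \<alpha>) \<partial>lborel"
  have Jm: "?J \<in> borel_measurable M" by measurable
  have "(\<integral>\<^sup>+ \<omega>. ?J \<omega> \<partial>M) \<le> (\<integral>\<^sup>+ s. ennreal (moment_const \<alpha> * (w s * s powr \<alpha>)) \<partial>lborel)"
  proof (rule weighted_moment[OF \<alpha>])
    fix s :: real assume "w s \<noteq> 0"
    then have "1 \<le> s" by (auto simp: w_def indicator_def split: if_splits)
    then show "0 < s \<and> y \<le> y * s" using y_nonneg mult_left_mono[of 1 s y] by auto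
  qed (auto simp: w_def)
  also have "\<dots> = (\<integral>\<^sup>+ s. ennreal (moment_const \<alpha>) * ennreal (indicator {1..} s * s powr (- 1 - \<eta>)) \<partial>lborel)"
  proof (rule nn_integral_cong)
    fix s :: real
    have "\<gamma> - k + \<alpha> = - 1 - \<eta>" by (simp add: k_def)
    then have "w s * s powr \<alpha> = indicator {1..} s * s powr (- 1 - \<eta>)"
      unfolding w_def mult.assoc powr_add[symmetric] by (simp only:)
    then show "ennreal (moment_const \<alpha> * (w s * s powr \<alpha>)) = ennreal (moment_const \<alpha>) * ennreal (indicator {1..} s * s powr (- 1 - \<eta>))"
      using moment_const_nonneg[of \<alpha>] by (simp add: ennreal_mult')
  qed
  also have "\<dots> = ennreal (moment_const \<alpha>) * ennreal (- 1 / (- 1 - \<eta> + 1))"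
    using \<eta> by (simp add: nn_integral_cmult nn_integral_powr_at_top)
  also have "\<dots> < \<infinity>" by (simp add: ennreal_mult_less_top)
  finally have "(\<integral>\<^sup>+ \<omega>. ?J \<omega> \<partial>M) \<noteq> \<infinity>" by simp
  from nn_integral_PInf_AE[OF Jm this] AE_space show ?thesis
  proof eventually_elim
    case (elim \<omega>)
    note [measurable] = V_measurable_path[OF elim(2)]
    show ?case
    proof (intro exI[of _ "enn2real (?J \<omega>)"] allI impI)
      fix t :: real assume t: "1 \<le> t"
      have "ennreal (A \<alpha> \<gamma> t \<omega>) \<le> (\<integral>\<^sup>+ s. ennreal (indicator {1..t} s * s powr \<gamma> * rpow0 (V s \<omega>) \<alpha>) \<partial>lborel)"
        by (rule A_le_nn_integral)
      also have "\<dots> \<le> (\<integral>\<^sup>+ s. ennreal (t powr k) * ennreal (w s * rpow0 (V s \<omega>) \<alpha>) \<partial>lborel)"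
      proof (rule nn_integral_mono)
        fix s :: real
        have "indicator {1..t} s * s powr \<gamma> \<le> t powr k * w s"
        proof (cases "s \<in> {1..t}")
          case True
          have "s powr \<gamma> = s powr k * s powr (\<gamma> - k)" using True by (simp add: powr_add[symmetric])
          also have "\<dots> \<le> t powr k * s powr (\<gamma> - k)" using True k by (intro mult_right_mono powr_mono2) auto
          finally show ?thesis using True by (simp add: w_def)
        qed (simp add: w_def)
        then have "indicator {1..t} s * s powr \<gamma> * rpow0 (V s \<omega>) \<alpha> \<le> t powr k * w s * rpow0 (V s \<omega>) \<alpha>"
          by (rule mult_right_mono) (rule rpow0_nonneg)
        then have "ennreal (indicator {1..t} s * s powr \<gamma> * rpow0 (V s \<omega>) \<alpha>) \<le> ennreal (t powr k * (w s * rpow0 (V s \<omega>) \<alpha>))"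
          by (intro ennreal_leI) (simp add: mult.assoc)
        then show "ennreal (indicator {1..t} s * s powr \<gamma> * rpow0 (V s \<omega>) \<alpha>) \<le> ennreal (t powr k) * ennreal (w s * rpow0 (V s \<omega>) \<alpha>)"
          by (simp add: ennreal_mult')
      qed
      also have "\<dots> = ennreal (t powr k) * ?J \<omega>"
        by (rule nn_integral_cmult) measurable
      also have "\<dots> = ennreal (t powr k) * ennreal (enn2real (?J \<omega>))" using elim by (simp add: ennreal_enn2real_if)
      also have "\<dots> = ennreal (enn2real (?J \<omega>) * t powr k)" by (simp add: ennreal_mult' mult.commute)
      finally show "A \<alpha> \<gamma> t \<omega> \<le> enn2real (?J \<omega>) * t powr (1 + \<gamma> + \<alpha> + \<eta>)"
        unfolding k_def by (subst (asm) ennreal_le_iff) auto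
    qed
  qed
qed

lemma path_set_integrable:
  assumes "\<omega> \<in> space M" "0 < a" "0 \<le> \<alpha>"
  shows "set_integrable lborel {a..b} (\<lambda>s. s powr \<gamma> * rpow0 (V s \<omega>) \<alpha>)"
proof (rule borel_integrable_atLeastAtMost')
  have c: "continuous_on {a..b} (\<lambda>s. V s \<omega>)" by (rule continuous_on_subset[OF V_continuous[OF assms(1)]]) simp
  have "continuous_on {a..b} (\<lambda>s. rpow0 (V s \<omega>) \<alpha>)"
  proof (cases "\<alpha> = 0")
    case False
    then have "continuous_on {a..b} (\<lambda>s. V s \<omega> powr \<alpha>)"
      using assms V_nonneg by (intro continuous_on_powr' c continuous_on_const) auto
    then show ?thesis using False by (simp add: rpow0_def)
  qed (simp add: rpow0_def)
  then show "continuous_on {a..b} (\<lambda>s. s powr \<gamma> * rpow0 (V s \<omega>) \<alpha>)"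
    using assms by (intro continuous_intros) auto
qed

text \<open>On (t/2,t] the measure ds / s has mass ln 2. The function 1 - e exp (- s^(\<eta>-1) V s)
  is at most 1 and positive only where V s > s^(1-\<eta>); there s^\<gamma> V^\<alpha> is at least
  s^(p-1), hence at least (t/2)^p / s. Its exponential part over (t/2,t] belongs to the tail of a
  convergent integral and eventually removes at most half of the mass.\<close>

lemma A_lower:
  assumes \<alpha>: "0 \<le> \<alpha>" and \<gamma>: "- \<alpha> < \<gamma>" and \<eta>: "0 < \<eta>" "\<eta> * \<alpha> \<le> 1"
  shows "AE \<omega> in M. eventually (\<lambda>t. ln 2 / 2 * (t / 2) powr (1 + \<gamma> + \<alpha> - \<eta> * \<alpha>) \<le> A \<alpha> \<gamma> t \<omega>) at_top"
proof -
  define p where "p = 1 + \<gamma> + \<alpha> - \<eta> * \<alpha>"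
  \<comment> \<open>Here \<eta> \<alpha> \<le> 1 enters; it is what allows (t/2)^p \<le> s^p for s >
    t/2.\<close>
  have p: "0 \<le> p" using \<gamma> \<eta> by (simp add: p_def)
  let ?h = "\<lambda>s v::real. s powr (-1) * exp (- (s powr (\<eta> - 1) * v))"
  let ?J = "\<lambda>\<omega>. \<integral>\<^sup>+ s. ennreal (indicator {1..} s * ?h s (V s \<omega>)) \<partial>lborel"
  have Jm: "?J \<in> borel_measurable M" by measurable
  have "(\<integral>\<^sup>+ \<omega>. ?J \<omega> \<partial>M) = (\<integral>\<^sup>+ s. \<integral>\<^sup>+ \<omega>. ennreal (indicator {1..} s * ?h s (V s \<omega>)) \<partial>M \<partial>lborel)"
    by (rule nn_Fubini[where g = "\<lambda>s v. indicator {1..} s * ?h s v"]) measurable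
  also have "\<dots> \<le> (\<integral>\<^sup>+ s. ennreal (indicator {1..} s * s powr (- 1 - \<eta> * \<delta> / 2)) \<partial>lborel)"
  proof (rule nn_integral_mono)
    fix s :: real
    show "(\<integral>\<^sup>+ \<omega>. ennreal (indicator {1..} s * ?h s (V s \<omega>)) \<partial>M) \<le> ennreal (indicator {1..} s * s powr (- 1 - \<eta> * \<delta> / 2))"
    proof (cases "1 \<le> s")
      case True
      define l where "l = s powr (\<eta> - 1)"
      have l: "0 < l" using True by (simp add: l_def)
      have "(\<integral>\<^sup>+ \<omega>. ennreal (indicator {1..} s * ?h s (V s \<omega>)) \<partial>M) = ennreal (s powr (-1)) * (\<integral>\<^sup>+ \<omega>. ennreal (exp (- (l * V s \<omega>))) \<partial>M)"
      proof -
        have "ennreal (indicator {1..} s * ?h s (V s \<omega>)) = ennreal (s powr (-1)) * ennreal (exp (- (l * V s \<omega>)))" for \<omega>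
          using True by (simp add: l_def ennreal_mult'[symmetric])
        then show ?thesis by (simp only:) (rule nn_integral_cmult, measurable)
      qed
      also have "(\<integral>\<^sup>+ \<omega>. ennreal (exp (- (l * V s \<omega>))) \<partial>M) = ennreal (laplace_derivative s y 0 \<delta> l)"
        using laplace_at[OF l, of s] True V_power_exp_integrable[OF l, of s 0] by (subst nn_integral_eq_integral) auto
      also have "\<dots> \<le> ennreal (s powr (- \<eta> * \<delta> / 2))"
      proof (rule ennreal_leI)
        \<comment> \<open>With l s = s^\<eta> the Laplace transform decays like a negative power of
          s. Positivity of \<delta> is what makes the integral against ds / s converge.\<close>
        have ls: "l * s = s powr \<eta>" using True by (simp add: l_def powr_diff)
        have "2 * l * s = 2 * s powr \<eta>" using ls by (simp only: mult.assoc)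
        moreover have "0 < s powr \<eta>" using True by simp
        ultimately have "s powr \<eta> \<le> 1 + 2 * l * s" "0 < s powr \<eta>" by linarith+
        then have "(1 + 2 * l * s) powr (- \<delta> / 2) \<le> (s powr \<eta>) powr (- \<delta> / 2)"
          using \<delta>_pos by (intro powr_mono2') auto
        moreover have "exp (- (l / (1 + 2 * l * s) * y)) \<le> 1" using l True y_nonneg by simp
        ultimately have "(1 + 2 * l * s) powr (- \<delta> / 2) * exp (- (l / (1 + 2 * l * s) * y)) \<le> (s powr \<eta>) powr (- \<delta> / 2) * 1"
          by (intro mult_mono) auto
        then show "laplace_derivative s y 0 \<delta> l \<le> s powr (- \<eta> * \<delta> / 2)" by (simp add: powr_powr)
      qed
      also have "ennreal (s powr (-1)) * ennreal (s powr (- \<eta> * \<delta> / 2)) = ennreal (indicator {1..} s * s powr (- 1 - \<eta> * \<delta> / 2))"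
      proof -
        have "-1 + - \<eta> * \<delta> / 2 = - 1 - \<eta> * \<delta> / 2" by simp
        then have "s powr (-1) * s powr (- \<eta> * \<delta> / 2) = s powr (- 1 - \<eta> * \<delta> / 2)"
          by (simp only: powr_add[symmetric])
        then show ?thesis using True by (simp only: ennreal_mult'[OF powr_ge_zero, symmetric]) simp
      qed
      finally show ?thesis by (simp add: mult_left_mono)
    qed (simp add: indicator_def)
  qed
  also have "\<dots> = ennreal (- 1 / (- 1 - \<eta> * \<delta> / 2 + 1))"
    by (rule nn_integral_powr_at_top) (use \<eta> \<delta>_pos in simp)
  also have "\<dots> < \<infinity>" by simp
  finally have "(\<integral>\<^sup>+ \<omega>. ?J \<omega> \<partial>M) \<noteq> \<infinity>" by simp
  from nn_integral_PInf_AE[OF Jm this] AE_space show ?thesis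
  proof eventually_elim
    case (elim \<omega>)
    note [measurable] = V_measurable_path[OF elim(2)]
    define g where "g s = ?h s (V s \<omega>)" for s
    have "integrable lborel (\<lambda>s. indicator {1..} s * g s)"
    proof (rule integrableI_nonneg)
      show "(\<integral>\<^sup>+ s. ennreal (indicator {1..} s * g s) \<partial>lborel) < \<infinity>" using elim(1) by (simp add: g_def less_top)
    qed (auto simp: g_def)
    then have gi: "set_integrable lborel {1..} g" by (simp add: set_integrable_def)
    let ?G = "\<lambda>t. LINT s:{1..t}|lborel. g s"
    have Glim: "(?G \<longlongrightarrow> (LINT s:{1..}|lborel. g s)) at_top"
      by (rule tendsto_set_lebesgue_integral_at_top[OF _ gi]) simp
    have half: "filterlim (\<lambda>t::real. t / 2) at_top at_top"
      unfolding filterlim_at_top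
    proof
      fix Z :: real
      show "eventually (\<lambda>t. Z \<le> t / 2) at_top"
        using eventually_ge_at_top[of "2 * Z"] by eventually_elim simp
    qed
    have "((\<lambda>t. ?G t - ?G (t / 2)) \<longlongrightarrow> (LINT s:{1..}|lborel. g s) - (LINT s:{1..}|lborel. g s)) at_top"
      by (intro tendsto_diff Glim filterlim_compose[OF Glim half])
    then have "((\<lambda>t. ?G t - ?G (t / 2)) \<longlongrightarrow> 0) at_top" by simp
    \<comment> \<open>Multiplied by e, this threshold is half of the mass ln 2.\<close>
    moreover have "0 < ln 2 / (2 * exp 1 :: real)" by simp
    ultimately have "eventually (\<lambda>t. ?G t - ?G (t / 2) < ln 2 / (2 * exp 1)) at_top" by (rule order_tendstoD(2))
    then show ?case using eventually_ge_at_top[of 2]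
    proof eventually_elim
      case (elim t)
      have gt: "set_integrable lborel {1..b} g" for b
        by (rule set_integrable_subset[OF gi]) auto
      have li: "set_integrable lborel {1..b} (\<lambda>s::real. s powr (-1))" for b
        by (rule borel_integrable_atLeastAtMost') (auto intro!: continuous_intros)
      have lnb: "(LINT s:{1..b}|lborel. s powr (-1)) = ln b" if "1 \<le> b" for b :: real
      proof -
        have "(\<integral>s. s powr (-1) * indicator {1..b} s \<partial>lborel) = ln b - ln 1"
        proof (rule integral_FTC_Icc_real[OF that])
          fix x :: real assume x: "1 \<le> x" "x \<le> b"
          show "(ln has_real_derivative x powr (-1)) (at x)"
            using x DERIV_ln[of x] by (simp add: powr_minus)
          show "isCont (\<lambda>x. x powr (-1)) x" using x by (intro continuous_intros) auto
        qed
        then show ?thesis by (simp add: set_lebesgue_integral_def mult.commute)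
      qed
      \<comment> \<open>The difference \<open>?r t s - ?r (t / 2) s\<close> is s^-1 (1 - e g s)
        times s^0 on (t/2,t], with the exponential of \<open>g\<close> inside, and 0 at all other
        times.\<close>
      let ?r = "\<lambda>b s. indicator {1..b} s * (s powr (-1)) - exp 1 * (indicator {1..b} s * g s)"
      have ri: "integrable lborel (?r b)" for b
        using li[of b] gt[of b] by (simp add: set_integrable_def)
      have rint: "integral\<^sup>L lborel (?r b) = ln b - exp 1 * ?G b" if "1 \<le> b" for b
        using li[of b] gt[of b] lnb[OF that] by (simp add: set_integrable_def set_lebesgue_integral_def)
      have "(t / 2) powr p * (ln 2 - exp 1 * (?G t - ?G (t / 2))) = integral\<^sup>L lborel (\<lambda>s. (t / 2) powr p * (?r t s - ?r (t / 2) s))"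
      proof -
        have "integral\<^sup>L lborel (\<lambda>s. (t / 2) powr p * (?r t s - ?r (t / 2) s)) = (t / 2) powr p * (integral\<^sup>L lborel (?r t) - integral\<^sup>L lborel (?r (t / 2)))"
          using ri[of t] ri[of "t / 2"] by (simp only: integral_mult_right_zero Bochner_Integration.integral_diff)
        also have "integral\<^sup>L lborel (?r t) - integral\<^sup>L lborel (?r (t / 2)) = ln 2 - exp 1 * (?G t - ?G (t / 2))"
        proof -
          have t1: "1 \<le> t" "1 \<le> t / 2" using elim(2) by auto
          show ?thesis unfolding rint[OF t1(1)] rint[OF t1(2)] using elim(2) by (simp add: ln_div algebra_simps)
        qed
        finally show ?thesis by (rule sym)
      qed
      also have "\<dots> \<le> integral\<^sup>L lborel (\<lambda>s. indicator {1..t} s * (s powr \<gamma> * rpow0 (V s \<omega>) \<alpha>))"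
      proof (rule integral_mono)
        show "integrable lborel (\<lambda>s. (t / 2) powr p * (?r t s - ?r (t / 2) s))"
          by (intro integrable_mult_right impI Bochner_Integration.integrable_diff[OF ri ri])
        show "integrable lborel (\<lambda>s. indicator {1..t} s * (s powr \<gamma> * rpow0 (V s \<omega>) \<alpha>))"
          using path_set_integrable[OF \<open>\<omega> \<in> space M\<close> zero_less_one \<alpha>, of t \<gamma>] by (simp add: set_integrable_def)
        fix s :: real
        show "(t / 2) powr p * (?r t s - ?r (t / 2) s) \<le> indicator {1..t} s * (s powr \<gamma> * rpow0 (V s \<omega>) \<alpha>)"
        proof (cases "t / 2 < s \<and> s \<le> t")
          case True
          then have s: "1 \<le> s" "s \<in> {1..t}" "s \<notin> {1..t / 2}" using elim(2) by auto
          define q where "q = 1 - exp 1 * exp (- (s powr (\<eta> - 1) * V s \<omega>))"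
          have eq: "?r t s - ?r (t / 2) s = s powr (-1) * q"
            using s by (simp add: q_def g_def algebra_simps)
          have "(t / 2) powr p * (s powr (-1) * q) \<le> s powr \<gamma> * rpow0 (V s \<omega>) \<alpha>"
          proof (cases "0 \<le> q")
            case q0: True
            then have "exp 1 * exp (- (s powr (\<eta> - 1) * V s \<omega>)) \<le> 1" by (simp add: q_def)
            then have "exp (1 - s powr (\<eta> - 1) * V s \<omega>) \<le> 1" by (simp add: exp_diff exp_minus field_simps)
            then have "1 \<le> s powr (\<eta> - 1) * V s \<omega>" by simp
            then have "s powr (1 - \<eta>) * 1 \<le> s powr (1 - \<eta>) * (s powr (\<eta> - 1) * V s \<omega>)" by (rule mult_left_mono) simp
            also have "\<dots> = V s \<omega>" using s by (simp add: mult.assoc[symmetric] powr_add[symmetric])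
            finally have Vs: "s powr (1 - \<eta>) \<le> V s \<omega>" by simp
            have rp: "(s powr (1 - \<eta>)) powr \<alpha> \<le> rpow0 (V s \<omega>) \<alpha>"
              using Vs \<alpha> s by (cases "\<alpha> = 0") (auto simp: rpow0_def intro!: powr_mono2)
            have "(t / 2) powr p * (s powr (-1) * q) \<le> s powr p * (s powr (-1) * 1)"
            proof (rule mult_mono)
              show "(t / 2) powr p \<le> s powr p" using True p elim(2) by (intro powr_mono2) auto
              show "s powr (-1) * q \<le> s powr (-1) * 1" by (rule mult_left_mono) (auto simp: q_def)
              show "0 \<le> s powr (-1) * q" using q0 by simp
            qed simp
            also have "\<dots> = s powr (p - 1)" using s powr_add[of s p "-1"] by simp
            also have "p - 1 = \<gamma> + (1 - \<eta>) * \<alpha>" by (simp add: p_def algebra_simps)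
            also have "s powr (\<gamma> + (1 - \<eta>) * \<alpha>) = s powr \<gamma> * (s powr (1 - \<eta>)) powr \<alpha>"
              by (simp add: powr_add powr_powr)
            also have "\<dots> \<le> s powr \<gamma> * rpow0 (V s \<omega>) \<alpha>" by (intro mult_left_mono rp) auto
            finally show ?thesis .
          next
            case False
            then have "(t / 2) powr p * (s powr (-1) * q) \<le> 0"
              by (intro mult_nonneg_nonpos) auto
            also have "0 \<le> s powr \<gamma> * rpow0 (V s \<omega>) \<alpha>" by (simp add: rpow0_nonneg)
            finally show ?thesis .
          qed
          then show ?thesis unfolding eq using s by simp
        next
          case False
          then have "indicator {1..t} s = (indicator {1..t / 2} s :: real)" using elim(2) by (auto simp: indicator_def)
          then show ?thesis by (simp add: rpow0_nonneg)
        qed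
      qed
      also have "\<dots> = A \<alpha> \<gamma> t \<omega>" by (simp add: A_def set_lebesgue_integral_def)
      finally have main: "(t / 2) powr p * (ln 2 - exp 1 * (?G t - ?G (t / 2))) \<le> A \<alpha> \<gamma> t \<omega>" .
      have "exp 1 * (?G t - ?G (t / 2)) \<le> exp 1 * (ln 2 / (2 * exp 1))" using elim(1) by (intro mult_left_mono) auto
      also have "\<dots> = ln 2 / 2" by simp
      finally have "ln 2 / 2 \<le> ln 2 - exp 1 * (?G t - ?G (t / 2))" by (simp add: field_simps)
      then have "(t / 2) powr p * (ln 2 / 2) \<le> (t / 2) powr p * (ln 2 - exp 1 * (?G t - ?G (t / 2)))"
        by (rule mult_left_mono) simp
      with main show ?case unfolding p_def by (simp add: mult.commute)
    qed
  qed
qed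

theorem A_log_asymptotics:
  assumes \<alpha>: "0 \<le> \<alpha>" and \<gamma>: "- \<alpha> < \<gamma>"
  shows "AE \<omega> in M. ((\<lambda>t. ln (A \<alpha> \<gamma> t \<omega>) / ln t) \<longlongrightarrow> 1 + \<gamma> + \<alpha>) at_top"
proof -
  \<comment> \<open>A countable sequence, so that the exceptional sets may be united. The factor
    \<alpha> + 1 makes both \<eta> and \<eta> \<alpha> at most 1 / (n + 1), and in particular \<eta>
    \<alpha> \<le> 1 as \<open>A_lower\<close> requires.\<close>
  define \<eta> where "\<eta> n = 1 / ((\<alpha> + 1) * real (Suc n))" for n
  have \<eta>: "0 < \<eta> n" "\<eta> n * \<alpha> \<le> 1" "\<eta> n \<le> 1 / real (Suc n)" "\<eta> n * \<alpha> \<le> 1 / real (Suc n)" for n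
  proof -
    show "0 < \<eta> n" using \<alpha> by (simp add: \<eta>_def)
    have "\<eta> n * \<alpha> = \<alpha> / (\<alpha> + 1) * (1 / real (Suc n))" by (simp add: \<eta>_def)
    also have "\<dots> \<le> 1 * (1 / real (Suc n))" using \<alpha> by (intro mult_right_mono) auto
    finally show *: "\<eta> n * \<alpha> \<le> 1 / real (Suc n)" by simp
    have "1 / real (Suc n) \<le> 1" by simp
    with * show "\<eta> n * \<alpha> \<le> 1" by linarith
    have "1 / ((\<alpha> + 1) * real (Suc n)) \<le> 1 / (1 * real (Suc n))"
      using \<alpha> by (intro divide_left_mono mult_right_mono) auto
    then show "\<eta> n \<le> 1 / real (Suc n)" by (simp add: \<eta>_def)
  qed
  have "AE \<omega> in M. \<forall>n. \<exists>U. \<forall>t\<ge>1. A \<alpha> \<gamma> t \<omega> \<le> U * t powr (1 + \<gamma> + \<alpha> + \<eta> n)"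
    unfolding AE_all_countable by (intro allI A_upper \<alpha> \<gamma> \<eta>)
  moreover have "AE \<omega> in M. \<forall>n. eventually (\<lambda>t. ln 2 / 2 * (t / 2) powr (1 + \<gamma> + \<alpha> - \<eta> n * \<alpha>) \<le> A \<alpha> \<gamma> t \<omega>) at_top"
    unfolding AE_all_countable by (intro allI A_lower \<alpha> \<gamma> \<eta>)
  ultimately show ?thesis
  proof eventually_elim
    case (elim \<omega>)
    show ?case
    proof (rule log_ratio_limit)
      fix \<epsilon> :: real assume "0 < \<epsilon>"
      then obtain n where n: "1 / real (Suc n) < \<epsilon>" using nat_approx_posE by blast
      have n1: "\<eta> n \<le> \<epsilon>" "\<eta> n * \<alpha> \<le> \<epsilon>" using \<eta>(3,4)[of n] n by linarith+
      obtain U where U: "\<And>t. 1 \<le> t \<Longrightarrow> A \<alpha> \<gamma> t \<omega> \<le> U * t powr (1 + \<gamma> + \<alpha> + \<eta> n)" using elim(1) by blast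
      have "A \<alpha> \<gamma> t \<omega> \<le> \<bar>U\<bar> * t powr (1 + \<gamma> + \<alpha> + \<epsilon>)" if t: "1 \<le> t" for t
      proof -
        have "U * t powr (1 + \<gamma> + \<alpha> + \<eta> n) \<le> \<bar>U\<bar> * t powr (1 + \<gamma> + \<alpha> + \<epsilon>)"
          using t n1 by (intro mult_mono powr_mono) auto
        then show ?thesis using U[OF t] by linarith
      qed
      then show "\<exists>U. eventually (\<lambda>t. A \<alpha> \<gamma> t \<omega> \<le> U * t powr (1 + \<gamma> + \<alpha> + \<epsilon>)) at_top"
        by (intro exI[of _ "\<bar>U\<bar>"] eventually_mono[OF eventually_ge_at_top[of 1]])
      let ?p = "1 + \<gamma> + \<alpha> - \<eta> n * \<alpha>"
      show "\<exists>c>0. eventually (\<lambda>t. c * t powr (1 + \<gamma> + \<alpha> - \<epsilon>) \<le> A \<alpha> \<gamma> t \<omega>) at_top"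
      proof (intro exI[of _ "ln 2 / 2 * (1 / 2) powr ?p"] conjI)
        show "eventually (\<lambda>t. ln 2 / 2 * (1 / 2) powr ?p * t powr (1 + \<gamma> + \<alpha> - \<epsilon>) \<le> A \<alpha> \<gamma> t \<omega>) at_top"
          using elim(2)[rule_format, of n] eventually_ge_at_top[of 1]
        proof eventually_elim
          case (elim t)
          have "t powr (1 + \<gamma> + \<alpha> - \<epsilon>) \<le> t powr ?p" using elim n1 by (intro powr_mono) auto
          then have "ln 2 / 2 * (1 / 2) powr ?p * t powr (1 + \<gamma> + \<alpha> - \<epsilon>) \<le> ln 2 / 2 * (1 / 2) powr ?p * t powr ?p"
            by (intro mult_left_mono) auto
          also have "\<dots> = ln 2 / 2 * (t / 2) powr ?p" using elim by (simp add: powr_divide)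
          finally show ?case using elim by linarith
        qed
      qed simp
    qed
  qed
qed

end

section \<open>Convergence in distribution\<close>

context besq_sol
begin

text \<open>The variable whose mean is the joint Laplace transform, at the times S with parameters
  \<open>lm\<close>, of the rescaled process V (c s) / c.\<close>

definition joint :: "real \<Rightarrow> real set \<Rightarrow> (real \<Rightarrow> real) \<Rightarrow> 'a \<Rightarrow> real" where
  "joint c S lm \<omega> = exp (- (\<Sum>s\<in>S. lm s * (V (c * s) \<omega> / c)))"

lemma joint_bounded:
  assumes "0 < c" "\<And>s. s \<in> S \<Longrightarrow> 0 \<le> lm s"
  shows "0 \<le> joint c S lm \<omega>" "joint c S lm \<omega> \<le> 1" "\<bar>joint c S lm \<omega>\<bar> \<le> 1"
proof -
  have "0 \<le> (\<Sum>s\<in>S. lm s * (V (c * s) \<omega> / c))"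
    using assms V_nonneg by (intro sum_nonneg mult_nonneg_nonneg divide_nonneg_nonneg) (auto intro: less_imp_le)
  then show "0 \<le> joint c S lm \<omega>" "joint c S lm \<omega> \<le> 1" "\<bar>joint c S lm \<omega>\<bar> \<le> 1" by (auto simp: joint_def)
qed

lemma joint_measurable [measurable]: "joint c S lm \<in> borel_measurable M"
  unfolding joint_def by measurable

lemma joint_adapted:
  assumes "0 < c" "0 \<le> t" "S \<subseteq> {0..t}"
  shows "joint c S lm \<in> borel_measurable (Fm (c * t))"
proof -
  have "V (c * s) \<in> borel_measurable (Fm (c * t))" if "s \<in> S" for s
  proof (rule measurable_Fm_mono[OF V_adapted])
    show "0 \<le> c * s" "0 \<le> c * s" "c * s \<le> c * t" using assms that by (auto intro: mult_left_mono)
  qed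
  then have [measurable]: "(\<lambda>\<omega>. \<Sum>s\<in>S. lm s * (V (c * s) \<omega> / c)) \<in> borel_measurable (Fm (c * t))"
    by (intro borel_measurable_sum borel_measurable_times borel_measurable_divide) auto
  show ?thesis unfolding joint_def by measurable
qed

lemma joint_insert:
  assumes "finite S" "t \<notin> S"
  shows "joint c (insert t S) lm \<omega> = joint c S lm \<omega> * exp (- (lm t / c * V (c * t) \<omega>))"
  using assms by (simp add: joint_def exp_add[symmetric] algebra_simps)

lemma joint_upd:
  assumes "finite S" "s \<in> S"
  shows "joint c S (lm(s := lm s + \<mu>)) \<omega> = joint c S lm \<omega> * exp (- (\<mu> / c * V (c * s) \<omega>))"
proof -
  have "(\<Sum>r\<in>S. (lm(s := lm s + \<mu>)) r * (V (c * r) \<omega> / c)) = (\<Sum>r\<in>S. lm r * (V (c * r) \<omega> / c) + (if r = s then \<mu> * (V (c * s) \<omega> / c) else 0))"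
    by (intro sum.cong) (auto simp: algebra_simps add_divide_distrib)
  also have "\<dots> = (\<Sum>r\<in>S. lm r * (V (c * r) \<omega> / c)) + \<mu> * (V (c * s) \<omega> / c)"
    using assms by (simp add: sum.distrib sum.delta)
  finally show ?thesis by (simp add: joint_def exp_add[symmetric])
qed

text \<open>A further exponential at time s is absorbed in the parameters. If s is a new time,
  whatever value \<open>lm\<close> happens to have there must count as 0.\<close>

lemma joint_factor:
  assumes S: "finite S"
  shows "joint c (insert s S) (lm(s := (if s \<in> S then lm s else 0) + \<mu>)) \<omega> = joint c S lm \<omega> * exp (- (\<mu> / c * V (c * s) \<omega>))"
proof (cases "s \<in> S")
  case True
  then have "insert s S = S" by auto
  then show ?thesis using joint_upd[OF S True] True by simp
next
  case False
  have "joint c S (lm(s := 0 + \<mu>)) \<omega> = joint c S lm \<omega>"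
    unfolding joint_def by (intro arg_cong[where f = "\<lambda>x. exp (- x)"] sum.cong) (use False in auto)
  then show ?thesis using joint_insert[OF S False, of c "lm(s := 0 + \<mu>)"] False by simp
qed

text \<open>\<open>conditional_laplace\<close> with the exponentials at the earlier times as weight:
  the last time t is removed, and its transformed parameter is added at the time s before it. The
  scale c cancels in (lm t / c) (c t - c s), so the factor gained is free of c; this is the scaling
  property of the process.\<close>

lemma joint_step:
  assumes c: "0 < c" and S: "finite S" "s \<in> S" "S \<subseteq> {0..s}" and t: "s < t" and l: "\<And>r. r \<in> insert t S \<Longrightarrow> 0 \<le> lm r"
  shows "expectation (joint c (insert t S) lm) =
    (1 + 2 * lm t * (t - s)) powr (- \<delta> / 2) * expectation (joint c S (lm(s := lm s + lm t / (1 + 2 * lm t * (t - s)))))"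
proof -
  have s0: "0 \<le> s" using S by auto
  have tS: "t \<notin> S" using S t by auto
  note ins = joint_insert[OF S(1) tS]
  show ?thesis
  proof (cases "lm t = 0")
    \<comment> \<open>\<open>conditional_laplace\<close> asks for a positive parameter; for
      parameter 0 both sides agree at once.\<close>
    case True
    then show ?thesis unfolding ins by simp
  next
    case False
    then have lt: "0 < lm t / c" using l[of t] c by simp
    have e: "2 * (lm t / c) * (c * t - c * s) = 2 * lm t * (t - s)" using c by (simp add: field_simps)
    have "expectation (\<lambda>\<omega>. joint c S lm \<omega> * exp (- (lm t / c * V (c * t) \<omega>))) =
      (1 + 2 * (lm t / c) * (c * t - c * s)) powr (- \<delta> / 2) *
      expectation (\<lambda>\<omega>. joint c S lm \<omega> * exp (- (lm t / c / (1 + 2 * (lm t / c) * (c * t - c * s)) * V (c * s) \<omega>)))"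
    proof (rule conditional_laplace[OF lt joint_adapted[OF c s0 S(3)]])
      show "\<bar>joint c S lm \<omega>\<bar> \<le> 1" for \<omega> using joint_bounded[OF c] l by auto
      show "0 \<le> c * s" "c * s \<le> c * t" using c s0 t by auto
    qed
    also have "lm t / c / (1 + 2 * (lm t / c) * (c * t - c * s)) = lm t / (1 + 2 * lm t * (t - s)) / c"
      unfolding e by simp
    finally show ?thesis unfolding e ins joint_upd[OF S(1,2)] .
  qed
qed

lemma joint_start:
  assumes "0 < c"
  shows "expectation (joint c {0} lm) = exp (- (lm 0 * (y / c)))"
proof -
  have "expectation (joint c {0} lm) = expectation (\<lambda>\<omega>. exp (- (lm 0 * (y / c))))"
    by (rule integral_cong_AE) (use V_start in \<open>auto simp: joint_def\<close>)
  then show ?thesis by (simp add: prob_space)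
qed

lemma scaled_measurable_pair [measurable]:
  assumes "sets \<mu> = sets borel"
  shows "(\<lambda>p. V (c * fst p) (snd p)) \<in> borel_measurable (\<mu> \<Otimes>\<^sub>M M)" "(\<lambda>p. V (c * snd p) (fst p)) \<in> borel_measurable (M \<Otimes>\<^sub>M \<mu>)"
proof -
  have [measurable_cong]: "sets \<mu> = sets lborel" using assms by simp
  have [measurable]: "fst \<in> borel_measurable (\<mu> \<Otimes>\<^sub>M M)" "snd \<in> borel_measurable (M \<Otimes>\<^sub>M \<mu>)"
    using measurable_fst[of \<mu> M] measurable_snd[of M \<mu>] by (simp_all cong: measurable_cong_sets add: assms)
  have "(\<lambda>p. (c * fst p, snd p)) \<in> measurable (\<mu> \<Otimes>\<^sub>M M) (lborel \<Otimes>\<^sub>M M)" by measurable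
  from measurable_compose[OF this V_measurable_pair] show "(\<lambda>p. V (c * fst p) (snd p)) \<in> borel_measurable (\<mu> \<Otimes>\<^sub>M M)" by simp
  have "(\<lambda>p. (c * snd p, fst p)) \<in> measurable (M \<Otimes>\<^sub>M \<mu>) (lborel \<Otimes>\<^sub>M M)" by measurable
  from measurable_compose[OF this V_measurable_pair] show "(\<lambda>p. V (c * snd p) (fst p)) \<in> borel_measurable (M \<Otimes>\<^sub>M \<mu>)" by simp
qed

text \<open>The bounded substitute for the rescaled A: powers of the process are replaced by a
  polynomial in exp (- V (c s) / c). Later \<mu> is \<open>weight\<close>, the density s^\<gamma>
  away from 0.\<close>

definition functional :: "real measure \<Rightarrow> (nat \<Rightarrow> real) \<Rightarrow> nat \<Rightarrow> real \<Rightarrow> 'a \<Rightarrow> real" where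
  "functional \<mu> a n c \<omega> = (\<integral>s. (\<Sum>i\<le>n. a i * exp (- (V (c * s) \<omega> / c)) ^ i) \<partial>\<mu>)"

lemma functional_props:
  assumes \<mu>: "finite_measure \<mu>" "sets \<mu> = sets borel" and c: "0 < c"
  shows "functional \<mu> a n c \<in> borel_measurable M"
    and "\<bar>functional \<mu> a n c \<omega>\<bar> \<le> (\<Sum>i\<le>n. \<bar>a i\<bar>) * measure \<mu> UNIV"
proof -
  interpret finite_measure \<mu> by fact
  note [measurable] = scaled_measurable_pair[OF \<mu>(2)]
  show "functional \<mu> a n c \<in> borel_measurable M"
    unfolding functional_def by measurable
  have le: "norm (\<Sum>i\<le>n. a i * exp (- (V (c * s) \<omega> / c)) ^ i) \<le> (\<Sum>i\<le>n. \<bar>a i\<bar>)" for s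
  proof -
    have "norm (\<Sum>i\<le>n. a i * exp (- (V (c * s) \<omega> / c)) ^ i) \<le> (\<Sum>i\<le>n. norm (a i * exp (- (V (c * s) \<omega> / c)) ^ i))"
      by (rule norm_sum)
    also have "\<dots> \<le> (\<Sum>i\<le>n. \<bar>a i\<bar>)"
    proof (rule sum_mono)
      fix i
      have "exp (- (V (c * s) \<omega> / c)) ^ i \<le> 1" using V_nonneg[of "c * s" \<omega>] c by (intro power_le_one) auto
      then show "norm (a i * exp (- (V (c * s) \<omega> / c)) ^ i) \<le> \<bar>a i\<bar>" by (simp add: abs_mult mult_left_le)
    qed
    finally show ?thesis .
  qed
  have sp: "space \<mu> = UNIV" using sets_eq_imp_space_eq[OF \<mu>(2)] by simp
  have "\<bar>functional \<mu> a n c \<omega>\<bar> \<le> (\<integral>s. norm (\<Sum>i\<le>n. a i * exp (- (V (c * s) \<omega> / c)) ^ i) \<partial>\<mu>)"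
    unfolding functional_def real_norm_def[symmetric] by (rule integral_norm_bound)
  also have "\<dots> \<le> (\<integral>s. (\<Sum>i\<le>n. \<bar>a i\<bar>) \<partial>\<mu>)"
    by (rule integral_mono') (use le in \<open>auto intro: sum_nonneg\<close>)
  also have "\<dots> = (\<Sum>i\<le>n. \<bar>a i\<bar>) * measure \<mu> UNIV" by (simp add: sp)
  finally show "\<bar>functional \<mu> a n c \<omega>\<bar> \<le> (\<Sum>i\<le>n. \<bar>a i\<bar>) * measure \<mu> UNIV" .
qed

text \<open>One factor of the power is written as an integral over s and taken outside by Fubini;
  its i-th exponential power then joins the Laplace variable as time s with parameter i. The factor
  \<open>joint\<close> in the statement is what lets this be iterated down to power 0.\<close>

lemma functional_power_Suc:
  assumes \<mu>: "finite_measure \<mu>" "sets \<mu> = sets borel" and c: "0 < c"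
    and S: "finite S" "\<And>s. s \<in> S \<Longrightarrow> 0 \<le> lm s"
  shows "expectation (\<lambda>\<omega>. joint c S lm \<omega> * functional \<mu> a n c \<omega> ^ Suc k) =
    (\<integral>s. (\<Sum>i\<le>n. a i * expectation (\<lambda>\<omega>. joint c (insert s S) (lm(s := (if s \<in> S then lm s else 0) + real i)) \<omega> * functional \<mu> a n c \<omega> ^ k)) \<partial>\<mu>)"
proof -
  interpret mu: finite_measure \<mu> by fact
  interpret P: pair_sigma_finite \<mu> M by unfold_locales
  note [measurable] = scaled_measurable_pair[OF \<mu>(2)] functional_props(1)[OF \<mu> c]
  let ?J = "joint c S lm" and ?B = "functional \<mu> a n c"
  let ?U = "\<lambda>s \<omega>. exp (- (V (c * s) \<omega> / c))"
  let ?P = "\<lambda>s \<omega>. \<Sum>i\<le>n. a i * ?U s \<omega> ^ i"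
  let ?K = "(\<Sum>i\<le>n. \<bar>a i\<bar>)"
  have J1: "\<bar>?J \<omega>\<bar> \<le> 1" for \<omega> using S(2) by (intro joint_bounded[OF c])
  have Bb: "\<bar>?B \<omega>\<bar> \<le> ?K * measure \<mu> UNIV" for \<omega> by (rule functional_props[OF \<mu> c])
  have U1: "\<bar>?U s \<omega> ^ i\<bar> \<le> 1" for s \<omega> i
    using V_nonneg[of "c * s" \<omega>] c by (auto intro!: power_le_one)
  have Pb: "\<bar>?P s \<omega>\<bar> \<le> ?K" for s \<omega>
  proof -
    have "\<bar>?P s \<omega>\<bar> \<le> (\<Sum>i\<le>n. \<bar>a i * ?U s \<omega> ^ i\<bar>)" by (rule sum_abs)
    also have "\<dots> \<le> ?K" using U1 by (intro sum_mono) (simp add: abs_mult mult_left_le)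
    finally show ?thesis .
  qed
  let ?f = "\<lambda>s \<omega>. ?J \<omega> * ?B \<omega> ^ k * ?P s \<omega>"
  have fb: "\<bar>?J \<omega> * ?B \<omega> ^ k * u\<bar> \<le> 1 * (?K * measure \<mu> UNIV) ^ k * C" if "\<bar>u\<bar> \<le> C" for \<omega> u C
    unfolding abs_mult power_abs by (intro mult_mono J1 power_mono Bb that) (auto intro!: mult_nonneg_nonneg sum_nonneg)
  have fm: "(\<lambda>p. ?f (fst p) (snd p)) \<in> borel_measurable (\<mu> \<Otimes>\<^sub>M M)"
    by measurable
  have fi: "integrable (\<mu> \<Otimes>\<^sub>M M) (case_prod ?f)"
  proof (rule finite_measure.integrable_const_bound)
    show "finite_measure (\<mu> \<Otimes>\<^sub>M M)"
      by (rule finite_measure_pair_measure) unfold_locales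
    show "AE p in \<mu> \<Otimes>\<^sub>M M. norm (case_prod ?f p) \<le> 1 * (?K * measure \<mu> UNIV) ^ k * ?K"
      by (intro AE_I2) (simp only: case_prod_beta real_norm_def, rule fb, rule Pb)
    show "case_prod ?f \<in> borel_measurable (\<mu> \<Otimes>\<^sub>M M)" using fm by (simp add: case_prod_beta)
  qed
  have "expectation (\<lambda>\<omega>. ?J \<omega> * ?B \<omega> ^ Suc k) = expectation (\<lambda>\<omega>. \<integral>s. ?f s \<omega> \<partial>\<mu>)"
  proof (rule Bochner_Integration.integral_cong[OF refl])
    fix \<omega>
    show "?J \<omega> * ?B \<omega> ^ Suc k = (\<integral>s. ?f s \<omega> \<partial>\<mu>)"
      by (simp add: functional_def)
  qed
  also have "\<dots> = (\<integral>s. expectation (?f s) \<partial>\<mu>)"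
    by (rule P.Fubini_integral[OF fi])
  also have "\<dots> = (\<integral>s. (\<Sum>i\<le>n. a i * expectation (\<lambda>\<omega>. joint c (insert s S) (lm(s := (if s \<in> S then lm s else 0) + real i)) \<omega> * ?B \<omega> ^ k)) \<partial>\<mu>)"
  proof (rule Bochner_Integration.integral_cong[OF refl])
    fix s
    have ij: "joint c (insert s S) (lm(s := (if s \<in> S then lm s else 0) + real i)) \<omega> = ?J \<omega> * ?U s \<omega> ^ i" for i \<omega>
    proof -
      have "?U s \<omega> ^ i = exp (- (real i / c * V (c * s) \<omega>))" by (simp add: exp_of_nat_mult[symmetric])
      then show ?thesis by (simp only: joint_factor[OF S(1)])
    qed
    have ii: "integrable M (\<lambda>\<omega>. ?J \<omega> * ?B \<omega> ^ k * ?U s \<omega> ^ i)" for i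
      by (rule bounded_integrable[OF _ fb[OF U1]]) measurable
    have "expectation (?f s) = expectation (\<lambda>\<omega>. \<Sum>i\<le>n. a i * (?J \<omega> * ?B \<omega> ^ k * ?U s \<omega> ^ i))"
      by (simp add: sum_distrib_left mult_ac)
    also have "\<dots> = (\<Sum>i\<le>n. a i * expectation (\<lambda>\<omega>. ?J \<omega> * ?B \<omega> ^ k * ?U s \<omega> ^ i))"
      using ii by simp
    finally show "expectation (?f s) = (\<Sum>i\<le>n. a i * expectation (\<lambda>\<omega>. joint c (insert s S) (lm(s := (if s \<in> S then lm s else 0) + real i)) \<omega> * ?B \<omega> ^ k))"
      unfolding ij by (simp add: mult_ac)
  qed
  finally show ?thesis .
qed

end

section \<open>Comparison of the rescaled process with the process started at 0\<close>

locale besq_pair = P1: besq_sol M F W Y \<delta> y + P2: besq_sol M' F' W' Y' \<delta> 0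
  for M :: "'a measure" and F W Y \<delta> y and M' :: "'b measure" and F' W' Y'
begin

text \<open>Times are removed from the largest down, each contributing a factor common to both
  processes and free of c. Time 0 is always included, so that every positive time has a predecessor;
  only there does the start enter, as y / c for one process and 0 for the other.\<close>

lemma joint_formula:
  assumes "finite S" "S \<subseteq> {0<..}" "\<And>s. s \<in> insert 0 S \<Longrightarrow> 0 \<le> lm s"
  shows "\<exists>C \<nu>. (\<forall>c>0. P1.expectation (P1.joint c (insert 0 S) lm) = C * exp (- (\<nu> * (y / c)))) \<and>
    P2.expectation (P2.joint 1 (insert 0 S) lm) = C"
  using assms
proof (induction S arbitrary: lm rule: finite_linorder_max_induct)
  case empty
  show ?case
    by (rule exI[of _ 1], rule exI[of _ "lm 0"]) (simp add: P1.joint_start P2.joint_start)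
next
  case (insert t S)
  define s where "s = Max (insert 0 S)"
  have fin: "finite (insert 0 S)" using insert.hyps by simp
  have s: "s \<in> insert 0 S" unfolding s_def by (rule Max_in[OF fin]) simp
  have sub: "insert 0 S \<subseteq> {0..s}"
    using insert.prems(1) Max_ge[OF fin] unfolding s_def by auto
  have st: "s < t" using s insert.hyps insert.prems(1) by auto
  define q where "q = 1 + 2 * lm t * (t - s)"
  define lm' where "lm' = lm(s := lm s + lm t / q)"
  have lt: "0 \<le> lm t" using insert.prems(2) by auto
  have q: "1 \<le> q" using lt st by (simp add: q_def)
  have pos: "\<And>r. r \<in> insert t (insert 0 S) \<Longrightarrow> 0 \<le> lm r" using insert.prems(2) by auto
  have "\<And>r. r \<in> insert 0 S \<Longrightarrow> 0 \<le> lm' r" using insert.prems(2) lt q by (auto simp: lm'_def)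
  then obtain C \<nu> where IH: "\<forall>c>0. P1.expectation (P1.joint c (insert 0 S) lm') = C * exp (- (\<nu> * (y / c)))"
    "P2.expectation (P2.joint 1 (insert 0 S) lm') = C"
    using insert.IH[of lm'] insert.prems(1) by auto
  have comm: "insert 0 (insert t S) = insert t (insert 0 S)" by auto
  have e1: "P1.expectation (P1.joint c (insert t (insert 0 S)) lm) = q powr (- \<delta> / 2) * P1.expectation (P1.joint c (insert 0 S) lm')" if "0 < c" for c
    using P1.joint_step[OF that fin s sub st pos] by (simp only: q_def lm'_def)
  have e2: "P2.expectation (P2.joint 1 (insert t (insert 0 S)) lm) = q powr (- \<delta> / 2) * P2.expectation (P2.joint 1 (insert 0 S) lm')"
    using P2.joint_step[OF zero_less_one fin s sub st pos] by (simp only: q_def lm'_def)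
  show ?case
    unfolding comm
    by (rule exI[of _ "q powr (- \<delta> / 2) * C"], rule exI[of _ \<nu>]) (use IH e1 e2 in \<open>simp\<close>)
qed

text \<open>Time 0, if absent, is added with parameter 0 to fit \<open>joint_formula\<close>; the
  only dependence on c, through y / c, disappears in the limit.\<close>

lemma joint_tendsto:
  assumes S: "finite S" "S \<subseteq> {0..}" "\<And>s. s \<in> S \<Longrightarrow> 0 \<le> lm s"
  shows "((\<lambda>c. P1.expectation (P1.joint c S lm)) \<longlongrightarrow> P2.expectation (P2.joint 1 S lm)) at_top"
proof -
  define lm' where "lm' s = (if s \<in> S then lm s else 0)" for s
  have eq: "(\<Sum>s\<in>S. lm s * g s) = (\<Sum>s\<in>insert 0 (S - {0}). lm' s * g s)" for g :: "real \<Rightarrow> real"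
  proof -
    have "(\<Sum>s\<in>S. lm s * g s) = (\<Sum>s\<in>S. lm' s * g s)" by (intro sum.cong) (auto simp: lm'_def)
    also have "\<dots> = (\<Sum>s\<in>insert 0 (S - {0}). lm' s * g s)"
      by (rule sum.mono_neutral_left) (use S in \<open>auto simp: lm'_def\<close>)
    finally show ?thesis .
  qed
  have j1: "P1.joint c S lm = P1.joint c (insert 0 (S - {0})) lm'" for c
    by (rule ext) (simp only: P1.joint_def eq)
  have j2: "P2.joint 1 S lm = P2.joint 1 (insert 0 (S - {0})) lm'"
    by (rule ext) (simp only: P2.joint_def eq)
  obtain C \<nu> where C: "\<forall>c>0. P1.expectation (P1.joint c (insert 0 (S - {0})) lm') = C * exp (- (\<nu> * (y / c)))"
    "P2.expectation (P2.joint 1 (insert 0 (S - {0})) lm') = C"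
    using joint_formula[of "S - {0}" lm'] S by (force simp: lm'_def)
  have "((\<lambda>c. C * exp (- (\<nu> * (y / c)))) \<longlongrightarrow> C * exp (- (\<nu> * 0))) at_top"
    by (intro tendsto_intros tendsto_divide_0[OF tendsto_const] filterlim_at_top_imp_at_infinity filterlim_ident)
  then have "((\<lambda>c. C * exp (- (\<nu> * (y / c)))) \<longlongrightarrow> C) at_top" by simp
  then have "((\<lambda>c. P1.expectation (P1.joint c (insert 0 (S - {0})) lm')) \<longlongrightarrow> C) at_top"
    by (rule Lim_transform_eventually) (use C(1) in \<open>auto intro!: eventually_mono[OF eventually_gt_at_top[of 0]]\<close>)
  then show ?thesis unfolding j1 j2 C(2) .
qed

text \<open>Induction on the power, with the set of times and the parameters general, since each
  step adds a time. Convergence for each s passes to the integral over \<mu> by dominated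
  convergence, with a bound independent of c.\<close>

lemma functional_moments_tendsto:
  assumes \<mu>: "finite_measure \<mu>" "sets \<mu> = sets borel" "AE s in \<mu>. 0 \<le> s"
  shows "finite S \<Longrightarrow> S \<subseteq> {0..} \<Longrightarrow> (\<And>s. s \<in> S \<Longrightarrow> 0 \<le> lm s) \<Longrightarrow>
    ((\<lambda>c. P1.expectation (\<lambda>\<omega>. P1.joint c S lm \<omega> * P1.functional \<mu> a n c \<omega> ^ k)) \<longlongrightarrow>
      P2.expectation (\<lambda>\<omega>. P2.joint 1 S lm \<omega> * P2.functional \<mu> a n 1 \<omega> ^ k)) at_top"
proof (induction k arbitrary: S lm)
  case 0
  then show ?case using joint_tendsto[of S lm] by simp
next
  case (Suc k)
  interpret mu: finite_measure \<mu> by fact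
  define K where "K = (\<Sum>i\<le>n. \<bar>a i\<bar>)"
  have K: "0 \<le> K" unfolding K_def by (intro sum_nonneg) auto
  define lam where "lam s i = lm(s := (if s \<in> S then lm s else 0) + real i)" for s :: real and i :: nat
  let ?E1 = "\<lambda>c s i. P1.expectation (\<lambda>\<omega>. P1.joint c (insert s S) (lam s i) \<omega> * P1.functional \<mu> a n c \<omega> ^ k)"
  let ?E2 = "\<lambda>s i. P2.expectation (\<lambda>\<omega>. P2.joint 1 (insert s S) (lam s i) \<omega> * P2.functional \<mu> a n 1 \<omega> ^ k)"
  let ?w = "\<Sum>i\<le>n. \<bar>a i\<bar> * (K * measure \<mu> UNIV) ^ k"
  have lamS: "0 \<le> lam s i r" if "r \<in> insert s S" for s i r
    using that Suc.prems(3) by (auto simp: lam_def)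
  \<comment> \<open>Measurability in s is demanded for every real c but is available for c > 0; the
    value 0 fills in for the others.\<close>
  have lim: "((\<lambda>c. \<integral>s. (if 0 < c then \<Sum>i\<le>n. a i * ?E1 c s i else 0) \<partial>\<mu>) \<longlongrightarrow> (\<integral>s. (\<Sum>i\<le>n. a i * ?E2 s i) \<partial>\<mu>)) at_top"
  proof (rule integral_dominated_convergence_at_top[where w = "\<lambda>_. ?w"])
    show "integrable \<mu> (\<lambda>_. ?w)" by simp
    show "AE s in \<mu>. ((\<lambda>c. if 0 < c then \<Sum>i\<le>n. a i * ?E1 c s i else 0) \<longlongrightarrow> (\<Sum>i\<le>n. a i * ?E2 s i)) at_top"
      using \<mu>(3)
    proof eventually_elim
      case (elim s)
      have "((\<lambda>c. \<Sum>i\<le>n. a i * ?E1 c s i) \<longlongrightarrow> (\<Sum>i\<le>n. a i * ?E2 s i)) at_top"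
        by (intro tendsto_sum tendsto_mult_left Suc.IH) (use Suc.prems elim lamS in auto)
      then show ?case
        by (rule Lim_transform_eventually) (auto intro!: eventually_mono[OF eventually_gt_at_top[of 0]])
    qed
    have bnd: "\<bar>?E1 c s i\<bar> \<le> (K * measure \<mu> UNIV) ^ k" if "0 < c" for c s i
    proof -
      have "\<bar>?E1 c s i\<bar> \<le> P1.expectation (\<lambda>\<omega>. \<bar>P1.joint c (insert s S) (lam s i) \<omega> * P1.functional \<mu> a n c \<omega> ^ k\<bar>)"
        by (rule integral_abs_bound)
      also have "\<dots> \<le> P1.expectation (\<lambda>\<omega>. (K * measure \<mu> UNIV) ^ k)"
      proof (rule integral_mono')
        fix \<omega>
        have "\<bar>P1.joint c (insert s S) (lam s i) \<omega>\<bar> * \<bar>P1.functional \<mu> a n c \<omega>\<bar> ^ k \<le> 1 * (K * measure \<mu> UNIV) ^ k"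
          unfolding K_def
          by (intro mult_mono power_mono P1.joint_bounded P1.functional_props that \<mu> lamS) auto
        then show "\<bar>P1.joint c (insert s S) (lam s i) \<omega> * P1.functional \<mu> a n c \<omega> ^ k\<bar> \<le> (K * measure \<mu> UNIV) ^ k"
          by (simp add: abs_mult power_abs)
      qed (use K in auto)
      finally show ?thesis by (simp add: P1.prob_space)
    qed
    show "\<forall>\<^sub>F c in at_top. AE s in \<mu>. norm (if 0 < c then \<Sum>i\<le>n. a i * ?E1 c s i else 0) \<le> ?w"
    proof (rule always_eventually, intro allI AE_I2)
      fix c s
      have "\<bar>\<Sum>i\<le>n. a i * ?E1 c s i\<bar> \<le> ?w" if "0 < c"
      proof -
        have "\<bar>\<Sum>i\<le>n. a i * ?E1 c s i\<bar> \<le> (\<Sum>i\<le>n. \<bar>a i * ?E1 c s i\<bar>)" by (rule sum_abs)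
        also have "\<dots> \<le> ?w" unfolding abs_mult by (intro sum_mono mult_left_mono bnd that) auto
        finally show ?thesis .
      qed
      moreover have "0 \<le> ?w" using K by (intro sum_nonneg) auto
      ultimately show "norm (if 0 < c then \<Sum>i\<le>n. a i * ?E1 c s i else 0) \<le> ?w" by simp
    qed
    have jm1: "(\<lambda>p. P1.joint c (insert (fst p) S) (lam (fst p) i) (snd p)) \<in> borel_measurable (\<mu> \<Otimes>\<^sub>M M)" if "0 < c" for c i
    proof -
      note [measurable] = P1.scaled_measurable_pair[OF \<mu>(2)]
      have "P1.joint c (insert s S) (lam s i) \<omega> = P1.joint c S lm \<omega> * exp (- (real i / c * P1.V (c * s) \<omega>))" for s \<omega>
        using P1.joint_factor[OF Suc.prems(1)] unfolding lam_def .
      then show ?thesis by (simp only:) measurable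
    qed
    have jm2: "(\<lambda>p. P2.joint 1 (insert (fst p) S) (lam (fst p) i) (snd p)) \<in> borel_measurable (\<mu> \<Otimes>\<^sub>M M')" for i
    proof -
      note [measurable] = P2.scaled_measurable_pair[OF \<mu>(2)]
      have "P2.joint 1 (insert s S) (lam s i) \<omega> = P2.joint 1 S lm \<omega> * exp (- (real i / 1 * P2.V (1 * s) \<omega>))" for s \<omega>
        using P2.joint_factor[OF Suc.prems(1)] unfolding lam_def .
      then show ?thesis by (simp only:) measurable
    qed
    show "(\<lambda>s. if 0 < c then \<Sum>i\<le>n. a i * ?E1 c s i else 0) \<in> borel_measurable \<mu>" for c
    proof (cases "0 < c")
      case True
      note [measurable] = jm1[OF True] P1.functional_props(1)[OF \<mu>(1,2) True]
      have "(\<lambda>s. ?E1 c s i) \<in> borel_measurable \<mu>" for i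
        by (rule P1.borel_measurable_lebesgue_integral) (simp add: case_prod_beta)
      then show ?thesis using True by simp
    qed simp
    show "(\<lambda>s. \<Sum>i\<le>n. a i * ?E2 s i) \<in> borel_measurable \<mu>"
    proof -
      note [measurable] = jm2 P2.functional_props(1)[OF \<mu>(1,2) zero_less_one]
      have "(\<lambda>s. ?E2 s i) \<in> borel_measurable \<mu>" for i
        by (rule P2.borel_measurable_lebesgue_integral) (simp add: case_prod_beta)
      then show ?thesis by simp
    qed
  qed
  have e2: "(\<integral>s. (\<Sum>i\<le>n. a i * ?E2 s i) \<partial>\<mu>) = P2.expectation (\<lambda>\<omega>. P2.joint 1 S lm \<omega> * P2.functional \<mu> a n 1 \<omega> ^ Suc k)"
    using P2.functional_power_Suc[OF \<mu>(1,2) zero_less_one Suc.prems(1,3)] unfolding lam_def by simp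
  have e1: "(\<integral>s. (if 0 < c then \<Sum>i\<le>n. a i * ?E1 c s i else 0) \<partial>\<mu>) = P1.expectation (\<lambda>\<omega>. P1.joint c S lm \<omega> * P1.functional \<mu> a n c \<omega> ^ Suc k)" if "0 < c" for c
    using P1.functional_power_Suc[OF \<mu>(1,2) that Suc.prems(1,3)] that unfolding lam_def by simp
  show ?case
    using lim unfolding e2
    by (rule Lim_transform_eventually) (rule eventually_mono[OF eventually_gt_at_top[of 0] e1])
qed

end

section \<open>Approximation in mean and weak convergence\<close>

lemma cts_step_lipschitz:
  assumes "a < b"
  shows "\<bar>cts_step a b x - cts_step a b x'\<bar> \<le> 1 / (b - a) * \<bar>x - x'\<bar>"
proof -
  have eq: "cts_step a b x = max 0 (min 1 ((b - x) / (b - a)))" for x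
  proof -
    consider "x \<le> a" | "a < x" "x < b" | "b \<le> x" by linarith
    then show ?thesis
    proof cases
      case 1
      then have "1 \<le> (b - x) / (b - a)" using assms by (simp add: field_simps)
      then show ?thesis using 1 by (simp add: cts_step_def)
    next
      case 2
      then have "0 \<le> (b - x) / (b - a)" "(b - x) / (b - a) \<le> 1" using assms by (auto simp: field_simps)
      then show ?thesis using 2 by (simp add: cts_step_def)
    next
      case 3
      then have "(b - x) / (b - a) \<le> 0" using assms by (simp add: divide_nonpos_pos)
      then show ?thesis using 3 assms by (simp add: cts_step_def)
    qed
  qed
  have "\<bar>max 0 (min 1 u) - max 0 (min 1 v)\<bar> \<le> \<bar>u - v\<bar>" for u v :: real
    by (simp add: max_def min_def)
  then have "\<bar>cts_step a b x - cts_step a b x'\<bar> \<le> \<bar>(b - x) / (b - a) - (b - x') / (b - a)\<bar>"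
    unfolding eq .
  also have "(b - x) / (b - a) - (b - x') / (b - a) = (x' - x) / (b - a)" by (simp add: diff_divide_distrib)
  also have "\<bar>(x' - x) / (b - a)\<bar> = 1 / (b - a) * \<bar>x - x'\<bar>" using assms by (simp add: abs_minus_commute)
  finally show ?thesis .
qed

text \<open>With u = exp (- v) the half line becomes (0,1], and truncation of v at R becomes
  \<open>max u (exp (- R))\<close>. The truncation makes the function continuous up to u = 0, so
  Weierstrass applies on [0,1].\<close>

lemma truncated_power_approx:
  assumes "0 < \<zeta>" "0 < R" "0 \<le> \<alpha>"
  shows "\<exists>a n. \<forall>v\<ge>0. \<bar>rpow0 (min v R) \<alpha> - (\<Sum>i\<le>n. a i * exp (- v) ^ i)\<bar> \<le> \<zeta>"
proof -
  define h where "h u = rpow0 (- ln (max u (exp (- R)))) \<alpha>" for u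
  have "continuous_on {0..1} h"
  proof (cases "\<alpha> = 0")
    case False
    have "continuous_on {0..1} (\<lambda>u. (- ln (max u (exp (- R)))) powr \<alpha>)"
    proof (rule continuous_on_powr')
      show "continuous_on {0..1} (\<lambda>u. - ln (max u (exp (- R))))"
      proof (intro continuous_intros ballI)
        fix u :: real
        have "0 < exp (- R)" by simp
        then show "max u (exp (- R)) \<noteq> 0" by linarith
      qed
      show "\<forall>u\<in>{0..1}. 0 \<le> - ln (max u (exp (- R))) \<and> (- ln (max u (exp (- R))) = 0 \<longrightarrow> 0 < \<alpha>)"
      proof
        fix u :: real assume u: "u \<in> {0..1}"
        have "0 < exp (- R)" "exp (- R) \<le> 1" using assms by auto
        then have "0 < max u (exp (- R))" "max u (exp (- R)) \<le> 1" using u by (auto simp: less_max_iff_disj)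
        then have "ln (max u (exp (- R))) \<le> 0" by simp
        then show "0 \<le> - ln (max u (exp (- R))) \<and> (- ln (max u (exp (- R))) = 0 \<longrightarrow> 0 < \<alpha>)"
          using assms False by simp
      qed
    qed auto
    then show ?thesis using False by (simp add: h_def[abs_def] rpow0_def)
  qed (simp add: h_def[abs_def] rpow0_def)
  then obtain g where g: "real_polynomial_function g" "\<And>u. u \<in> {0..1} \<Longrightarrow> \<bar>h u - g u\<bar> < \<zeta>"
    using Stone_Weierstrass_real_polynomial_function[of "{0..1::real}" h \<zeta>] assms by auto
  obtain a n where an: "g = (\<lambda>u. \<Sum>i\<le>n. a i * u ^ i)" using g(1) unfolding real_polynomial_function_iff_sum by blast
  show ?thesis
  proof (intro exI allI impI)
    fix v :: real assume v: "0 \<le> v"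
    have "max (exp (- v)) (exp (- R)) = exp (- (min v R))" by (simp add: max_def min_def)
    then have "h (exp (- v)) = rpow0 (min v R) \<alpha>" by (simp add: h_def)
    then show "\<bar>rpow0 (min v R) \<alpha> - (\<Sum>i\<le>n. a i * exp (- v) ^ i)\<bar> \<le> \<zeta>"
      using g(2)[of "exp (- v)"] v by (simp add: an)
  qed
qed

text \<open>Beyond R a factor v / R \<ge> 1 may be inserted: truncation costs one more moment and
  gains 1 / R.\<close>

lemma rpow0_truncation:
  assumes "0 \<le> v" "0 < R" "0 \<le> \<alpha>"
  shows "\<bar>rpow0 v \<alpha> - rpow0 (min v R) \<alpha>\<bar> \<le> 1 / R * rpow0 v (\<alpha> + 1)"
proof (cases "v \<le> R")
  case False
  then have v: "R < v" "0 < v" using assms by auto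
  have "rpow0 (min v R) \<alpha> \<le> rpow0 v \<alpha>" using v assms by (auto simp: rpow0_def intro!: powr_mono2)
  then have "\<bar>rpow0 v \<alpha> - rpow0 (min v R) \<alpha>\<bar> \<le> rpow0 v \<alpha>" using rpow0_nonneg[of "min v R" \<alpha>] by simp
  also have "\<dots> = v powr \<alpha>" using v by (simp add: rpow0_def)
  also have "\<dots> \<le> v powr \<alpha> * (v / R)"
    using v assms mult_left_mono[of 1 "v / R" "v powr \<alpha>"] by simp
  also have "\<dots> = 1 / R * rpow0 v (\<alpha> + 1)" using v assms by (simp add: rpow0_def powr_add)
  finally show ?thesis .
qed (use assms in \<open>simp add: rpow0_nonneg\<close>)

context besq_sol
begin

text \<open>The factor c^a of the moment bound cancels against the division by c, so the estimate is
  uniform in c.\<close>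

lemma weighted_moment_scaled:
  assumes c: "0 < c" and a: "0 \<le> a" and w: "w \<in> borel_measurable borel" "\<And>s. 0 \<le> w s" "\<And>s. w s \<noteq> 0 \<Longrightarrow> 0 < s \<and> y \<le> y * (c * s)"
  shows "(\<integral>\<^sup>+ \<omega>. \<integral>\<^sup>+ s. ennreal (w s * rpow0 (V (c * s) \<omega> / c) a) \<partial>lborel \<partial>M)
    \<le> (\<integral>\<^sup>+ s. ennreal (moment_const a * (w s * s powr a)) \<partial>lborel)"
proof -
  interpret pair_sigma_finite lborel M by unfold_locales
  note [measurable] = w(1)
  have lb: "sets lborel = sets (borel :: real measure)" by simp
  note [measurable] = scaled_measurable_pair[OF lb]
  have "(\<integral>\<^sup>+ \<omega>. \<integral>\<^sup>+ s. ennreal (w s * rpow0 (V (c * s) \<omega> / c) a) \<partial>lborel \<partial>M) = (\<integral>\<^sup>+ s. \<integral>\<^sup>+ \<omega>. ennreal (w s * rpow0 (V (c * s) \<omega> / c) a) \<partial>M \<partial>lborel)"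
    by (rule Fubini') (simp add: case_prod_beta)
  also have "\<dots> \<le> (\<integral>\<^sup>+ s. ennreal (moment_const a * (w s * s powr a)) \<partial>lborel)"
  proof (rule nn_integral_mono)
    fix s :: real
    show "(\<integral>\<^sup>+ \<omega>. ennreal (w s * rpow0 (V (c * s) \<omega> / c) a) \<partial>M) \<le> ennreal (moment_const a * (w s * s powr a))"
    proof (cases "w s = 0")
      case False
      then have s: "0 < s" "y \<le> y * (c * s)" using w(3) by auto
      define k where "k = w s * (1 / c) powr a"
      have k: "0 \<le> k" using w(2) by (simp add: k_def)
      have "w s * rpow0 (V (c * s) \<omega> / c) a = k * rpow0 (V (c * s) \<omega>) a" for \<omega>
        using rpow0_mult[OF V_nonneg, of "1 / c" "c * s" \<omega> a] c by (simp add: k_def)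
      then have "(\<integral>\<^sup>+ \<omega>. ennreal (w s * rpow0 (V (c * s) \<omega> / c) a) \<partial>M) = ennreal k * (\<integral>\<^sup>+ \<omega>. ennreal (rpow0 (V (c * s) \<omega>) a) \<partial>M)"
        using k by (simp add: ennreal_mult' nn_integral_cmult)
      also have "\<dots> \<le> ennreal k * ennreal (moment_const a * (c * s) powr a)"
        using c s by (intro mult_left_mono V_rpow0_moment a) auto
      also have "\<dots> = ennreal (k * (moment_const a * (c * s) powr a))"
        using k moment_const_nonneg[of a] by (simp add: ennreal_mult')
      also have "k * (moment_const a * (c * s) powr a) = moment_const a * (w s * (((1 / c) powr a) * (c * s) powr a))"
        by (simp add: k_def mult_ac)
      also have "((1 / c) powr a) * (c * s) powr a = s powr a"
        using c s by (simp add: powr_mult[symmetric])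
      finally show ?thesis .
    qed simp
  qed
  finally show ?thesis .
qed

text \<open>The lower limit b is separate from c to cover both cases: b = 1 / c gives the normalised
  A at time c, while c = 1 and b = 0 give the limit variable.\<close>

definition scaled_A :: "real \<Rightarrow> real \<Rightarrow> real \<Rightarrow> real \<Rightarrow> 'a \<Rightarrow> real" where
  "scaled_A \<alpha> \<gamma> c b \<omega> = (LINT s:{b..1}|lborel. s powr \<gamma> * rpow0 (V (c * s) \<omega> / c) \<alpha>)"

lemma scaled_A_measurable [measurable]: "scaled_A \<alpha> \<gamma> c b \<in> borel_measurable M"
proof -
  have lb: "sets lborel = sets (borel :: real measure)" by simp
  note [measurable] = scaled_measurable_pair[OF lb]
  show ?thesis unfolding scaled_A_def set_lebesgue_integral_def by measurable
qed

lemma A_scaling: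
  assumes c: "0 < c"
  shows "A \<alpha> \<gamma> c \<omega> / c powr (1 + \<gamma> + \<alpha>) = scaled_A \<alpha> \<gamma> c (1 / c) \<omega>"
proof -
  let ?f = "\<lambda>s. indicator {1..c} s * (s powr \<gamma> * rpow0 (V s \<omega>) \<alpha>)"
  have "A \<alpha> \<gamma> c \<omega> = \<bar>c\<bar> *\<^sub>R (\<integral>s. ?f (0 + c * s) \<partial>lborel)"
    unfolding A_def set_lebesgue_integral_def
    using lborel_integral_real_affine[of c ?f 0] c by simp
  also have "\<dots> = c * (\<integral>s. c powr (\<gamma> + \<alpha>) * (indicator {1 / c..1} s * (s powr \<gamma> * rpow0 (V (c * s) \<omega> / c) \<alpha>)) \<partial>lborel)"
  proof -
    have "?f (0 + c * s) = c powr (\<gamma> + \<alpha>) * (indicator {1 / c..1} s * (s powr \<gamma> * rpow0 (V (c * s) \<omega> / c) \<alpha>))" for s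
    proof (cases "s \<in> {1 / c..1}")
      case True
      have s: "0 < s" using True c by (auto intro: less_le_trans[of 0 "1 / c"])
      have "indicator {1..c} (c * s) = (1::real)" using True c by (auto simp: indicator_def field_simps)
      moreover have "(c * s) powr \<gamma> = c powr \<gamma> * s powr \<gamma>" using s c by (simp add: powr_mult)
      moreover have "rpow0 (V (c * s) \<omega>) \<alpha> = c powr \<alpha> * rpow0 (V (c * s) \<omega> / c) \<alpha>"
        using rpow0_mult[of "V (c * s) \<omega> / c" c \<alpha>] V_nonneg[of "c * s" \<omega>] c by simp
      ultimately show ?thesis using True by (simp add: powr_add)
    next
      case False
      then have "indicator {1..c} (c * s) = (0::real)" using c by (auto simp: indicator_def field_simps)
      then show ?thesis using False by simp
    qed
    then show ?thesis using c by simp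
  qed
  also have "\<dots> = c powr (1 + \<gamma> + \<alpha>) * scaled_A \<alpha> \<gamma> c (1 / c) \<omega>"
    using powr_add[of c 1 "\<gamma> + \<alpha>"] c by (simp add: scaled_A_def set_lebesgue_integral_def add.assoc)
  finally show ?thesis using c by simp
qed

definition weight :: "real \<Rightarrow> real \<Rightarrow> real measure" where
  "weight \<epsilon> \<gamma> = density lborel (\<lambda>s. ennreal (indicator {\<epsilon>..1} s * s powr \<gamma>))"

text \<open>The sum 1 + \<epsilon>^\<gamma> covers both signs of \<gamma>.\<close>

lemma weight_bound:
  fixes s :: real
  assumes "0 < \<epsilon>"
  shows "indicator {\<epsilon>..1} s * s powr \<gamma> \<le> (1 + \<epsilon> powr \<gamma>) * indicator {\<epsilon>..1} s"
proof (cases "s \<in> {\<epsilon>..1}")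
  case True
  have "s powr \<gamma> \<le> 1 + \<epsilon> powr \<gamma>"
  proof (cases "0 \<le> \<gamma>")
    case t: True
    have "s powr \<gamma> \<le> 1" using True assms t by (intro powr_le1) auto
    then show ?thesis by (simp add: add_increasing2)
  next
    case False
    have "s powr \<gamma> \<le> \<epsilon> powr \<gamma>" using True assms False by (intro powr_mono2') auto
    then show ?thesis by simp
  qed
  then show ?thesis using True by simp
qed simp

lemma weight_props:
  assumes \<epsilon>: "0 < \<epsilon>" "\<epsilon> \<le> 1"
  shows "finite_measure (weight \<epsilon> \<gamma>)" "sets (weight \<epsilon> \<gamma>) = sets borel" "AE s in weight \<epsilon> \<gamma>. 0 \<le> s"
    and "(\<integral>\<^sup>+ s. ennreal (indicator {\<epsilon>..1} s * s powr \<gamma>) \<partial>lborel) \<le> ennreal (1 + \<epsilon> powr \<gamma>)"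
proof -
  show s: "sets (weight \<epsilon> \<gamma>) = sets borel" by (simp add: weight_def)
  have "(\<integral>\<^sup>+ s. ennreal (indicator {\<epsilon>..1} s * s powr \<gamma>) \<partial>lborel) \<le> (\<integral>\<^sup>+ s. ennreal (1 + \<epsilon> powr \<gamma>) * indicator {\<epsilon>..1} s \<partial>lborel)"
  proof (rule nn_integral_mono)
    fix s :: real
    show "ennreal (indicator {\<epsilon>..1} s * s powr \<gamma>) \<le> ennreal (1 + \<epsilon> powr \<gamma>) * indicator {\<epsilon>..1} s"
      using ennreal_leI[OF weight_bound[OF \<epsilon>(1), of s \<gamma>]] by (cases "s \<in> {\<epsilon>..1}") (auto simp del: ennreal_plus)
  qed
  also have "\<dots> = ennreal (1 + \<epsilon> powr \<gamma>) * ennreal (1 - \<epsilon>)" using \<epsilon> by (simp add: nn_integral_cmult_indicator)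
  also have "\<dots> = ennreal ((1 + \<epsilon> powr \<gamma>) * (1 - \<epsilon>))" using \<epsilon> by (simp add: ennreal_mult')
  also have "\<dots> \<le> ennreal (1 + \<epsilon> powr \<gamma>)"
    by (rule ennreal_leI) (use \<epsilon> in \<open>simp add: mult_left_le\<close>)
  finally show b: "(\<integral>\<^sup>+ s. ennreal (indicator {\<epsilon>..1} s * s powr \<gamma>) \<partial>lborel) \<le> ennreal (1 + \<epsilon> powr \<gamma>)" .
  show "finite_measure (weight \<epsilon> \<gamma>)"
  proof
    have "emeasure (weight \<epsilon> \<gamma>) (space (weight \<epsilon> \<gamma>)) = (\<integral>\<^sup>+ s. ennreal (indicator {\<epsilon>..1} s * s powr \<gamma>) \<partial>lborel)"
      unfolding weight_def by (subst emeasure_density) auto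
    then show "emeasure (weight \<epsilon> \<gamma>) (space (weight \<epsilon> \<gamma>)) \<noteq> \<infinity>" using b by (auto simp: top_unique)
  qed
  show "AE s in weight \<epsilon> \<gamma>. 0 \<le> s"
    unfolding weight_def by (subst AE_density) (use \<epsilon> in \<open>auto simp: indicator_def\<close>)
qed

text \<open>The three terms stem from the times below \<epsilon>, from truncation at R, and from the
  polynomial approximation; since \<gamma> + \<alpha> > 0, the mean integrands are bounded on (0,1]
  uniformly in c. The condition on b holds for b = 1 / c because c s \<ge> 1, and for b = 0 when y =
  0.\<close>

lemma approx_error:
  assumes c: "0 < c" and \<alpha>: "0 \<le> \<alpha>" and \<gamma>: "- \<alpha> < \<gamma>"
    and \<epsilon>: "0 < \<epsilon>" "\<epsilon> \<le> 1" and b: "0 \<le> b" "b \<le> \<epsilon>" "\<And>s. b \<le> s \<Longrightarrow> 0 < s \<Longrightarrow> y \<le> y * (c * s)"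
    and R: "0 < R" and \<zeta>: "0 \<le> \<zeta>"
    and approx: "\<And>v. 0 \<le> v \<Longrightarrow> \<bar>rpow0 (min v R) \<alpha> - (\<Sum>i\<le>n. a i * exp (- v) ^ i)\<bar> \<le> \<zeta>"
  shows "(\<integral>\<^sup>+ \<omega>. ennreal \<bar>scaled_A \<alpha> \<gamma> c b \<omega> - functional (weight \<epsilon> \<gamma>) a n c \<omega>\<bar> \<partial>M)
    \<le> ennreal (moment_const \<alpha> * \<epsilon> + moment_const (\<alpha> + 1) / R + \<zeta> * (1 + \<epsilon> powr \<gamma>))"
proof -
  have lb: "sets lborel = sets (borel :: real measure)" by simp
  note [measurable] = scaled_measurable_pair[OF lb]
  let ?v = "\<lambda>s \<omega>. V (c * s) \<omega> / c"
  have v0: "0 \<le> ?v s \<omega>" for s \<omega> using V_nonneg[of "c * s" \<omega>] c by simp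
  let ?p = "\<lambda>s \<omega>. \<Sum>i\<le>n. a i * exp (- ?v s \<omega>) ^ i"
  \<comment> \<open>Time 0 is left out because the moment bound asks for s > 0; the integrand
    vanishes there, as 0 powr \<gamma> = 0.\<close>
  define w1 where "w1 s = indicator ({b..<\<epsilon>} \<inter> {0<..}) s * s powr \<gamma>" for s :: real
  define w2 where "w2 s = indicator {\<epsilon>..1} s * s powr \<gamma>" for s :: real
  define w3 where "w3 s = 1 / R * w2 s" for s
  have wm [measurable]: "w1 \<in> borel_measurable borel" "w2 \<in> borel_measurable borel" "w3 \<in> borel_measurable borel"
    unfolding w1_def w3_def w2_def by measurable
  have w0: "0 \<le> w1 s" "0 \<le> w2 s" "0 \<le> w3 s" for s using R by (auto simp: w1_def w2_def w3_def)
  have path: "ennreal \<bar>scaled_A \<alpha> \<gamma> c b \<omega> - functional (weight \<epsilon> \<gamma>) a n c \<omega>\<bar> \<le>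
    (\<integral>\<^sup>+ s. ennreal (w1 s * rpow0 (?v s \<omega>) \<alpha>) + ennreal (w3 s * rpow0 (?v s \<omega>) (\<alpha> + 1)) + ennreal (\<zeta> * w2 s) \<partial>lborel)"
    (is "_ \<le> ?I") if \<omega>: "\<omega> \<in> space M" for \<omega>
  proof (cases "?I = \<infinity>")
    \<comment> \<open>An infinite dominating integral leaves nothing to show. A finite one supplies
      the integrability of the path, which is not known beforehand near time 0.\<close>
    case False
    have vm [measurable]: "(\<lambda>s. V (c * s) \<omega>) \<in> borel_measurable borel"
      using measurable_compose[OF _ V_measurable_path[OF \<omega>], of "\<lambda>s. c * s" borel] by simp
    define D where "D s = w1 s * rpow0 (?v s \<omega>) \<alpha> + w3 s * rpow0 (?v s \<omega>) (\<alpha> + 1) + \<zeta> * w2 s" for s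
    have D0: "0 \<le> D s" for s using w0 \<zeta> by (auto simp: D_def rpow0_nonneg intro!: add_nonneg_nonneg mult_nonneg_nonneg)
    have Dm [measurable]: "D \<in> borel_measurable borel" unfolding D_def by measurable
    have DI: "?I = (\<integral>\<^sup>+ s. ennreal (D s) \<partial>lborel)"
      using w0 \<zeta> by (intro nn_integral_cong) (simp add: D_def rpow0_nonneg ennreal_plus[symmetric] del: ennreal_plus)
    have Di: "integrable lborel D"
      by (rule integrableI_nonneg) (use D0 False DI in \<open>auto simp: less_top\<close>)
    define f1 where "f1 s = indicator {b..1} s * (s powr \<gamma> * rpow0 (?v s \<omega>) \<alpha>)" for s
    define f2 where "f2 s = w2 s * ?p s \<omega>" for s
    have fm [measurable]: "f1 \<in> borel_measurable borel" "f2 \<in> borel_measurable borel" unfolding f1_def f2_def by measurable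
    have fD: "\<bar>f1 s - f2 s\<bar> \<le> D s" for s
    proof (cases "s \<in> {\<epsilon>..1}")
      case True
      have "f1 s - f2 s = w2 s * (rpow0 (?v s \<omega>) \<alpha> - ?p s \<omega>)"
        using True b by (simp add: f1_def f2_def w2_def algebra_simps)
      then have "\<bar>f1 s - f2 s\<bar> = w2 s * \<bar>rpow0 (?v s \<omega>) \<alpha> - ?p s \<omega>\<bar>" using w0 by (simp add: abs_mult)
      also have "\<dots> \<le> w2 s * (1 / R * rpow0 (?v s \<omega>) (\<alpha> + 1) + \<zeta>)"
      proof (rule mult_left_mono)
        show "\<bar>rpow0 (?v s \<omega>) \<alpha> - ?p s \<omega>\<bar> \<le> 1 / R * rpow0 (?v s \<omega>) (\<alpha> + 1) + \<zeta>"
          using approx[OF v0[of s \<omega>]] rpow0_truncation[OF v0[of s \<omega>] R \<alpha>] by linarith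
      qed (rule w0)
      also have "\<dots> = D s" using True by (simp add: D_def w3_def w1_def algebra_simps)
      finally show ?thesis .
    next
      case False
      then have "f2 s = 0" by (simp add: f2_def w2_def)
      moreover have "\<bar>f1 s\<bar> \<le> w1 s * rpow0 (?v s \<omega>) \<alpha>"
        using False b by (cases "s = 0") (auto simp: f1_def w1_def indicator_def rpow0_nonneg abs_mult)
      moreover have "w1 s * rpow0 (?v s \<omega>) \<alpha> \<le> D s"
        using w0 \<zeta> by (simp add: D_def rpow0_nonneg)
      ultimately show ?thesis by simp
    qed
    have di: "integrable lborel (\<lambda>s. f1 s - f2 s)"
      by (rule Bochner_Integration.integrable_bound[OF Di]) (use fD D0 in auto)
    have w2i: "integrable lborel w2"
    proof (rule integrableI_nonneg)
      have "(\<integral>\<^sup>+ s. ennreal (w2 s) \<partial>lborel) \<le> ennreal (1 + \<epsilon> powr \<gamma>)"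
        unfolding w2_def by (rule weight_props(4)[OF \<epsilon>])
      then show "(\<integral>\<^sup>+ s. ennreal (w2 s) \<partial>lborel) < \<infinity>" using le_less_trans ennreal_less_top by fastforce
    qed (use w0 in auto)
    have f2i: "integrable lborel f2"
    proof (rule Bochner_Integration.integrable_bound)
      show "integrable lborel (\<lambda>s. (\<Sum>i\<le>n. \<bar>a i\<bar>) * w2 s)" using w2i by simp
      show "AE s in lborel. norm (f2 s) \<le> norm ((\<Sum>i\<le>n. \<bar>a i\<bar>) * w2 s)"
      proof (rule AE_I2)
        fix s
        have "\<bar>?p s \<omega>\<bar> \<le> (\<Sum>i\<le>n. \<bar>a i * exp (- ?v s \<omega>) ^ i\<bar>)" by (rule sum_abs)
        also have "\<dots> \<le> (\<Sum>i\<le>n. \<bar>a i\<bar>)"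
        proof (rule sum_mono)
          fix i
          have "exp (- ?v s \<omega>) ^ i \<le> 1" using v0[of s \<omega>] by (intro power_le_one) auto
          then show "\<bar>a i * exp (- ?v s \<omega>) ^ i\<bar> \<le> \<bar>a i\<bar>" by (simp add: abs_mult mult_left_le)
        qed
        finally have "w2 s * \<bar>?p s \<omega>\<bar> \<le> w2 s * (\<Sum>i\<le>n. \<bar>a i\<bar>)" by (rule mult_left_mono) (rule w0)
        then show "norm (f2 s) \<le> norm ((\<Sum>i\<le>n. \<bar>a i\<bar>) * w2 s)"
          using w0[of s] by (simp add: f2_def abs_mult mult.commute sum_nonneg)
      qed
    qed measurable
    have f1i: "integrable lborel f1"
      using Bochner_Integration.integrable_add[OF di f2i] by simp
    have e1: "scaled_A \<alpha> \<gamma> c b \<omega> = integral\<^sup>L lborel f1"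
      unfolding scaled_A_def set_lebesgue_integral_def
      by (intro Bochner_Integration.integral_cong) (simp_all add: f1_def)
    have e2: "functional (weight \<epsilon> \<gamma>) a n c \<omega> = integral\<^sup>L lborel f2"
      unfolding functional_def weight_def f2_def w2_def
      by (subst integral_real_density) auto
    have "\<bar>scaled_A \<alpha> \<gamma> c b \<omega> - functional (weight \<epsilon> \<gamma>) a n c \<omega>\<bar> = \<bar>integral\<^sup>L lborel (\<lambda>s. f1 s - f2 s)\<bar>"
      unfolding e1 e2 using f1i f2i by simp
    also have "\<dots> \<le> integral\<^sup>L lborel (\<lambda>s. \<bar>f1 s - f2 s\<bar>)" by (rule integral_abs_bound)
    also have "\<dots> \<le> integral\<^sup>L lborel D" by (rule integral_mono[OF integrable_abs[OF di] Di fD])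
    finally have "ennreal \<bar>scaled_A \<alpha> \<gamma> c b \<omega> - functional (weight \<epsilon> \<gamma>) a n c \<omega>\<bar> \<le> ennreal (integral\<^sup>L lborel D)"
      by (rule ennreal_leI)
    also have "\<dots> \<le> (\<integral>\<^sup>+ s. ennreal (D s) \<partial>lborel)" by (rule ennreal_integral_le[OF D0])
    finally show ?thesis unfolding DI .
  qed simp
  have m1: "(\<integral>\<^sup>+ \<omega>. \<integral>\<^sup>+ s. ennreal (w1 s * rpow0 (?v s \<omega>) \<alpha>) \<partial>lborel \<partial>M) \<le> ennreal (moment_const \<alpha> * \<epsilon>)"
  proof -
    have "(\<integral>\<^sup>+ \<omega>. \<integral>\<^sup>+ s. ennreal (w1 s * rpow0 (?v s \<omega>) \<alpha>) \<partial>lborel \<partial>M) \<le> (\<integral>\<^sup>+ s. ennreal (moment_const \<alpha> * (w1 s * s powr \<alpha>)) \<partial>lborel)"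
      by (rule weighted_moment_scaled[OF c \<alpha> wm(1) w0(1)]) (use b(3) in \<open>auto simp: w1_def indicator_def split: if_splits\<close>)
    also have "\<dots> \<le> (\<integral>\<^sup>+ s. ennreal (moment_const \<alpha>) * indicator {0..\<epsilon>} s \<partial>lborel)"
    proof (rule nn_integral_mono)
      fix s :: real
      have "w1 s * s powr \<alpha> \<le> indicator {0..\<epsilon>} s"
      proof (cases "s \<in> {b..<\<epsilon>} \<inter> {0<..}")
        case True
        have "s powr (\<gamma> + \<alpha>) \<le> 1" using True \<epsilon> \<gamma> by (intro powr_le1) auto
        then show ?thesis using True by (simp add: w1_def powr_add)
      qed (simp add: w1_def)
      then have "moment_const \<alpha> * (w1 s * s powr \<alpha>) \<le> moment_const \<alpha> * indicator {0..\<epsilon>} s"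
        by (rule mult_left_mono) (rule moment_const_nonneg)
      then show "ennreal (moment_const \<alpha> * (w1 s * s powr \<alpha>)) \<le> ennreal (moment_const \<alpha>) * indicator {0..\<epsilon>} s"
        by (cases "s \<in> {0..\<epsilon>}") (auto intro: ennreal_leI simp: ennreal_neg)
    qed
    also have "\<dots> = ennreal (moment_const \<alpha> * \<epsilon>)"
      using \<epsilon> moment_const_nonneg[of \<alpha>] by (simp add: nn_integral_cmult_indicator ennreal_mult)
    finally show ?thesis .
  qed
  have m3: "(\<integral>\<^sup>+ \<omega>. \<integral>\<^sup>+ s. ennreal (w3 s * rpow0 (?v s \<omega>) (\<alpha> + 1)) \<partial>lborel \<partial>M) \<le> ennreal (moment_const (\<alpha> + 1) / R)"
  proof -
    have "(\<integral>\<^sup>+ \<omega>. \<integral>\<^sup>+ s. ennreal (w3 s * rpow0 (?v s \<omega>) (\<alpha> + 1)) \<partial>lborel \<partial>M) \<le> (\<integral>\<^sup>+ s. ennreal (moment_const (\<alpha> + 1) * (w3 s * s powr (\<alpha> + 1))) \<partial>lborel)"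
      by (rule weighted_moment_scaled[OF c _ wm(3) w0(3)])
        (use b \<epsilon> \<alpha> in \<open>auto simp: w3_def w2_def indicator_def split: if_splits\<close>)
    also have "\<dots> \<le> (\<integral>\<^sup>+ s. ennreal (moment_const (\<alpha> + 1) / R) * indicator {0..1::real} s \<partial>lborel)"
    proof (rule nn_integral_mono)
      fix s :: real
      have "w3 s * s powr (\<alpha> + 1) \<le> 1 / R * indicator {0..1} s"
      proof (cases "s \<in> {\<epsilon>..1}")
        case True
        have "s powr (\<gamma> + (\<alpha> + 1)) \<le> 1" using True \<epsilon> \<gamma> by (intro powr_le1) auto
        then show ?thesis using True \<epsilon> R by (simp add: w3_def w2_def powr_add[symmetric] divide_right_mono)
      qed (use R in \<open>simp add: w3_def w2_def\<close>)
      then have "moment_const (\<alpha> + 1) * (w3 s * s powr (\<alpha> + 1)) \<le> moment_const (\<alpha> + 1) * (1 / R * indicator {0..1} s)"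
        by (rule mult_left_mono) (rule moment_const_nonneg)
      then show "ennreal (moment_const (\<alpha> + 1) * (w3 s * s powr (\<alpha> + 1))) \<le> ennreal (moment_const (\<alpha> + 1) / R) * indicator {0..1} s"
        by (cases "s \<in> {0..1}") (auto intro: ennreal_leI simp: ennreal_neg)
    qed
    also have "\<dots> = ennreal (moment_const (\<alpha> + 1) / R)"
      by (simp add: nn_integral_cmult_indicator)
    finally show ?thesis .
  qed
  have m2: "(\<integral>\<^sup>+ s. ennreal (\<zeta> * w2 s) \<partial>lborel) \<le> ennreal (\<zeta> * (1 + \<epsilon> powr \<gamma>))"
  proof -
    have "(\<integral>\<^sup>+ s. ennreal (\<zeta> * w2 s) \<partial>lborel) = ennreal \<zeta> * (\<integral>\<^sup>+ s. ennreal (w2 s) \<partial>lborel)"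
      using \<zeta> by (simp add: ennreal_mult' nn_integral_cmult)
    also have "\<dots> \<le> ennreal \<zeta> * ennreal (1 + \<epsilon> powr \<gamma>)"
      unfolding w2_def by (intro mult_left_mono weight_props(4)[OF \<epsilon>]) simp
    also have "\<dots> = ennreal (\<zeta> * (1 + \<epsilon> powr \<gamma>))" using \<zeta> by (simp add: ennreal_mult')
    finally show ?thesis .
  qed
  have "(\<integral>\<^sup>+ \<omega>. ennreal \<bar>scaled_A \<alpha> \<gamma> c b \<omega> - functional (weight \<epsilon> \<gamma>) a n c \<omega>\<bar> \<partial>M) \<le>
    (\<integral>\<^sup>+ \<omega>. \<integral>\<^sup>+ s. ennreal (w1 s * rpow0 (?v s \<omega>) \<alpha>) + ennreal (w3 s * rpow0 (?v s \<omega>) (\<alpha> + 1)) + ennreal (\<zeta> * w2 s) \<partial>lborel \<partial>M)"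
    by (rule nn_integral_mono) (rule path)
  also have "\<dots> = (\<integral>\<^sup>+ \<omega>. (\<integral>\<^sup>+ s. ennreal (w1 s * rpow0 (?v s \<omega>) \<alpha>) \<partial>lborel) + (\<integral>\<^sup>+ s. ennreal (w3 s * rpow0 (?v s \<omega>) (\<alpha> + 1)) \<partial>lborel)
      + (\<integral>\<^sup>+ s. ennreal (\<zeta> * w2 s) \<partial>lborel) \<partial>M)"
  proof (rule nn_integral_cong)
    fix \<omega> assume \<omega>: "\<omega> \<in> space M"
    have vm [measurable]: "(\<lambda>s. V (c * s) \<omega>) \<in> borel_measurable borel"
      using measurable_compose[OF _ V_measurable_path[OF \<omega>], of "\<lambda>s. c * s" borel] by simp
    show "(\<integral>\<^sup>+ s. ennreal (w1 s * rpow0 (?v s \<omega>) \<alpha>) + ennreal (w3 s * rpow0 (?v s \<omega>) (\<alpha> + 1)) + ennreal (\<zeta> * w2 s) \<partial>lborel) =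
      (\<integral>\<^sup>+ s. ennreal (w1 s * rpow0 (?v s \<omega>) \<alpha>) \<partial>lborel) + (\<integral>\<^sup>+ s. ennreal (w3 s * rpow0 (?v s \<omega>) (\<alpha> + 1)) \<partial>lborel)
      + (\<integral>\<^sup>+ s. ennreal (\<zeta> * w2 s) \<partial>lborel)"
      by (simp add: nn_integral_add)
  qed
  also have "\<dots> = (\<integral>\<^sup>+ \<omega>. \<integral>\<^sup>+ s. ennreal (w1 s * rpow0 (?v s \<omega>) \<alpha>) \<partial>lborel \<partial>M) + (\<integral>\<^sup>+ \<omega>. \<integral>\<^sup>+ s. ennreal (w3 s * rpow0 (?v s \<omega>) (\<alpha> + 1)) \<partial>lborel \<partial>M)
      + (\<integral>\<^sup>+ s. ennreal (\<zeta> * w2 s) \<partial>lborel)"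
    by (simp add: nn_integral_add emeasure_space_1)
  also have "\<dots> \<le> ennreal (moment_const \<alpha> * \<epsilon>) + ennreal (moment_const (\<alpha> + 1) / R) + ennreal (\<zeta> * (1 + \<epsilon> powr \<gamma>))"
    by (intro add_mono m1 m2 m3)
  also have "\<dots> = ennreal (moment_const \<alpha> * \<epsilon> + moment_const (\<alpha> + 1) / R + \<zeta> * (1 + \<epsilon> powr \<gamma>))"
    using moment_const_nonneg[of \<alpha>] moment_const_nonneg[of "\<alpha> + 1"] \<epsilon> R \<zeta>
    by (simp add: ennreal_plus[symmetric] add_nonneg_nonneg del: ennreal_plus)
  finally show ?thesis .
qed

lemma lipschitz_expectation_diff:
  fixes f :: "real \<Rightarrow> real"
  assumes f: "\<And>x x'. \<bar>f x - f x'\<bar> \<le> L * \<bar>x - x'\<bar>" "\<And>x. \<bar>f x\<bar> \<le> B" "f \<in> borel_measurable borel"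
    and [measurable]: "X \<in> borel_measurable M" "X' \<in> borel_measurable M"
    and L: "0 \<le> L" and \<tau>: "0 \<le> \<tau>" "(\<integral>\<^sup>+ \<omega>. ennreal \<bar>X \<omega> - X' \<omega>\<bar> \<partial>M) \<le> ennreal \<tau>"
  shows "\<bar>expectation (\<lambda>\<omega>. f (X \<omega>)) - expectation (\<lambda>\<omega>. f (X' \<omega>))\<bar> \<le> L * \<tau>"
proof -
  note [measurable] = f(3)
  have i: "integrable M (\<lambda>\<omega>. f (X \<omega>))" "integrable M (\<lambda>\<omega>. f (X' \<omega>))"
    by (rule bounded_integrable[OF _ f(2)]; measurable)+
  have "\<bar>expectation (\<lambda>\<omega>. f (X \<omega>)) - expectation (\<lambda>\<omega>. f (X' \<omega>))\<bar> = \<bar>expectation (\<lambda>\<omega>. f (X \<omega>) - f (X' \<omega>))\<bar>"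
    using i by simp
  also have "\<dots> \<le> expectation (\<lambda>\<omega>. \<bar>f (X \<omega>) - f (X' \<omega>)\<bar>)" by (rule integral_abs_bound)
  finally have "ennreal \<bar>expectation (\<lambda>\<omega>. f (X \<omega>)) - expectation (\<lambda>\<omega>. f (X' \<omega>))\<bar> \<le> ennreal (expectation (\<lambda>\<omega>. \<bar>f (X \<omega>) - f (X' \<omega>)\<bar>))"
    by (rule ennreal_leI)
  also have "\<dots> \<le> (\<integral>\<^sup>+ \<omega>. ennreal \<bar>f (X \<omega>) - f (X' \<omega>)\<bar> \<partial>M)" by (rule ennreal_integral_le) simp
  also have "\<dots> \<le> (\<integral>\<^sup>+ \<omega>. ennreal L * ennreal \<bar>X \<omega> - X' \<omega>\<bar> \<partial>M)"
    using f(1) L by (intro nn_integral_mono) (auto simp: ennreal_mult'[symmetric] intro!: ennreal_leI)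
  also have "\<dots> = ennreal L * (\<integral>\<^sup>+ \<omega>. ennreal \<bar>X \<omega> - X' \<omega>\<bar> \<partial>M)" by (rule nn_integral_cmult) measurable
  also have "\<dots> \<le> ennreal L * ennreal \<tau>" by (intro mult_left_mono \<tau>) simp
  also have "\<dots> = ennreal (L * \<tau>)" using L by (simp add: ennreal_mult')
  finally show ?thesis using L \<tau> by (subst (asm) ennreal_le_iff) auto
qed

end

lemma polynomial_expectation_approx:
  fixes f g :: "real \<Rightarrow> real"
  assumes "prob_space N" and X [measurable]: "X \<in> borel_measurable N" and XK: "\<And>\<omega>. X \<omega> \<in> {- K..K}"
    and fm: "f \<in> borel_measurable borel" and bm: "g = (\<lambda>x. \<Sum>i\<le>m. b i * x ^ i)"
    and g: "\<And>x. x \<in> {- K..K} \<Longrightarrow> \<bar>f x - g x\<bar> < e"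
  shows "\<bar>prob_space.expectation N (\<lambda>\<omega>. f (X \<omega>)) - (\<Sum>i\<le>m. b i * prob_space.expectation N (\<lambda>\<omega>. X \<omega> ^ i))\<bar> \<le> e"
proof -
  interpret N: prob_space N by fact
  note [measurable] = fm
  have gm [measurable]: "g \<in> borel_measurable borel" unfolding bm by measurable
  have pi: "integrable N (\<lambda>\<omega>. X \<omega> ^ i)" for i
  proof (rule N.integrable_const_bound[where B = "\<bar>K\<bar> ^ i"])
    show "AE \<omega> in N. norm (X \<omega> ^ i) \<le> \<bar>K\<bar> ^ i"
    proof (rule AE_I2)
      fix \<omega>
      have "\<bar>X \<omega>\<bar> \<le> \<bar>K\<bar>" using XK[of \<omega>] by auto
      then show "norm (X \<omega> ^ i) \<le> \<bar>K\<bar> ^ i" by (simp add: power_abs power_mono)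
    qed
  qed measurable
  have gi: "integrable N (\<lambda>\<omega>. g (X \<omega>))" unfolding bm using pi by auto
  have dm: "integrable N (\<lambda>\<omega>. f (X \<omega>) - g (X \<omega>))"
  proof (rule N.integrable_const_bound[where B = "e"])
    show "AE \<omega> in N. norm (f (X \<omega>) - g (X \<omega>)) \<le> e"
      using g[OF XK] by (intro AE_I2) (simp add: less_imp_le)
  qed measurable
  have fi: "integrable N (\<lambda>\<omega>. f (X \<omega>))" using Bochner_Integration.integrable_add[OF dm gi] by simp
  have ge: "(\<Sum>i\<le>m. b i * N.expectation (\<lambda>\<omega>. X \<omega> ^ i)) = N.expectation (\<lambda>\<omega>. g (X \<omega>))"
    unfolding bm using pi by simp
  have "\<bar>N.expectation (\<lambda>\<omega>. f (X \<omega>)) - N.expectation (\<lambda>\<omega>. g (X \<omega>))\<bar> = \<bar>N.expectation (\<lambda>\<omega>. f (X \<omega>) - g (X \<omega>))\<bar>"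
    using fi gi by simp
  also have "\<dots> \<le> N.expectation (\<lambda>\<omega>. \<bar>f (X \<omega>) - g (X \<omega>)\<bar>)" by (rule integral_abs_bound)
  also have "\<dots> \<le> N.expectation (\<lambda>\<omega>. e)"
  proof (rule integral_mono)
    show "integrable N (\<lambda>\<omega>. \<bar>f (X \<omega>) - g (X \<omega>)\<bar>)" by (rule integrable_abs[OF dm])
    show "\<bar>f (X \<omega>) - g (X \<omega>)\<bar> \<le> e" for \<omega> using g[OF XK[of \<omega>]] by simp
  qed simp
  finally show ?thesis unfolding ge by (simp add: N.prob_space)
qed

context besq_pair
begin

text \<open>Method of moments: for all c > 0 the functionals take values in one compact interval, on
  which f is uniformly close to a polynomial.\<close>

lemma functional_tendsto:
  fixes f :: "real \<Rightarrow> real"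
  assumes \<mu>: "finite_measure \<mu>" "sets \<mu> = sets borel" "AE s in \<mu>. 0 \<le> s"
    and f: "continuous_on UNIV f"
  shows "((\<lambda>c. P1.expectation (\<lambda>\<omega>. f (P1.functional \<mu> a n c \<omega>))) \<longlongrightarrow>
      P2.expectation (\<lambda>\<omega>. f (P2.functional \<mu> a n 1 \<omega>))) at_top"
proof (rule tendstoI)
  fix e :: real assume e: "0 < e"
  define K where "K = (\<Sum>i\<le>n. \<bar>a i\<bar>) * measure \<mu> UNIV"
  note fm = borel_measurable_continuous_onI[OF f]
  obtain g where g: "real_polynomial_function g" "\<And>x. x \<in> {- K..K} \<Longrightarrow> \<bar>f x - g x\<bar> < e / 4"
    using Stone_Weierstrass_real_polynomial_function[of "{- K..K}" f "e / 4"] e continuous_on_subset[OF f] by auto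
  obtain b m where bm: "g = (\<lambda>x. \<Sum>i\<le>m. b i * x ^ i)" using g(1) unfolding real_polynomial_function_iff_sum by blast
  have K1: "P1.functional \<mu> a n c \<omega> \<in> {- K..K}" if "0 < c" for c \<omega>
    using P1.functional_props(2)[OF \<mu>(1,2) that, of a n \<omega>] by (auto simp: K_def abs_le_iff)
  have K2: "P2.functional \<mu> a n 1 \<omega> \<in> {- K..K}" for \<omega>
    using P2.functional_props(2)[OF \<mu>(1,2) zero_less_one, of a n \<omega>] by (auto simp: K_def abs_le_iff)
  \<comment> \<open>With no times the factor \<open>joint\<close> is 1, and the pure moments
    remain.\<close>
  have pw: "((\<lambda>c. P1.expectation (\<lambda>\<omega>. P1.functional \<mu> a n c \<omega> ^ k)) \<longlongrightarrow> P2.expectation (\<lambda>\<omega>. P2.functional \<mu> a n 1 \<omega> ^ k)) at_top" for k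
    using functional_moments_tendsto[OF \<mu>, of "{}" "\<lambda>_. 0" a n k] by (simp add: P1.joint_def P2.joint_def)
  have "((\<lambda>c. \<Sum>i\<le>m. b i * P1.expectation (\<lambda>\<omega>. P1.functional \<mu> a n c \<omega> ^ i)) \<longlongrightarrow>
    (\<Sum>i\<le>m. b i * P2.expectation (\<lambda>\<omega>. P2.functional \<mu> a n 1 \<omega> ^ i))) at_top"
    by (intro tendsto_intros pw)
  from tendstoD[OF this, of "e / 4"] e
  have "eventually (\<lambda>c. dist (\<Sum>i\<le>m. b i * P1.expectation (\<lambda>\<omega>. P1.functional \<mu> a n c \<omega> ^ i))
    (\<Sum>i\<le>m. b i * P2.expectation (\<lambda>\<omega>. P2.functional \<mu> a n 1 \<omega> ^ i)) < e / 4) at_top" by simp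
  with eventually_gt_at_top[of 0]
  show "eventually (\<lambda>c. dist (P1.expectation (\<lambda>\<omega>. f (P1.functional \<mu> a n c \<omega>))) (P2.expectation (\<lambda>\<omega>. f (P2.functional \<mu> a n 1 \<omega>))) < e) at_top"
  proof eventually_elim
    case (elim c)
    have b1: "\<bar>P1.expectation (\<lambda>\<omega>. f (P1.functional \<mu> a n c \<omega>)) - (\<Sum>i\<le>m. b i * P1.expectation (\<lambda>\<omega>. P1.functional \<mu> a n c \<omega> ^ i))\<bar> \<le> e / 4"
      by (rule polynomial_expectation_approx[OF P1.prob_space_axioms P1.functional_props(1)[OF \<mu>(1,2) elim(1)] K1[OF elim(1)] fm bm g(2)])
    have b2: "\<bar>P2.expectation (\<lambda>\<omega>. f (P2.functional \<mu> a n 1 \<omega>)) - (\<Sum>i\<le>m. b i * P2.expectation (\<lambda>\<omega>. P2.functional \<mu> a n 1 \<omega> ^ i))\<bar> \<le> e / 4"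
      by (rule polynomial_expectation_approx[OF P2.prob_space_axioms P2.functional_props(1)[OF \<mu>(1,2) zero_less_one] K2 fm bm g(2)])
    show ?case using b1 b2 elim(2) e unfolding dist_real_def by linarith
  qed
qed

text \<open>The Lipschitz bound converts errors in mean into errors of expectations. All parameters
  are fixed before c: \<epsilon> and R first, then \<zeta> small against \<epsilon>^\<gamma>, which
  may be large for negative \<gamma>. The resulting error is uniform over c \<ge> 1 / \<epsilon>, so
  the limit can be taken for the functional alone.\<close>

lemma lipschitz_tendsto:
  fixes f :: "real \<Rightarrow> real"
  assumes \<alpha>: "0 \<le> \<alpha>" and \<gamma>: "- \<alpha> < \<gamma>"
    and f: "\<And>x x'. \<bar>f x - f x'\<bar> \<le> L * \<bar>x - x'\<bar>" "\<And>x. \<bar>f x\<bar> \<le> B" "continuous_on UNIV f" and L: "0 \<le> L"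
  shows "((\<lambda>c. P1.expectation (\<lambda>\<omega>. f (P1.scaled_A \<alpha> \<gamma> c (1 / c) \<omega>))) \<longlongrightarrow>
      P2.expectation (\<lambda>\<omega>. f (P2.scaled_A \<alpha> \<gamma> 1 0 \<omega>))) at_top"
proof (rule tendstoI)
  fix e :: real assume e: "0 < e"
  note fm = borel_measurable_continuous_onI[OF f(3)]
  define \<tau> where "\<tau> = e / (4 * (L + 1))"
  have \<tau>: "0 < \<tau>" "L * \<tau> \<le> e / 4"
  proof -
    show "0 < \<tau>" using e L by (simp add: \<tau>_def)
    have "L * \<tau> \<le> (L + 1) * \<tau>" using \<open>0 < \<tau>\<close> by (intro mult_right_mono) auto
    also have "\<dots> = e / 4" using L by (simp add: \<tau>_def divide_simps) (simp add: algebra_simps)?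
    finally show "L * \<tau> \<le> e / 4" .
  qed
  \<comment> \<open>The moment constants depend on the start and differ for the two processes; C
    dominates them all, for both orders \<alpha> and \<alpha> + 1.\<close>
  define C where "C = 1 + P1.moment_const \<alpha> + P2.moment_const \<alpha> + P1.moment_const (\<alpha> + 1) + P2.moment_const (\<alpha> + 1)"
  note mc = P1.moment_const_nonneg[of \<alpha>] P2.moment_const_nonneg[of \<alpha>] P1.moment_const_nonneg[of "\<alpha> + 1"] P2.moment_const_nonneg[of "\<alpha> + 1"]
  have C: "1 \<le> C" using mc by (simp add: C_def)
  define \<epsilon> where "\<epsilon> = min 1 (\<tau> / (3 * C))"
  have \<epsilon>: "0 < \<epsilon>" "\<epsilon> \<le> 1" "C * \<epsilon> \<le> \<tau> / 3"
  proof -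
    show "0 < \<epsilon>" "\<epsilon> \<le> 1" using \<tau> C by (auto simp: \<epsilon>_def)
    have "C * \<epsilon> \<le> C * (\<tau> / (3 * C))" using C by (intro mult_left_mono) (auto simp: \<epsilon>_def)
    also have "\<dots> = \<tau> / 3" using C by simp
    finally show "C * \<epsilon> \<le> \<tau> / 3" .
  qed
  define R where "R = 3 * C / \<tau>"
  have R: "0 < R" "C / R = \<tau> / 3" using C \<tau> by (auto simp: R_def)
  define \<zeta> where "\<zeta> = \<tau> / (3 * (1 + \<epsilon> powr \<gamma>))"
  have e1: "0 < 1 + \<epsilon> powr \<gamma>" by (simp add: add_pos_nonneg)
  have \<zeta>: "0 < \<zeta>" "\<zeta> * (1 + \<epsilon> powr \<gamma>) = \<tau> / 3" using \<tau> e1 by (auto simp: \<zeta>_def field_simps)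
  obtain a n where an: "\<And>v. 0 \<le> v \<Longrightarrow> \<bar>rpow0 (min v R) \<alpha> - (\<Sum>i\<le>n. a i * exp (- v) ^ i)\<bar> \<le> \<zeta>"
    using truncated_power_approx[OF \<zeta>(1) R(1) \<alpha>] by blast
  have small: "x * \<epsilon> + z / R + \<zeta> * (1 + \<epsilon> powr \<gamma>) \<le> \<tau>" if "x \<le> C" "z \<le> C" for x z
  proof -
    have "x * \<epsilon> \<le> C * \<epsilon>" using that \<epsilon> by (intro mult_right_mono) auto
    moreover have "z / R \<le> C / R" using that R by (intro divide_right_mono) auto
    ultimately show ?thesis using \<epsilon>(3) R(2) \<zeta>(2) by linarith
  qed
  let ?\<mu> = "P1.weight \<epsilon> \<gamma>"
  note wp = P1.weight_props[OF \<epsilon>(1,2), of \<gamma>]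
  have d2: "\<bar>P2.expectation (\<lambda>\<omega>. f (P2.scaled_A \<alpha> \<gamma> 1 0 \<omega>)) - P2.expectation (\<lambda>\<omega>. f (P2.functional ?\<mu> a n 1 \<omega>))\<bar> \<le> L * \<tau>"
  proof (rule P2.lipschitz_expectation_diff[OF f(1,2) fm P2.scaled_A_measurable P2.functional_props(1)[OF wp(1,2) zero_less_one] L])
    have "(\<integral>\<^sup>+ \<omega>. ennreal \<bar>P2.scaled_A \<alpha> \<gamma> 1 0 \<omega> - P2.functional ?\<mu> a n 1 \<omega>\<bar> \<partial>M') \<le>
      ennreal (P2.moment_const \<alpha> * \<epsilon> + P2.moment_const (\<alpha> + 1) / R + \<zeta> * (1 + \<epsilon> powr \<gamma>))"
      by (rule P2.approx_error[OF zero_less_one \<alpha> \<gamma> \<epsilon>(1,2) order_refl _ _ R(1) _ an]) (use \<epsilon> \<zeta> in auto)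
    also have "\<dots> \<le> ennreal \<tau>" using mc by (intro ennreal_leI small) (auto simp: C_def)
    finally show "(\<integral>\<^sup>+ \<omega>. ennreal \<bar>P2.scaled_A \<alpha> \<gamma> 1 0 \<omega> - P2.functional ?\<mu> a n 1 \<omega>\<bar> \<partial>M') \<le> ennreal \<tau>" .
  qed (use \<tau> in simp)
  have "((\<lambda>c. P1.expectation (\<lambda>\<omega>. f (P1.functional ?\<mu> a n c \<omega>))) \<longlongrightarrow> P2.expectation (\<lambda>\<omega>. f (P2.functional ?\<mu> a n 1 \<omega>))) at_top"
    by (rule functional_tendsto[OF wp(1-3) f(3)])
  from tendstoD[OF this, of "e / 4"] e
  have "eventually (\<lambda>c. dist (P1.expectation (\<lambda>\<omega>. f (P1.functional ?\<mu> a n c \<omega>))) (P2.expectation (\<lambda>\<omega>. f (P2.functional ?\<mu> a n 1 \<omega>))) < e / 4) at_top"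
    by simp
  with eventually_ge_at_top[of "1 / \<epsilon>"]
  show "eventually (\<lambda>c. dist (P1.expectation (\<lambda>\<omega>. f (P1.scaled_A \<alpha> \<gamma> c (1 / c) \<omega>))) (P2.expectation (\<lambda>\<omega>. f (P2.scaled_A \<alpha> \<gamma> 1 0 \<omega>))) < e) at_top"
  proof eventually_elim
    case (elim c)
    have c: "0 < c" using elim(1) \<epsilon> by (auto intro: less_le_trans[of 0 "1 / \<epsilon>"])
    have ce: "1 / c \<le> \<epsilon>" using elim(1) \<epsilon> c by (simp add: field_simps)
    have d1: "\<bar>P1.expectation (\<lambda>\<omega>. f (P1.scaled_A \<alpha> \<gamma> c (1 / c) \<omega>)) - P1.expectation (\<lambda>\<omega>. f (P1.functional ?\<mu> a n c \<omega>))\<bar> \<le> L * \<tau>"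
    proof (rule P1.lipschitz_expectation_diff[OF f(1,2) fm P1.scaled_A_measurable P1.functional_props(1)[OF wp(1,2) c] L])
      have "(\<integral>\<^sup>+ \<omega>. ennreal \<bar>P1.scaled_A \<alpha> \<gamma> c (1 / c) \<omega> - P1.functional ?\<mu> a n c \<omega>\<bar> \<partial>M) \<le>
        ennreal (P1.moment_const \<alpha> * \<epsilon> + P1.moment_const (\<alpha> + 1) / R + \<zeta> * (1 + \<epsilon> powr \<gamma>))"
      proof (rule P1.approx_error[OF c \<alpha> \<gamma> \<epsilon>(1,2) _ ce _ R(1) _ an])
        fix s assume "1 / c \<le> s"
        then have "1 \<le> c * s" using c by (simp add: field_simps)
        then show "y \<le> y * (c * s)" using P1.y_nonneg mult_left_mono[of 1 "c * s" y] by simp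
      qed (use c \<zeta> in auto)
      also have "\<dots> \<le> ennreal \<tau>" using mc by (intro ennreal_leI small) (auto simp: C_def)
      finally show "(\<integral>\<^sup>+ \<omega>. ennreal \<bar>P1.scaled_A \<alpha> \<gamma> c (1 / c) \<omega> - P1.functional ?\<mu> a n c \<omega>\<bar> \<partial>M) \<le> ennreal \<tau>" .
    qed (use \<tau> in simp)
    show ?case using d1 d2 \<tau>(2) elim(2) e unfolding dist_real_def by linarith
  qed
qed

text \<open>Continuous steps are Lipschitz and already determine weak convergence of the laws, which
  in turn gives every bounded continuous f. Weak convergence concerns sequences, so the limit is
  taken along an arbitrary sequence tending to infinity.\<close>

theorem scaled_A_converges:
  fixes f :: "real \<Rightarrow> real"
  assumes \<alpha>: "0 \<le> \<alpha>" and \<gamma>: "- \<alpha> < \<gamma>" and f: "continuous_on UNIV f" "\<And>x. \<bar>f x\<bar> \<le> B"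
  shows "((\<lambda>c. P1.expectation (\<lambda>\<omega>. f (P1.scaled_A \<alpha> \<gamma> c (1 / c) \<omega>))) \<longlongrightarrow>
      P2.expectation (\<lambda>\<omega>. f (P2.scaled_A \<alpha> \<gamma> 1 0 \<omega>))) at_top"
proof (rule tendsto_at_topI_sequentially)
  fix t :: "nat \<Rightarrow> real" assume t: "filterlim t at_top sequentially"
  let ?\<mu> = "\<lambda>k. distr M borel (P1.scaled_A \<alpha> \<gamma> (t k) (1 / t k))"
  let ?\<nu> = "distr M' borel (P2.scaled_A \<alpha> \<gamma> 1 0)"
  have r: "real_distribution (?\<mu> k)" "real_distribution ?\<nu>" for k
    by (intro P1.real_distribution_distr P2.real_distribution_distr; measurable)+
  have i: "integral\<^sup>L (?\<mu> k) g = P1.expectation (\<lambda>\<omega>. g (P1.scaled_A \<alpha> \<gamma> (t k) (1 / t k) \<omega>))"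
    "integral\<^sup>L ?\<nu> g = P2.expectation (\<lambda>\<omega>. g (P2.scaled_A \<alpha> \<gamma> 1 0 \<omega>))" if "continuous_on UNIV g" for g :: "real \<Rightarrow> real" and k
    using borel_measurable_continuous_onI[OF that] by (simp_all add: integral_distr)
  have w: "weak_conv_m ?\<mu> ?\<nu>"
  proof (rule integral_cts_step_conv_imp_weak_conv[OF r])
    fix a b :: real assume ab: "a < b"
    have c: "continuous_on UNIV (cts_step a b)"
      using cts_step_uniformly_continuous[OF ab] by (rule uniformly_continuous_imp_continuous)
    have "\<bar>cts_step a b x\<bar> \<le> 1" for x using ab by (auto simp: cts_step_def field_simps)
    from filterlim_compose[OF lipschitz_tendsto[OF \<alpha> \<gamma> cts_step_lipschitz[OF ab] this c] t] ab
    show "(\<lambda>k. integral\<^sup>L (?\<mu> k) (cts_step a b)) \<longlonglongrightarrow> integral\<^sup>L ?\<nu> (cts_step a b)"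
      unfolding i[OF c] by simp
  qed
  have "(\<lambda>k. integral\<^sup>L (?\<mu> k) f) \<longlonglongrightarrow> integral\<^sup>L ?\<nu> f"
    by (rule weak_conv_imp_integral_bdd_continuous_conv[OF r w, where B = B])
      (use f in \<open>auto simp: continuous_on_eq_continuous_at\<close>)
  then show "(\<lambda>k. P1.expectation (\<lambda>\<omega>. f (P1.scaled_A \<alpha> \<gamma> (t k) (1 / t k) \<omega>))) \<longlonglongrightarrow>
    P2.expectation (\<lambda>\<omega>. f (P2.scaled_A \<alpha> \<gamma> 1 0 \<omega>))"
    unfolding i[OF f(1)] .
qed

end

section \<open>Return from the nonnegative version to Y\<close>

context besq_sol
begin

text \<open>Almost sure equality with the integral of V does not transfer measurability, since M
  need not be complete, so joint measurability is established for Y itself; \<open>max 0 s\<close>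
  extends the paths continuously to negative times.\<close>

lemma set_integral_Y_measurable:
  assumes "S \<in> sets borel" "S \<subseteq> {0..}"
  shows "(\<lambda>\<omega>. LINT s:S|lborel. s powr \<gamma> * rpow0 (Y s \<omega>) \<alpha>) \<in> borel_measurable M"
proof -
  note [measurable] = assms(1)
  have "(\<lambda>p. Y (max 0 (fst p)) (snd p)) \<in> borel_measurable (lborel \<Otimes>\<^sub>M M)"
  proof (rule continuous_process_measurable[where X = "\<lambda>s. Y (max 0 s)"])
    show "continuous_on UNIV (\<lambda>s. Y (max 0 s) \<omega>)" if "\<omega> \<in> space M" for \<omega>
      by (rule continuous_on_compose2[OF Y_continuous[OF that], where f = "max 0"]) (auto intro: continuous_intros)
  qed simp
  moreover have "(\<lambda>p. (snd p, fst p)) \<in> measurable (M \<Otimes>\<^sub>M lborel) (lborel \<Otimes>\<^sub>M M)" by measurable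
  ultimately have "(\<lambda>p. Y (max 0 (snd p)) (fst p)) \<in> borel_measurable (M \<Otimes>\<^sub>M lborel)"
    using measurable_compose[of "\<lambda>p. (snd p, fst p)" "M \<Otimes>\<^sub>M lborel" "lborel \<Otimes>\<^sub>M M" "\<lambda>p. Y (max 0 (fst p)) (snd p)" borel] by simp
  note [measurable] = this
  have "(\<lambda>\<omega>. \<integral>s. indicator S s *\<^sub>R (s powr \<gamma> * rpow0 (Y (max 0 s) \<omega>) \<alpha>) \<partial>lborel) \<in> borel_measurable M"
    by measurable
  moreover have "indicator S s *\<^sub>R (s powr \<gamma> * rpow0 (Y (max 0 s) \<omega>) \<alpha>) = indicator S s *\<^sub>R (s powr \<gamma> * rpow0 (Y s \<omega>) \<alpha>)" for s \<omega>
    using assms(2) by (auto simp: indicator_def max_def)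
  ultimately show ?thesis unfolding set_lebesgue_integral_def by (simp only:)
qed

end

theorem theorem4p1:
  fixes M :: "'a measure" and F :: "real \<Rightarrow> 'a set set" and W Y :: "real \<Rightarrow> 'a \<Rightarrow> real"
    and \<delta> y \<alpha> \<gamma> :: real and A :: "real \<Rightarrow> 'a \<Rightarrow> real"
  assumes sol: "besq_solution M F W \<delta> y Y"
    and \<delta>_pos: "\<delta> > 0" and y_nonneg: "y \<ge> 0"
    and \<alpha>_nonneg: "\<alpha> \<ge> 0" and \<gamma>_gt: "\<gamma> > - \<alpha>"
    and A_def: "\<And>t \<omega>. A t \<omega> = (LINT s:{1..t}|lborel. s powr \<gamma> * rpow0 (Y s \<omega>) \<alpha>)"
  shows "(AE \<omega> in M. ((\<lambda>t. ln (A t \<omega>) / ln t) \<longlongrightarrow> 1 + \<gamma> + \<alpha>) at_top)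
       \<and> (\<forall>(M' :: 'b measure) F' W' Y'. besq_solution M' F' W' \<delta> 0 Y' \<longrightarrow>
           conv_distr_at_top M (\<lambda>t \<omega>. A t \<omega> / t powr (1 + \<gamma> + \<alpha>)) M'
             (\<lambda>\<omega>'. LINT s:{0..1}|lborel. s powr \<gamma> * rpow0 (Y' s \<omega>') \<alpha>))
       \<and> (\<exists>C::real. \<forall>t\<ge>1. (\<integral>\<^sup>+ \<omega>. ennreal (A t \<omega>) \<partial>M) \<le> ennreal (C * t powr (1 + \<gamma> + \<alpha>)))"
proof -
  interpret S: besq_sol M F W Y \<delta> y
    by unfold_locales fact+
  \<comment> \<open>One null set for all t together, as the limit in (a) concerns the whole
    path.\<close>
  have AE_A: "AE \<omega> in M. \<forall>t. A t \<omega> = S.A \<alpha> \<gamma> t \<omega>"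
    using S.set_integral_V_eq[of \<gamma> \<alpha>] by eventually_elim (auto simp: A_def S.A_def)
  have a: "AE \<omega> in M. ((\<lambda>t. ln (A t \<omega>) / ln t) \<longlongrightarrow> 1 + \<gamma> + \<alpha>) at_top"
    using AE_A S.A_log_asymptotics[OF \<alpha>_nonneg \<gamma>_gt] by eventually_elim simp
  have c: "\<exists>C::real. \<forall>t\<ge>1. (\<integral>\<^sup>+ \<omega>. ennreal (A t \<omega>) \<partial>M) \<le> ennreal (C * t powr (1 + \<gamma> + \<alpha>))"
  proof (intro exI[of _ "S.moment_const \<alpha>"] allI impI)
    fix t :: real assume t: "1 \<le> t"
    have "(\<integral>\<^sup>+ \<omega>. ennreal (A t \<omega>) \<partial>M) = (\<integral>\<^sup>+ \<omega>. ennreal (S.A \<alpha> \<gamma> t \<omega>) \<partial>M)"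
      by (rule nn_integral_cong_AE) (use AE_A in \<open>eventually_elim, simp\<close>)
    also have "\<dots> \<le> ennreal (S.moment_const \<alpha> * t powr (1 + \<gamma> + \<alpha>))"
      by (rule S.A_expectation[OF \<alpha>_nonneg \<gamma>_gt t])
    finally show "(\<integral>\<^sup>+ \<omega>. ennreal (A t \<omega>) \<partial>M) \<le> ennreal (S.moment_const \<alpha> * t powr (1 + \<gamma> + \<alpha>))" .
  qed
  have b: "conv_distr_at_top M (\<lambda>t \<omega>. A t \<omega> / t powr (1 + \<gamma> + \<alpha>)) M'
             (\<lambda>\<omega>'. LINT s:{0..1}|lborel. s powr \<gamma> * rpow0 (Y' s \<omega>') \<alpha>)"
    if sol': "besq_solution M' F' W' \<delta> 0 Y'" for M' :: "'b measure" and F' W' Y'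
  proof -
    interpret Q: besq_pair M F W Y \<delta> y M' F' W' Y'
      by unfold_locales (use sol' \<delta>_pos in auto)
    show ?thesis
      unfolding conv_distr_at_top_def
    proof (intro allI impI, elim conjE exE)
      fix f :: "real \<Rightarrow> real" and B assume f: "continuous_on UNIV f" and B: "\<forall>x. \<bar>f x\<bar> \<le> B"
      note [measurable] = borel_measurable_continuous_onI[OF f]
      have e2: "integral\<^sup>L M' (\<lambda>\<omega>'. f (LINT s:{0..1}|lborel. s powr \<gamma> * rpow0 (Y' s \<omega>') \<alpha>)) =
        integral\<^sup>L M' (\<lambda>\<omega>. f (Q.P2.scaled_A \<alpha> \<gamma> 1 0 \<omega>))"
      proof (rule integral_cong_AE)
        show "(\<lambda>\<omega>'. f (LINT s:{0..1}|lborel. s powr \<gamma> * rpow0 (Y' s \<omega>') \<alpha>)) \<in> borel_measurable M'"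
          by (intro measurable_compose[OF Q.P2.set_integral_Y_measurable]) auto
        show "AE \<omega> in M'. f (LINT s:{0..1}|lborel. s powr \<gamma> * rpow0 (Y' s \<omega>) \<alpha>) = f (Q.P2.scaled_A \<alpha> \<gamma> 1 0 \<omega>)"
          using Q.P2.set_integral_V_eq[of \<gamma> \<alpha>] by eventually_elim (simp add: Q.P2.scaled_A_def)
      qed measurable
      have e1: "integral\<^sup>L M (\<lambda>\<omega>. f (A t \<omega> / t powr (1 + \<gamma> + \<alpha>))) = integral\<^sup>L M (\<lambda>\<omega>. f (S.scaled_A \<alpha> \<gamma> t (1 / t) \<omega>))"
        if t: "1 \<le> t" for t
      proof (rule integral_cong_AE)
        have [measurable]: "A t \<in> borel_measurable M"
          unfolding A_def by (rule S.set_integral_Y_measurable) auto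
        show "(\<lambda>\<omega>. f (A t \<omega> / t powr (1 + \<gamma> + \<alpha>))) \<in> borel_measurable M" by measurable
        show "AE \<omega> in M. f (A t \<omega> / t powr (1 + \<gamma> + \<alpha>)) = f (S.scaled_A \<alpha> \<gamma> t (1 / t) \<omega>)"
          using AE_A by eventually_elim (use t in \<open>simp add: S.A_scaling[symmetric]\<close>)
      qed measurable
      have "((\<lambda>t. integral\<^sup>L M (\<lambda>\<omega>. f (S.scaled_A \<alpha> \<gamma> t (1 / t) \<omega>))) \<longlongrightarrow>
        integral\<^sup>L M' (\<lambda>\<omega>. f (Q.P2.scaled_A \<alpha> \<gamma> 1 0 \<omega>))) at_top"
        by (rule Q.scaled_A_converges[OF \<alpha>_nonneg \<gamma>_gt f]) (use B in blast)
      then show "((\<lambda>t. integral\<^sup>L M (\<lambda>\<omega>. f (A t \<omega> / t powr (1 + \<gamma> + \<alpha>)))) \<longlongrightarrow>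
        integral\<^sup>L M' (\<lambda>\<omega>'. f (LINT s:{0..1}|lborel. s powr \<gamma> * rpow0 (Y' s \<omega>') \<alpha>))) at_top"
        unfolding e2 by (rule Lim_transform_eventually)
          (auto intro!: eventually_mono[OF eventually_ge_at_top[of 1]] simp: e1)
    qed
  qed
  show ?thesis using a b c by blast
qed

end
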